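(* Let $s=(s_n)_{n\ge0}$ be a normalized Stieltjes moment sequence which is indet(S), with N-extremal solutions $\mu_t$ and Friedrichs parameter $F(s)$. For $t\in[F(s),\infty)$ let $c_t=\xi(\mu_t)$ denote the smallest mass point in the support of $\mu_t$. The sequence $\tilde s(t)$ given by $$\tilde s(t)_n=s_{n+1}-c_t s_n,\quad n\ge0,$$ is a Stieltjes moment sequence which is determinate when $t=F(s)$ and indet(S) when $t>F(s)$. Moreover: (a) For $t=F(s)$ the unique measure with moments $\tilde s(F(s))$ is $(x-\xi_1)d\mu_{F(s)}(x)$, where $\xi_1=\xi(\mu_{F(s)})$. (b) For $F(s)<t<\infty$ and $t'\in[F(s),t]$ the measures $$\nu_{t'}:=(x-c_t)d\mu_{t'}(x)$$ are solutions to the moment problem for $\tilde s(t)$, and $\nu_t=(x-c_t)d\mu_t(x)$ is the Friedrichs solution. The measure $\nu_{F(s)}$ is N-extremal, while the measures $\nu_{t'}$ are not N-extremal when $F(s)<t'<t$.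
   Context: $\mathcal M^*$ denotes the set of positive Borel measures on $\mathbb R$ with infinite support and finite moments of every order. A measure $\mu\in\mathcal M^*$, and its moment sequence $s_n=\int x^n\,d\mu(x)$, $n\ge0$, is determinate if $\mu$ is the only measure in $\mathcal M^*$ with these moments, and indeterminate otherwise. $V=V(s)$ is the set of measures in $\mathcal M^*$ with moment sequence $s$ (the solutions); $s$ is normalized if $s_0=1$. For a measure $\mu$, $\xi(\mu):=\inf\operatorname{supp}(\mu)$. Let $s$ be normalized and indeterminate. Let $p_n$ be the orthonormal polynomials (degree $n$, positive leading coefficient) and $q_n(z)=\int\frac{p_n(z)-p_n(x)}{z-x}d\mu(x)$ ($\mu\in V$) the polynomials of the second kind. Define entire functions $A(z)=z\sum q_n(0)q_n(z)$, $B(z)=-1+z\sum q_n(0)p_n(z)$, $C(z)=1+z\sum p_n(0)q_n(z)$, $D(z)=z\sum p_n(0)p_n(z)$ (sums over $n\ge0$). For $t\in\mathbb R\cup\{\infty\}$ the N-extremal solution $\mu_t\in V$ (a discrete measure) is determined by $$\int\frac{d\mu_t(x)}{x-z}=-\frac{A(z)+tC(z)}{B(z)+tD(z)},\quad z\in\mathbb C\setminus\mathbb R,$$ with right-hand side $-C(z)/D(z)$ for $t=\infty$. An indeterminate measure $\mu$ is N-extremal iff $\mathbb C[x]$ is dense in $L^2(\mu)$ (M. Riesz). A moment sequence $s$ is Stieltjes if some $\mu\in V$ is supported in $[0,\infty)$. An indeterminate Stieltjes $s$ is det(S) if there is exactly one such $\mu\in V$, and indet(S) if there is more than one. For $s$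 indeterminate and Stieltjes put $\alpha(s)=\lim_{n\to\infty}p_n(0)/q_n(0)=\lim_{x\to-\infty}D(x)/B(x)\le 0$; $s$ is det(S) iff $\alpha(s)=0$. The Friedrichs parameter is $F(s)=-1/\alpha(s)$ if $\alpha(s)<0$ and $F(s)=\infty$ if $\alpha(s)=0$. The measure $\mu_t$ is supported in $[0,\infty)$ iff $F(s)\le t\le\infty$. The Friedrichs solution is $\mu_F=\mu_{F(s)}$. For non-normalized moment sequences, N-extremal and Friedrichs solutions are defined by rescaling to total mass 1. *)

theory Defs
  imports "HOL-Analysis.Analysis" "HOL-Computational_Algebra.Polynomial"
begin

definition supp :: "real measure \<Rightarrow> real set" where
  "supp \<mu> = {x. \<forall>U. open U \<longrightarrow> x \<in> U \<longrightarrow> emeasure \<mu> U > 0}"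

definition \<xi> :: "real measure \<Rightarrow> real" where
  "\<xi> \<mu> = Inf (supp \<mu>)"

definition Mstar :: "real measure set" where
  "Mstar = {\<mu>. sets \<mu> = sets borel \<and> infinite (supp \<mu>) \<and> (\<forall>n::nat. integrable \<mu> (\<lambda>x. x ^ n))}"

definition V :: "(nat \<Rightarrow> real) \<Rightarrow> real measure set" where
  "V s = {\<mu> \<in> Mstar. \<forall>n. (\<integral>x. x ^ n \<partial>\<mu>) = s n}"

definition determinate :: "(nat \<Rightarrow> real) \<Rightarrow> bool" where
  "determinate s \<longleftrightarrow> (\<exists>\<mu>. V s = {\<mu>})"

definition indeterminate :: "(nat \<Rightarrow> real) \<Rightarrow> bool" where
  "indeterminate s \<longleftrightarrow> V s \<noteq> {} \<and> \<not> determinate s"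

definition normalized :: "(nat \<Rightarrow> real) \<Rightarrow> bool" where
  "normalized s \<longleftrightarrow> s 0 = 1"

definition stieltjes :: "(nat \<Rightarrow> real) \<Rightarrow> bool" where
  "stieltjes s \<longleftrightarrow> (\<exists>\<mu>\<in>V s. supp \<mu> \<subseteq> {0..})"

definition indet_S :: "(nat \<Rightarrow> real) \<Rightarrow> bool" where
  "indet_S s \<longleftrightarrow> indeterminate s \<and> stieltjes s \<and>
     (\<exists>\<mu>\<in>V s. \<exists>\<nu>\<in>V s. supp \<mu> \<subseteq> {0..} \<and> supp \<nu> \<subseteq> {0..} \<and> \<mu> \<noteq> \<nu>)"

text \<open>The integrals in the next two definitions do not depend on the choice of a solution, since
  the integrands are polynomials in \<open>x\<close>; hence the quantification over all of \<open>V s\<close>.\<close>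

definition orthonormal_poly :: "(nat \<Rightarrow> real) \<Rightarrow> nat \<Rightarrow> real poly" where
  "orthonormal_poly s = (THE p.
     (\<forall>n. degree (p n) = n \<and> lead_coeff (p n) > 0) \<and>
     (\<forall>\<mu>\<in>V s. \<forall>m n. (\<integral>x. poly (p m) x * poly (p n) x \<partial>\<mu>) = (if m = n then 1 else 0)))"

text \<open>The value on the diagonal matters, because a solution may have an atom at \<open>z\<close>.\<close>

definition diff_quotient :: "real poly \<Rightarrow> real \<Rightarrow> real \<Rightarrow> real" where
  "diff_quotient p z x =
     (if x = z then poly (pderiv p) z else (poly p z - poly p x) / (z - x))"

definition second_kind_poly :: "(nat \<Rightarrow> real) \<Rightarrow> nat \<Rightarrow> real poly" where
  "second_kind_poly s n = (THE q. \<forall>\<mu>\<in>V s. \<forall>z.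
     poly q z = (\<integral>x. diff_quotient (orthonormal_poly s n) z x \<partial>\<mu>))"

definition cpoly :: "real poly \<Rightarrow> complex \<Rightarrow> complex" where
  "cpoly p z = poly (map_poly complex_of_real p) z"

definition Nev_A :: "(nat \<Rightarrow> real) \<Rightarrow> complex \<Rightarrow> complex" where
  "Nev_A s z = z * (\<Sum>n. cpoly (second_kind_poly s n) 0 * cpoly (second_kind_poly s n) z)"

definition Nev_B :: "(nat \<Rightarrow> real) \<Rightarrow> complex \<Rightarrow> complex" where
  "Nev_B s z = - 1 + z * (\<Sum>n. cpoly (second_kind_poly s n) 0 * cpoly (orthonormal_poly s n) z)"

definition Nev_C :: "(nat \<Rightarrow> real) \<Rightarrow> complex \<Rightarrow> complex" where
  "Nev_C s z = 1 + z * (\<Sum>n. cpoly (orthonormal_poly s n) 0 * cpoly (second_kind_poly s n) z)"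

definition Nev_D :: "(nat \<Rightarrow> real) \<Rightarrow> complex \<Rightarrow> complex" where
  "Nev_D s z = z * (\<Sum>n. cpoly (orthonormal_poly s n) 0 * cpoly (orthonormal_poly s n) z)"

text \<open>The parameter ranges over the one-point compactification of the reals, represented by
  \<^typ>\<open>ereal\<close> with \<open>-\<infinity>\<close> and \<open>\<infinity>\<close> identified.\<close>

definition Nev_transform :: "(nat \<Rightarrow> real) \<Rightarrow> ereal \<Rightarrow> complex \<Rightarrow> complex" where
  "Nev_transform s t z =
     (if \<bar>t\<bar> = \<infinity> then - (Nev_C s z / Nev_D s z)
      else - ((Nev_A s z + of_real (real_of_ereal t) * Nev_C s z) /
              (Nev_B s z + of_real (real_of_ereal t) * Nev_D s z)))"

text \<open>\<open>N_ext s t\<close> is the solution \<open>\<mu>\<^sub>t\<close>; it is meaningful for normalized indeterminate \<open>s\<close>.\<close>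

definition N_ext :: "(nat \<Rightarrow> real) \<Rightarrow> ereal \<Rightarrow> real measure" where
  "N_ext s t = (THE \<mu>. \<mu> \<in> V s \<and>
     (\<forall>z. z \<notin> \<real> \<longrightarrow> (\<integral>x. 1 / (complex_of_real x - z) \<partial>\<mu>) = Nev_transform s t z))"

text \<open>The term for \<open>n = 0\<close> is a division by zero and is irrelevant for the limit.\<close>

definition \<alpha> :: "(nat \<Rightarrow> real) \<Rightarrow> real" where
  "\<alpha> s = lim (\<lambda>n. poly (orthonormal_poly s n) 0 / poly (second_kind_poly s n) 0)"

definition friedrichs_param :: "(nat \<Rightarrow> real) \<Rightarrow> ereal" where
  "friedrichs_param s = (if \<alpha> s < 0 then ereal (- 1 / \<alpha> s) else \<infinity>)"

definition normalize_seq :: "(nat \<Rightarrow> real) \<Rightarrow> nat \<Rightarrow> real" where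
  "normalize_seq s n = s n / s 0"

definition is_N_extremal :: "(nat \<Rightarrow> real) \<Rightarrow> real measure \<Rightarrow> bool" where
  "is_N_extremal s \<mu> \<longleftrightarrow> indeterminate s \<and>
     (\<exists>t. \<mu> = scale_measure (ennreal (s 0)) (N_ext (normalize_seq s) t))"

definition friedrichs_solution :: "(nat \<Rightarrow> real) \<Rightarrow> real measure" where
  "friedrichs_solution s = scale_measure (ennreal (s 0))
     (N_ext (normalize_seq s) (friedrichs_param (normalize_seq s)))"

definition shifted_seq :: "(nat \<Rightarrow> real) \<Rightarrow> real \<Rightarrow> nat \<Rightarrow> real" where
  "shifted_seq s c n = s (n + 1) - c * s n"

text \<open>The measure \<open>(x - c) d\<mu>(x)\<close>. The conversion to \<^typ>\<open>ennreal\<close> truncates the density at \<open>0\<close>,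
  which has no effect if \<open>\<mu>\<close> is supported in \<open>[c, \<infinity>)\<close>.\<close>

definition linear_density :: "real \<Rightarrow> real measure \<Rightarrow> real measure" where
  "linear_density c \<mu> = density \<mu> (\<lambda>x. ennreal (x - c))"

end

theory Submission
  imports Defs "HOL-Probability.Probability" "HOL-Computational_Algebra.Fundamental_Theorem_Algebra"
begin

text \<open>
  All facts about the functions \<open>A, B, C, D\<close> are limits of identities for their partial sums, which follow
  from expanding \<open>(p\<^sub>n(x) - p\<^sub>n(0)) / x\<close> in the orthonormal polynomials. N-extremal solutions are weak limits of
  quadrature formulas at the zeros of \<open>u B\<^sub>n + v D\<^sub>n\<close>. They are recognised by their atoms: a solution has mass at
  most \<open>1 / \<kappa>(a)\<close> at \<open>a\<close>, where \<open>\<kappa>(a) = \<Sum> p\<^sub>n(a)\<^sup>2\<close>, and equality determines the solution, because then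
  \<open>\<Sum> p\<^sub>n(a) p\<^sub>n\<close> converges to a multiple of the indicator of \<open>{a}\<close>. The Friedrichs solution is the limit of the
  Gauss quadratures and minimises \<open>\<integral> 1 / (y - x) d\<mu>(y)\<close> for every \<open>x\<close> below the supports.

  Let \<open>a = c\<^sub>t\<close>. Dividing the Friedrichs solution of the shifted sequence by \<open>y - a\<close> and restoring the missing
  mass at \<open>a\<close> gives a solution of the original problem whose mass at \<open>a\<close> is maximal; hence it is \<open>\<mu>\<^sub>t\<close>. For
  \<open>t = F\<close> the same construction applied to the next N-extremal solutions contradicts the uniqueness of
  \<open>\<mu>\<^sub>F\<close> among the solutions supported in \<open>[c\<^sub>F, \<infinity>)\<close>, so the shifted sequence is determinate. For
  \<open>t > F\<close> the statements on \<open>\<nu>\<^sub>t'\<close> compare the Christoffel functions of \<open>(y - a) d\<mu>\<close> and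
  \<open>(y - b) d\<mu>\<close> at the smallest mass point \<open>b\<close> of \<open>\<mu>\<close>.
\<close>

section \<open>Supports and moments\<close>

text \<open>N-extremality is by definition membership in the family \<mu>_t, so proving or refuting
  it calls for a test on a given measure. Maximal mass at one point is such a test. For (y - a)
  d\<mu> it involves the Christoffel function at b, the infimum of the integral of f^2 over
  polynomials with f(b) = 1. Its excess over the mass of b is governed by the same infimum for (y -
  b) d\<mu>. At F that measure is determinate and has no mass at b, so the infimum is 0 and nothing
  is lost; above F it is indeterminate, the infimum is positive, and the mass at b stays strictly
  below the maximum. This is why determinacy of the sequence shifted by c_F has to be settled before
  part (b).

  Shifted sequences are not normalized, while the theory of \<mu>_t is for s_0 = 1. Hence the
  locales are parametrized by the sequence and instantiated again at
  \<open>normalize_seq (shifted_seq s a)\<close>, and \<open>scale_measure\<close> carries the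
  results back. The second instance again has a finite Friedrichs parameter, because c_t > 0 gives
  it a solution without mass at 0.\<close>

lemma closed_supp: "closed (supp \<mu>)"
proof -
  have "- supp \<mu> = \<Union>{U. open U \<and> emeasure \<mu> U = 0}"
    unfolding supp_def by (force simp: zero_less_iff_neq_zero)
  then have "open (- supp \<mu>)" by auto
  then show ?thesis by (simp add: closed_def)
qed

text \<open>The complement of the support is a union of open null sets; by Lindelof countably many
  of them have the same union, which is therefore null.\<close>

lemma AE_in_supp:
  assumes sets: "sets \<mu> = sets borel"
  shows "AE x in \<mu>. x \<in> supp \<mu>"
proof -
  define \<F> where "\<F> = {U :: real set. open U \<and> emeasure \<mu> U = 0}"
  obtain \<G> where \<G>: "\<G> \<subseteq> \<F>" "countable \<G>" "\<Union>\<G> = \<Union>\<F>"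
    using Lindelof[of \<F>] unfolding \<F>_def by auto
  have "\<Union>\<G> \<in> null_sets \<mu>"
    using \<G> sets by (intro null_sets_UN'[of \<G> "\<lambda>x. x", simplified]) (auto simp: \<F>_def null_sets_def)
  moreover have "- supp \<mu> = \<Union>\<F>"
    unfolding supp_def \<F>_def by (force simp: zero_less_iff_neq_zero)
  ultimately have "- supp \<mu> \<in> null_sets \<mu>" using \<G> by simp
  then show ?thesis by (rule AE_I') auto
qed

lemma supp_subset_closed:
  assumes sets: "sets \<mu> = sets borel" and "closed S" and "AE x in \<mu>. x \<in> S"
  shows "supp \<mu> \<subseteq> S"
proof
  fix x assume x: "x \<in> supp \<mu>"
  show "x \<in> S"
  proof (rule ccontr)
    assume "x \<notin> S"
    then have "emeasure \<mu> (- S) > 0" using x \<open>closed S\<close> unfolding supp_def by auto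
    moreover have "emeasure \<mu> (- S) = 0"
      using assms by (subst AE_iff_measurable[symmetric, of _ _ "\<lambda>x. x \<in> S"])
        (auto simp: sets_eq_imp_space_eq[OF sets])
    ultimately show False by simp
  qed
qed

lemma in_supp_if_atom:
  assumes "sets \<mu> = sets borel" "emeasure \<mu> {x} > 0"
  shows "x \<in> supp \<mu>"
  unfolding supp_def
proof (safe)
  fix U :: "real set" assume "open U" "x \<in> U"
  then have "emeasure \<mu> {x} \<le> emeasure \<mu> U" using assms by (intro emeasure_mono) auto
  then show "emeasure \<mu> U > 0" using assms by simp
qed

lemma Mstar_finite: "\<mu> \<in> Mstar \<Longrightarrow> finite_measure \<mu>"
proof -
  assume "\<mu> \<in> Mstar"
  then have "integrable \<mu> (\<lambda>x. x ^ 0)" unfolding Mstar_def by blast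
  then have "integrable \<mu> (\<lambda>x. 1 :: real)" by simp
  then have "emeasure \<mu> (space \<mu>) < \<infinity>" by (simp add: integrable_iff_bounded)
  then show ?thesis by (intro finite_measureI) auto
qed

lemma Mstar_sets: "\<mu> \<in> Mstar \<Longrightarrow> sets \<mu> = sets borel"
  by (simp add: Mstar_def)

lemma integrable_poly_of_moments:
  assumes "\<And>n::nat. integrable \<mu> (\<lambda>x. x ^ n :: real)"
  shows "integrable \<mu> (\<lambda>x. poly f x)"
  unfolding poly_altdef using assms by auto

lemma integral_poly_of_moments:
  assumes "\<And>n::nat. integrable \<mu> (\<lambda>x. x ^ n :: real)"
  shows "(\<integral>x. poly f x \<partial>\<mu>) = (\<Sum>i\<le>degree f. coeff f i * (\<integral>x. x ^ i \<partial>\<mu>))"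
  unfolding poly_altdef using assms by simp

lemma V_D:
  assumes "\<mu> \<in> V s"
  shows "sets \<mu> = sets borel" "\<mu> \<in> Mstar" "finite_measure \<mu>" "space \<mu> = UNIV"
    "integrable \<mu> (\<lambda>x. poly f x)" "(\<integral>x. poly f x \<partial>\<mu>) = (\<Sum>i\<le>degree f. coeff f i * s i)"
proof -
  have "\<mu> \<in> Mstar" and mom: "\<And>n. (\<integral>x. x ^ n \<partial>\<mu>) = s n" using assms by (auto simp: V_def)
  then have I: "\<And>n::nat. integrable \<mu> (\<lambda>x. x ^ n)" by (simp add: Mstar_def)
  show "sets \<mu> = sets borel" "\<mu> \<in> Mstar" "finite_measure \<mu>"
    using \<open>\<mu> \<in> Mstar\<close> Mstar_sets Mstar_finite by auto
  then show "space \<mu> = UNIV" using sets_eq_imp_space_eq by fastforce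
  show "integrable \<mu> (\<lambda>x. poly f x)" by (rule integrable_poly_of_moments[OF I])
  show "(\<integral>x. poly f x \<partial>\<mu>) = (\<Sum>i\<le>degree f. coeff f i * s i)"
    by (simp add: integral_poly_of_moments[OF I] mom)
qed

text \<open>A vanishing integral would confine the support to the finitely many roots of
  \<open>f\<close>, contradicting the infinite support built into \<open>Mstar\<close>.\<close>

lemma integral_poly_pos:
  assumes \<mu>: "\<mu> \<in> Mstar" and f: "f \<noteq> 0" and nn: "\<And>x. x \<in> supp \<mu> \<Longrightarrow> poly f x \<ge> 0"
  shows "(\<integral>x. poly f x \<partial>\<mu>) > 0"
proof -
  have sets: "sets \<mu> = sets borel" using \<mu> by (rule Mstar_sets)
  have int: "integrable \<mu> (\<lambda>x. poly f x)"
    using \<mu> by (intro integrable_poly_of_moments) (auto simp: Mstar_def)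
  have AE: "AE x in \<mu>. poly f x \<ge> 0" using AE_in_supp[OF sets] nn by auto
  have "(\<integral>x. poly f x \<partial>\<mu>) \<noteq> 0"
  proof
    assume "(\<integral>x. poly f x \<partial>\<mu>) = 0"
    then have "AE x in \<mu>. x \<in> {x. poly f x = 0}"
      using integral_nonneg_eq_0_iff_AE[OF int AE] by simp
    then have "supp \<mu> \<subseteq> {x. poly f x = 0}"
      using poly_roots_finite[OF f] by (intro supp_subset_closed sets finite_imp_closed) auto
    then have "finite (supp \<mu>)" using poly_roots_finite[OF f] finite_subset by blast
    then show False using \<mu> by (simp add: Mstar_def)
  qed
  moreover have "(\<integral>x. poly f x \<partial>\<mu>) \<ge> 0" using AE by (rule integral_nonneg_AE)
  ultimately show ?thesis by simp
qed

text \<open>Infinite support is inherited from the moments. If \<open>\<mu>\<close> lived on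
  finitely many points, the square of the polynomial vanishing there would integrate to 0 against
  \<open>\<mu>\<close> but to something positive against a member of \<open>V s\<close>, although
  both integrals are the same combination of moments.\<close>

lemma V_I:
  assumes ne: "V s \<noteq> {}" and sets: "sets \<mu> = sets borel"
    and int: "\<And>n::nat. integrable \<mu> (\<lambda>x. x ^ n :: real)" and mom: "\<And>n. (\<integral>x. x ^ n \<partial>\<mu>) = s n"
  shows "\<mu> \<in> V s"
proof -
  obtain \<nu> where \<nu>: "\<nu> \<in> V s" using ne by auto
  have "infinite (supp \<mu>)"
  proof
    assume fin: "finite (supp \<mu>)"
    define f where "f = (\<Prod>a\<in>supp \<mu>. [:- a, 1:])"
    have f0: "f * f \<noteq> 0" unfolding f_def using fin by (simp add: pCons_eq_0_iff)
    have f_supp: "poly (f * f) x = 0" if "x \<in> supp \<mu>" for x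
      using fin that unfolding f_def by (auto simp: poly_prod)
    have "0 < (\<integral>x. poly (f * f) x \<partial>\<nu>)"
      by (rule integral_poly_pos[OF V_D(2)[OF \<nu>] f0]) simp
    also have "\<dots> = (\<integral>x. poly (f * f) x \<partial>\<mu>)"
      unfolding V_D(6)[OF \<nu>] integral_poly_of_moments[OF int] mom ..
    also have "\<dots> = (\<integral>x. 0 \<partial>\<mu>)"
    proof (rule integral_cong_AE)
      show "AE x in \<mu>. poly (f * f) x = 0" using AE_in_supp[OF sets] f_supp by fast
    qed (use integrable_poly_of_moments[OF int] in auto)
    finally show False by simp
  qed
  then show ?thesis unfolding V_def Mstar_def using sets int mom by auto
qed

section \<open>Orthogonal polynomials\<close>

text \<open>Integration of polynomials against an arbitrary solution, expressed by the moments so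
  that algebraic arguments need not choose a solution.\<close>

definition moment_functional :: "(nat \<Rightarrow> real) \<Rightarrow> real poly \<Rightarrow> real" where
  "moment_functional s f = (\<Sum>i\<le>degree f. coeff f i * s i)"

text \<open>Synthetic division gives f = (X - z) S + f(z); the quotient is S(x) off the diagonal,
  and differentiating the identity gives the value S(z) on it.\<close>

lemma diff_quotient_eq: "diff_quotient f z x = poly (synthetic_div f z) x"
proof (cases "x = z")
  case True
  have "pderiv f = pderiv ([:- z, 1:] * synthetic_div f z + [:poly f z:])"
    by (simp only: synthetic_div_correct')
  also have "\<dots> = [:- z, 1:] * pderiv (synthetic_div f z) + synthetic_div f z"
    unfolding pderiv_add pderiv_mult by (simp add: pderiv_pCons)
  finally show ?thesis using True by (simp add: diff_quotient_def)
next
  case False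
  have "poly f x = poly ([:- z, 1:] * synthetic_div f z + [:poly f z:]) x"
    by (simp only: synthetic_div_correct')
  then have "poly f z - poly f x = (z - x) * poly (synthetic_div f z) x"
    by (simp add: algebra_simps)
  then show ?thesis using False by (simp add: diff_quotient_def)
qed

section \<open>Existence and uniqueness of the orthonormal polynomials\<close>

fun gram_schmidt :: "(real poly \<Rightarrow> real) \<Rightarrow> nat \<Rightarrow> real poly" where
  "gram_schmidt \<Lambda> n =
    (let r = monom 1 n -
       (\<Sum>k<n. smult (\<Lambda> (monom 1 n * gram_schmidt \<Lambda> k)) (gram_schmidt \<Lambda> k))
     in smult (1 / sqrt (\<Lambda> (r * r))) r)"

declare gram_schmidt.simps [simp del]

lemma poly_span_of_degrees:
  fixes p :: "nat \<Rightarrow> real poly"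
  assumes p: "\<And>n. degree (p n) = n" "\<And>n. p n \<noteq> 0" and f: "f = 0 \<or> degree f < n"
  shows "\<exists>c. f = (\<Sum>k<n. smult (c k) (p k))"
  using f
proof (induction n arbitrary: f)
  case 0
  then show ?case by simp
next
  case (Suc n)
  define c where "c = coeff f n / coeff (p n) n"
  have pn: "coeff (p n) n \<noteq> 0" using p[of n] by (metis leading_coeff_0_iff)
  have "coeff (f - smult c (p n)) i = 0" if "i \<ge> n" for i
  proof (cases "i = n")
    case True
    then show ?thesis using pn by (simp add: c_def)
  next
    case False
    then show ?thesis using that Suc.prems p(1)[of n] by (auto simp: coeff_eq_0)
  qed
  then have "f - smult c (p n) = 0 \<or> degree (f - smult c (p n)) < n"
    by (metis leading_coeff_0_iff not_less)
  then obtain d where d: "f - smult c (p n) = (\<Sum>k<n. smult (d k) (p k))"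
    using Suc.IH by blast
  have "f = (\<Sum>k<Suc n. smult ((d(n := c)) k) (p k))"
    using d by (simp add: algebra_simps)
  then show ?case by blast
qed

locale moment_sequence =
  fixes s :: "nat \<Rightarrow> real"
  assumes V_nonempty: "V s \<noteq> {}" and s_0: "s 0 = 1"
begin

abbreviation L :: "real poly \<Rightarrow> real" where "L \<equiv> moment_functional s"

lemma L_eq_integral: "\<mu> \<in> V s \<Longrightarrow> L f = (\<integral>x. poly f x \<partial>\<mu>)"
  by (simp add: V_D(6) moment_functional_def)

lemma L_add: "L (f + g) = L f + L g"
proof -
  obtain \<mu> where \<mu>: "\<mu> \<in> V s" using V_nonempty by auto
  show ?thesis by (simp add: L_eq_integral[OF \<mu>] V_D(5)[OF \<mu>])
qed

lemma L_smult: "L (smult c f) = c * L f"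
proof -
  obtain \<mu> where \<mu>: "\<mu> \<in> V s" using V_nonempty by auto
  show ?thesis by (simp add: L_eq_integral[OF \<mu>])
qed

lemma L_0 [simp]: "L 0 = 0" using L_smult[of 0 0] by simp

lemma L_minus: "L (- f) = - L f" using L_smult[of "-1" f] by simp

lemma L_diff: "L (f - g) = L f - L g" using L_add[of f "- g"] by (simp add: L_minus)

lemma L_sum: "L (\<Sum>k\<in>A. f k) = (\<Sum>k\<in>A. L (f k))"
  by (induction A rule: infinite_finite_induct) (auto simp: L_add)

lemma L_const [simp]: "L [:c:] = c"
  by (simp add: moment_functional_def s_0)

lemma L_1 [simp]: "L 1 = 1" unfolding one_pCons by simp

lemma L_pos:
  assumes "\<mu> \<in> V s" "f \<noteq> 0" "\<And>x. x \<in> supp \<mu> \<Longrightarrow> poly f x \<ge> 0"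
  shows "L f > 0"
  unfolding L_eq_integral[OF assms(1)] using assms V_D(2) by (intro integral_poly_pos) auto

lemma L_square_pos: "f \<noteq> 0 \<Longrightarrow> L (f * f) > 0"
  using V_nonempty L_pos[of _ "f * f"] by auto

lemma gram_schmidt_orthonormal:
  "degree (gram_schmidt L n) = n \<and> lead_coeff (gram_schmidt L n) > 0 \<and>
   L (gram_schmidt L n * gram_schmidt L n) = 1 \<and>
   (\<forall>k<n. L (gram_schmidt L n * gram_schmidt L k) = 0)"
proof (induction n rule: less_induct)
  case (less n)
  let ?g = "gram_schmidt L"
  define r where "r = monom 1 n - (\<Sum>k<n. smult (L (monom 1 n * ?g k)) (?g k))"
  have g: "?g n = smult (1 / sqrt (L (r * r))) r"
    by (subst gram_schmidt.simps) (simp add: r_def Let_def)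
  have orth: "L (?g j * ?g k) = (if j = k then 1 else 0)" if "j < n" "k < n" for j k
    using less[of j] less[of k] that by (cases j k rule: linorder_cases) (auto simp: mult.commute)
  have coeff_n: "coeff r n = 1"
    unfolding r_def using less by (simp add: coeff_sum coeff_eq_0)
  have "coeff r i = 0" if "i > n" for i
    unfolding r_def using less that by (simp add: coeff_sum coeff_eq_0)
  then have deg: "degree r = n" using coeff_n
    by (metis degree_le le_antisym le_degree zero_neq_one)
  have r0: "r \<noteq> 0" using coeff_n by auto
  have pos: "L (r * r) > 0" by (rule L_square_pos[OF r0])
  have "L (r * ?g j) = 0" if "j < n" for j
  proof -
    have "L (r * ?g j) = L (monom 1 n * ?g j) - (\<Sum>k<n. L (monom 1 n * ?g k) * L (?g k * ?g j))"
      unfolding r_def by (simp add: left_diff_distrib L_diff sum_distrib_right L_sum L_smult)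
    also have "(\<Sum>k<n. L (monom 1 n * ?g k) * L (?g k * ?g j)) =
      (\<Sum>k<n. if k = j then L (monom 1 n * ?g k) else 0)"
      using that by (intro sum.cong) (auto simp: orth)
    finally show ?thesis using that by simp
  qed
  then show ?case unfolding g using deg coeff_n pos r0
    by (auto simp: L_smult degree_smult_eq lead_coeff_smult field_simps real_sqrt_mult_self abs_of_pos)
qed

abbreviation p :: "nat \<Rightarrow> real poly" where "p \<equiv> orthonormal_poly s"
abbreviation q :: "nat \<Rightarrow> real poly" where "q \<equiv> second_kind_poly s"

lemma span_coeff:
  fixes g :: "nat \<Rightarrow> real poly"
  assumes "\<And>j k. L (g j * g k) = (if j = k then 1 else 0)" "f = (\<Sum>k<n. smult (c k) (g k))" "j < n"
  shows "c j = L (f * g j)"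
proof -
  have "L (f * g j) = (\<Sum>k<n. c k * L (g k * g j))"
    unfolding assms(2) by (simp add: sum_distrib_right L_sum L_smult)
  also have "\<dots> = (\<Sum>k<n. if k = j then c k else 0)"
    by (intro sum.cong) (auto simp: assms(1))
  also have "\<dots> = c j" using assms(3) by simp
  finally show ?thesis by simp
qed

text \<open>Stated for an arbitrary orthonormal family because it serves both the chosen polynomials
  and a competitor in the uniqueness argument.\<close>

lemma orthogonal_to_lower:
  assumes g: "\<And>n. degree (g n) = n" "\<And>n. lead_coeff (g n) > 0"
    and o: "\<And>j k. L (g j * g k) = (if j = k then 1 else 0)" and f: "f = 0 \<or> degree f < n"
  shows "L (g n * f) = 0"
proof -
  have "\<exists>c. f = (\<Sum>k<n. smult (c k) (g k))"
    using g(2) by (intro poly_span_of_degrees g(1) f) (metis leading_coeff_0_iff less_irrefl)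
  then obtain c where "f = (\<Sum>k<n. smult (c k) (g k))" by blast
  then show ?thesis by (simp add: sum_distrib_left L_sum L_smult o)
qed

text \<open>For uniqueness, a competing \<open>g n\<close> is orthogonal to all lower degrees, so
  its expansion reduces to a multiple of \<open>gram_schmidt L n\<close>; the norm makes the factor
  plus or minus 1, and the positive leading coefficient selects 1.\<close>

lemma orthonormal_poly_eq_gram_schmidt: "p = gram_schmidt L"
  unfolding orthonormal_poly_def
proof (rule the_equality)
  let ?g = "gram_schmidt L"
  have go: "L (?g j * ?g k) = (if j = k then 1 else 0)" for j k
    using gram_schmidt_orthonormal[of j] gram_schmidt_orthonormal[of k]
    by (cases j k rule: linorder_cases) (auto simp: mult.commute)
  then show "(\<forall>n. degree (?g n) = n \<and> 0 < lead_coeff (?g n)) \<and>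
    (\<forall>\<mu>\<in>V s. \<forall>m n. (\<integral>x. poly (?g m) x * poly (?g n) x \<partial>\<mu>) = (if m = n then 1 else 0))"
    using gram_schmidt_orthonormal by (intro conjI allI ballI) (blast, blast, simp add: L_eq_integral)
  fix g assume g: "(\<forall>n. degree (g n) = n \<and> 0 < lead_coeff (g n)) \<and>
    (\<forall>\<mu>\<in>V s. \<forall>m n. (\<integral>x. poly (g m) x * poly (g n) x \<partial>\<mu>) = (if m = n then 1 else 0))"
  have gd: "degree (g n) = n" and gl: "lead_coeff (g n) > 0" for n using g by blast+
  obtain \<mu> where \<mu>: "\<mu> \<in> V s" using V_nonempty by auto
  have o: "L (g j * g k) = (if j = k then 1 else 0)" for j k
    using g \<mu> by (simp add: L_eq_integral[OF \<mu>])
  show "g = ?g"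
  proof
    fix n
    have "\<exists>c. g n = (\<Sum>k<Suc n. smult (c k) (?g k))"
      using g gram_schmidt_orthonormal
      by (intro poly_span_of_degrees) (auto, metis leading_coeff_0_iff less_irrefl)
    then obtain c where c: "g n = (\<Sum>k<Suc n. smult (c k) (?g k))" by blast
    have "c j = 0" if "j < n" for j
    proof -
      have "c j = L (g n * ?g j)" using span_coeff[OF go c] that by simp
      also have "\<dots> = 0" 
        by (rule orthogonal_to_lower[OF gd gl o]) (use gram_schmidt_orthonormal[of j] that in auto)
      finally show ?thesis .
    qed
    then have gn: "g n = smult (c n) (?g n)" using c by simp
    then have "1 = c n * (c n * L (?g n * ?g n))" using o[of n n] by (simp add: L_smult)
    then have "c n * c n = 1" by (simp add: go)
    moreover have "lead_coeff (g n) = c n * lead_coeff (?g n)" using gn by (simp add: lead_coeff_smult)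
    then have "c n > 0" using g gram_schmidt_orthonormal[of n]
      by (metis zero_less_mult_pos2)
    ultimately have "c n = 1" by (metis abs_of_pos abs_1 abs_mult_self_eq mult_1 square_eq_iff
      not_less_iff_gr_or_eq less_minus_iff minus_zero less_numeral_extra(1) less_asym)
    then show "g n = ?g n" using gn by simp
  qed
qed

lemma degree_p [simp]: "degree (p n) = n"
  and lead_coeff_p: "lead_coeff (p n) > 0"
  using gram_schmidt_orthonormal[of n] by (auto simp: orthonormal_poly_eq_gram_schmidt)

lemma p_nonzero [simp]: "p n \<noteq> 0"
  using lead_coeff_p[of n] by (metis leading_coeff_0_iff less_irrefl)

lemma L_p_p: "L (p j * p k) = (if j = k then 1 else 0)"
  using gram_schmidt_orthonormal[of j] gram_schmidt_orthonormal[of k]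
  by (cases j k rule: linorder_cases) (auto simp: mult.commute orthonormal_poly_eq_gram_schmidt)

lemma L_p_lower: "f = 0 \<or> degree f < n \<Longrightarrow> L (p n * f) = 0"
  by (rule orthogonal_to_lower[OF degree_p lead_coeff_p L_p_p])

lemma p_expansion:
  assumes "f = 0 \<or> degree f < n"
  shows "f = (\<Sum>k<n. smult (L (f * p k)) (p k))"
proof -
  have "\<exists>c. f = (\<Sum>k<n. smult (c k) (p k))" using assms by (intro poly_span_of_degrees) auto
  then obtain c where c: "f = (\<Sum>k<n. smult (c k) (p k))" by blast
  have "c k = L (f * p k)" if "k < n" for k by (rule span_coeff[OF L_p_p c that])
  then show ?thesis using c by (metis (no_types, lifting) lessThan_iff sum.cong)
qed

lemma p_0: "p 0 = 1"
proof -
  obtain c where c: "p 0 = [:c:]" using degree_p[of 0] by (metis degree_eq_zeroE)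
  have "c > 0" using lead_coeff_p[of 0] c by simp
  moreover have "c * c = 1" using L_p_p[of 0 0] c by simp
  ultimately have "c = 1" by (metis abs_of_pos mult_1 square_eq_1_iff
    less_minus_iff minus_zero less_numeral_extra(1) less_asym)
  then show ?thesis using c by (simp add: one_pCons)
qed

section \<open>Polynomials of the second kind\<close>

lemma ex_second_kind: "\<exists>g. \<forall>z. poly g z = L (synthetic_div f z)"
proof (induction f rule: pCons_induct)
  case 0
  show ?case by (intro exI[of _ 0]) simp
next
  case (pCons a f)
  then obtain g where g: "\<And>z. poly g z = L (synthetic_div f z)" by blast
  \<comment> \<open>Horner's scheme: prepending a coefficient to \<open>f\<close> turns the quotient
    S into f + z S, so applying \<open>L\<close> multiplies by z and adds the constant
    \<open>L f\<close>, which stays polynomial in z.\<close>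
  have "pCons (poly f z) (synthetic_div f z) = f + smult z (synthetic_div f z)" for z
    using synthetic_div_correct[of f z] by simp
  then have "L (synthetic_div (pCons a f) z) = L f + z * poly g z" for z
    by (simp add: L_add L_smult g)
  then show ?case by (intro exI[of _ "pCons (L f) g"]) simp
qed

text \<open>The integral over x of (f(z) - f(x)) / (z - x), as a linear operator on all polynomials
  f: besides the polynomials of the second kind it also produces the numerators belonging to
  \<open>Bn\<close> and \<open>Dn\<close>.\<close>

definition Q :: "real poly \<Rightarrow> real poly" where
  "Q f = (SOME g. \<forall>z. poly g z = L (synthetic_div f z))"

lemma poly_Q: "poly (Q f) z = L (synthetic_div f z)"
  using someI_ex[OF ex_second_kind[of f]] unfolding Q_def by blast

lemma Q_pCons: "Q (pCons a f) = pCons (L f) (Q f)"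
proof -
  have "poly (Q (pCons a f)) z = poly (pCons (L f) (Q f)) z" for z
    using synthetic_div_correct[of f z, symmetric] by (simp add: poly_Q L_add L_smult)
  then show ?thesis by (simp add: poly_eq_poly_eq_iff[symmetric] fun_eq_iff)
qed

lemma Q_0 [simp]: "Q 0 = 0"
proof -
  have "poly (Q 0) z = poly 0 z" for z by (simp add: poly_Q)
  then show ?thesis by (simp add: poly_eq_poly_eq_iff[symmetric] fun_eq_iff)
qed

lemma Q_add: "Q (f + g) = Q f + Q g"
proof (induction f arbitrary: g rule: pCons_induct)
  case (pCons a f)
  show ?case by (cases g) (simp add: Q_pCons pCons.IH L_add)
qed simp

lemma Q_smult: "Q (smult c f) = smult c (Q f)"
  by (induction f rule: pCons_induct) (simp_all add: Q_pCons L_smult)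

lemma Q_sum: "Q (\<Sum>k\<in>A. f k) = (\<Sum>k\<in>A. Q (f k))"
  by (induction A rule: infinite_finite_induct) (auto simp: Q_add)

lemma second_kind_eq_Q: "q n = Q (p n)"
  unfolding second_kind_poly_def
proof (rule the_equality)
  show "\<forall>\<mu>\<in>V s. \<forall>z. poly (Q (p n)) z = (\<integral>x. diff_quotient (p n) z x \<partial>\<mu>)"
    by (simp add: diff_quotient_eq poly_Q L_eq_integral)
  fix g assume g: "\<forall>\<mu>\<in>V s. \<forall>z. poly g z = (\<integral>x. diff_quotient (p n) z x \<partial>\<mu>)"
  obtain \<mu> where \<mu>: "\<mu> \<in> V s" using V_nonempty by auto
  have "poly g z = poly (Q (p n)) z" for z
    using g \<mu> by (simp add: diff_quotient_eq poly_Q L_eq_integral)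
  then show "g = Q (p n)" by (simp add: poly_eq_poly_eq_iff[symmetric] fun_eq_iff)
qed

lemma q_0: "q 0 = 0"
  unfolding second_kind_eq_Q p_0 one_pCons by (simp add: Q_pCons)

lemma p_decomposition: "p n = pCons (poly (p n) 0) (synthetic_div (p n) 0)"
  using synthetic_div_correct[of "p n" 0] by simp

text \<open>Write p_k = x h_k + p_k(0). Then h_n p_k = p_k(0) h_n + p_n h_k - p_n(0) h_k, where the
  middle term is annihilated by \<open>L\<close> because deg h_k < n, and L(h_k) = q_k(0). This
  expansion takes the place of the three-term recurrence.\<close>

lemma synthetic_div_p:
  "synthetic_div (p n) 0 = (\<Sum>k<n. smult
      (poly (p k) 0 * poly (q n) 0 - poly (p n) 0 * poly (q k) 0) (p k))"
proof -
  define h where "h = (\<lambda>k. synthetic_div (p k) 0)"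
  have pk: "p k = pCons 0 (h k) + [:poly (p k) 0:]" for k
    using p_decomposition[of k] by (simp add: h_def)
  have deg: "h k = 0 \<or> degree (h k) < k" for k
    unfolding h_def using degree_synthetic_div[of "p k" 0] synthetic_div_eq_0_iff[of "p k" 0] by auto
  have q0: "poly (q k) 0 = L (h k)" for k
    by (simp add: second_kind_eq_Q poly_Q h_def)
  have "L (h n * p k) = poly (p k) 0 * poly (q n) 0 - poly (p n) 0 * poly (q k) 0" if "k < n" for k
  proof -
    have "h n * p k = smult (poly (p k) 0) (h n) + (p n * h k - smult (poly (p n) 0) (h k))"
      by (subst (1 2) pk) (simp add: algebra_simps)
    moreover have "L (p n * h k) = 0" using deg[of k] that by (intro L_p_lower) auto
    ultimately show ?thesis by (simp add: L_add L_diff L_smult q0)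
  qed
  then have "(\<Sum>k<n. smult (L (h n * p k)) (p k)) = (\<Sum>k<n. smult
      (poly (p k) 0 * poly (q n) 0 - poly (p n) 0 * poly (q k) 0) (p k))"
    by (intro sum.cong) auto
  then show ?thesis using p_expansion[OF deg[of n]] unfolding h_def by simp
qed

lemma p_key: "p n = pCons (poly (p n) 0) (\<Sum>k<n. smult
      (poly (p k) 0 * poly (q n) 0 - poly (p n) 0 * poly (q k) 0) (p k))"
  using p_decomposition[of n] synthetic_div_p[of n] by simp

lemma q_key: "q n = pCons (poly (q n) 0) (\<Sum>k<n. smult
      (poly (p k) 0 * poly (q n) 0 - poly (p n) 0 * poly (q k) 0) (q k))"
proof -
  have "q n = pCons (L (synthetic_div (p n) 0)) (Q (synthetic_div (p n) 0))"
    unfolding second_kind_eq_Q by (subst p_decomposition) (rule Q_pCons)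
  moreover have "L (synthetic_div (p n) 0) = poly (q n) 0"
    by (simp add: second_kind_eq_Q poly_Q)
  ultimately show ?thesis
    by (simp add: synthetic_div_p Q_sum Q_smult second_kind_eq_Q[symmetric])
qed

end

lemma cpoly_simps [simp]:
  "cpoly 0 z = 0" "cpoly (pCons a f) z = of_real a + z * cpoly f z" "cpoly 1 z = 1"
  by (simp_all add: cpoly_def map_poly_pCons one_pCons)

lemma cpoly_add: "cpoly (f + g) z = cpoly f z + cpoly g z"
proof (induction f arbitrary: g rule: pCons_induct)
  case (pCons a f)
  show ?case by (cases g) (simp add: pCons.IH distrib_left)
qed simp

lemma cpoly_smult: "cpoly (smult c f) z = of_real c * cpoly f z"
  by (induction f rule: pCons_induct) (simp_all add: algebra_simps)

lemma cpoly_sum: "cpoly (\<Sum>k\<in>A. f k) z = (\<Sum>k\<in>A. cpoly (f k) z)"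
  by (induction A rule: infinite_finite_induct) (auto simp: cpoly_add)

lemma cpoly_of_real: "cpoly f (of_real x) = of_real (poly f x)"
  by (induction f rule: pCons_induct) simp_all

lemma cpoly_at_0: "cpoly f 0 = of_real (poly f 0)"
  using cpoly_of_real[of f 0] by simp

section \<open>Nevanlinna polynomials and square summability\<close>

lemma discrete_gronwall:
  fixes T e :: "nat \<Rightarrow> real"
  assumes T: "\<And>n. T (Suc n) \<le> T n * (1 + e n)" "\<And>n. T n \<ge> 0"
    and e: "\<And>n. e n \<ge> 0"
  shows "T n \<le> T 0 * exp (\<Sum>k<n. e k)"
proof (induction n)
  case (Suc n)
  have "T (Suc n) \<le> T n * (1 + e n)" by (rule T)
  also have "\<dots> \<le> T n * exp (e n)" using T(2) by (intro mult_left_mono) auto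
  also have "\<dots> \<le> T 0 * exp (\<Sum>k<n. e k) * exp (e n)" using Suc by (intro mult_right_mono) auto
  finally show ?case by (simp add: exp_add)
qed simp

lemma norm_sum_mult_squared_le:
  fixes u v :: "nat \<Rightarrow> complex"
  shows "(norm (\<Sum>k\<in>I. u k * v k))\<^sup>2 \<le> (\<Sum>k\<in>I. (norm (u k))\<^sup>2) * (\<Sum>k\<in>I. (norm (v k))\<^sup>2)"
proof -
  have "norm (\<Sum>k\<in>I. u k * v k) \<le> (\<Sum>k\<in>I. norm (u k) * norm (v k))"
    by (rule order_trans[OF norm_sum]) (simp add: norm_mult)
  then have "(norm (\<Sum>k\<in>I. u k * v k))\<^sup>2 \<le> (\<Sum>k\<in>I. norm (u k) * norm (v k))\<^sup>2"
    by (intro power_mono) auto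
  also have "\<dots> \<le> (\<Sum>k\<in>I. (norm (u k))\<^sup>2) * (\<Sum>k\<in>I. (norm (v k))\<^sup>2)"
    by (rule Cauchy_Schwarz_ineq_sum)
  finally show ?thesis .
qed

text \<open>The relations assumed here express orthonormal polynomials and their companions at one point
  through their values at another point.\<close>

lemma square_sum_transfer:
  fixes x y X Y :: "nat \<Rightarrow> complex" and z :: complex
  assumes X: "\<And>n. X n = x n * (1 - z * (\<Sum>k<n. y k * X k)) + y n * (z * (\<Sum>k<n. x k * X k))"
    and Y: "\<And>n. Y n = - x n * (z * (\<Sum>k<n. y k * Y k)) + y n * (1 + z * (\<Sum>k<n. x k * Y k))"
    and E: "\<And>n. (\<Sum>k<n. (norm (x k))\<^sup>2 + (norm (y k))\<^sup>2) \<le> E"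
  shows "(\<Sum>k<n. (norm (X k))\<^sup>2 + (norm (Y k))\<^sup>2) \<le> exp (8 * (1 + (norm z)\<^sup>2 * E) * E)"
proof -
  define S where "S n = (\<Sum>k<n. (norm (X k))\<^sup>2 + (norm (Y k))\<^sup>2)" for n
  define e where "e n = (norm (x n))\<^sup>2 + (norm (y n))\<^sup>2" for n
  define c where "c = 8 * (1 + (norm z)\<^sup>2 * E)"
  have E0: "E \<ge> 0" using E[of 0] by simp
  have S0: "S n \<ge> 0" for n unfolding S_def by (intro sum_nonneg) auto
  have e0: "e n \<ge> 0" for n unfolding e_def by simp
  have c0: "c \<ge> 0" unfolding c_def using E0 by simp
  have sq: "norm (\<Sum>k<n. u k * v k) \<le> sqrt (E * S n)"
    if "u = x \<or> u = y" "v = X \<or> v = Y" for u v n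
  proof (rule real_le_rsqrt)
    have "(norm (\<Sum>k<n. u k * v k))\<^sup>2 \<le> (\<Sum>k<n. (norm (u k))\<^sup>2) * (\<Sum>k<n. (norm (v k))\<^sup>2)"
      by (rule norm_sum_mult_squared_le)
    also have "\<dots> \<le> E * S n"
    proof (rule mult_mono)
      have "(\<Sum>k<n. (norm (u k))\<^sup>2) \<le> (\<Sum>k<n. e k)" unfolding e_def using that
        by (intro sum_mono) auto
      also have "\<dots> \<le> E" using E unfolding e_def .
      finally show "(\<Sum>k<n. (norm (u k))\<^sup>2) \<le> E" .
      show "(\<Sum>k<n. (norm (v k))\<^sup>2) \<le> S n" unfolding S_def using that
        by (intro sum_mono) auto
    qed (auto intro: sum_nonneg E0)
    finally show "(norm (\<Sum>k<n. u k * v k))\<^sup>2 \<le> E * S n" .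
  qed
  have step: "S (Suc n) \<le> S n + c * e n * (1 + S n)" for n
  proof -
    define m where "m = norm z * sqrt (E * S n)"
    have m0: "m \<ge> 0" unfolding m_def using E0 S0 by simp
    have zs: "norm (z * (\<Sum>k<n. u k * v k)) \<le> m"
      if "u = x \<or> u = y" "v = X \<or> v = Y" for u v
      unfolding norm_mult m_def using sq[OF that] by (intro mult_left_mono) auto
    define b where "b = (norm (x n) + norm (y n)) * (1 + m)"
    have "norm (X n) \<le> norm (x n) * (1 + m) + norm (y n) * m"
      apply (subst X)
      apply (rule order_trans[OF norm_triangle_ineq])
      unfolding norm_mult[of "x n"] norm_mult[of "y n"]
      apply (intro add_mono mult_left_mono)
      apply (rule order_trans[OF norm_triangle_ineq4])
      using zs[of y X] zs[of x X] by auto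
    also have "\<dots> \<le> b" unfolding b_def by (simp add: algebra_simps)
    finally have Xb: "norm (X n) \<le> b" .
    have "norm (Y n) \<le> norm (x n) * m + norm (y n) * (1 + m)"
      apply (subst Y)
      apply (rule order_trans[OF norm_triangle_ineq])
      unfolding norm_mult[of "- x n"] norm_mult[of "y n"] norm_minus_cancel
      apply (intro add_mono mult_left_mono)
      prefer 3 apply (rule order_trans[OF norm_triangle_ineq])
      using zs[of y Y] zs[of x Y] by auto
    also have "\<dots> \<le> b" unfolding b_def by (simp add: algebra_simps)
    finally have Yb: "norm (Y n) \<le> b" .
    have "(norm (X n))\<^sup>2 + (norm (Y n))\<^sup>2 \<le> b\<^sup>2 + b\<^sup>2"
      using Xb Yb by (intro add_mono power_mono) auto
    \<comment> \<open>Two applications of (u + v)^2 \<le> 2 (u^2 + v^2); the resulting factor 4 and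
      the two copies of b^2 make the 8 of the exponent.\<close>
    also have "b\<^sup>2 \<le> (2 * e n) * (2 * (1 + m\<^sup>2))"
      unfolding b_def power_mult_distrib e_def
      using sum_squares_bound[of "norm (x n)" "norm (y n)"] sum_squares_bound[of 1 m] m0
      by (intro mult_mono) (simp_all add: power2_sum)
    also have "m\<^sup>2 = (norm z)\<^sup>2 * E * S n"
      unfolding m_def power_mult_distrib using E0 S0 by simp
    finally have "(norm (X n))\<^sup>2 + (norm (Y n))\<^sup>2 \<le> 8 * e n * (1 + (norm z)\<^sup>2 * E * S n)"
      by (simp add: algebra_simps)
    also have "\<dots> \<le> 8 * e n * ((1 + (norm z)\<^sup>2 * E) * (1 + S n))"
      using e0 E0 S0[of n] by (intro mult_left_mono) (auto simp: algebra_simps)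
    finally show ?thesis unfolding S_def c_def by (simp add: algebra_simps)
  qed
  \<comment> \<open>The recursive bound is inhomogeneous in \<open>S\<close> but homogeneous in 1 +
    S, which is therefore the quantity fed to Gronwall; \<open>S 0\<close> is an empty sum.\<close>
  have "1 + S n \<le> (1 + S 0) * exp (\<Sum>k<n. c * e k)"
    using step S0 c0 e0 by (intro discrete_gronwall) (auto simp: algebra_simps)
  also have "\<dots> \<le> exp (c * E)"
    using E[of n] c0 by (simp add: S_def sum_distrib_left[symmetric] e_def mult_left_mono)
  finally show ?thesis unfolding S_def c_def by simp
qed

text \<open>By Cauchy-Schwarz the square of a block of the series is at most a block of the squares
  of \<open>u\<close> times the bound on the squares of \<open>X\<close>; only the first factor has
  to be small, and it does not involve z.\<close>

lemma uniform_limit_square_summable: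
  fixes u :: "nat \<Rightarrow> complex" and X :: "nat \<Rightarrow> complex \<Rightarrow> complex"
  assumes u: "summable (\<lambda>k. (norm (u k))\<^sup>2)"
    and X: "\<And>n z. z \<in> S \<Longrightarrow> (\<Sum>k<n. (norm (X k z))\<^sup>2) \<le> M"
  shows "uniform_limit S (\<lambda>n z. \<Sum>k<n. u k * X k z) (\<lambda>z. \<Sum>k. u k * X k z) sequentially"
    and "z \<in> S \<Longrightarrow> summable (\<lambda>k. u k * X k z)"
proof -
  have "uniformly_Cauchy_on S (\<lambda>n z. \<Sum>k<n. u k * X k z)"
    unfolding uniformly_Cauchy_on_def
  proof (intro allI impI)
    fix e :: real assume e: "e > 0"
    \<comment> \<open>Strictly positive even if \<open>M\<close> is not, so that it may stand in a
      denominator.\<close>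
    define M' where "M' = max M 0 + 1"
    have M': "M' > 0" "M \<le> M'" unfolding M'_def by auto
    have "\<exists>N. \<forall>m\<ge>N. \<forall>n. norm (\<Sum>k=m..<n. (norm (u k))\<^sup>2) < e\<^sup>2 / M'"
      using u e M' unfolding summable_Cauchy by simp
    then obtain N where N: "\<And>m n. m \<ge> N \<Longrightarrow> norm (\<Sum>k=m..<n. (norm (u k))\<^sup>2) < e\<^sup>2 / M'"
      by blast
    have main: "dist (\<Sum>k<m. u k * X k z) (\<Sum>k<n. u k * X k z) < e"
      if "z \<in> S" "m \<ge> N" "m \<le> n" for m n z
    proof -
      have "(\<Sum>k<n. u k * X k z) - (\<Sum>k<m. u k * X k z) = (\<Sum>k=m..<n. u k * X k z)"
        using sum_diff_nat_ivl[of 0 m n "\<lambda>k. u k * X k z"] that by (simp add: atLeast0LessThan)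
      then have "(dist (\<Sum>k<m. u k * X k z) (\<Sum>k<n. u k * X k z))\<^sup>2 =
          (norm (\<Sum>k=m..<n. u k * X k z))\<^sup>2"
        by (metis dist_norm dist_commute)
      also have "\<dots> \<le> (\<Sum>k=m..<n. (norm (u k))\<^sup>2) * (\<Sum>k=m..<n. (norm (X k z))\<^sup>2)"
        by (rule norm_sum_mult_squared_le)
      also have "\<dots> \<le> (\<Sum>k=m..<n. (norm (u k))\<^sup>2) * M'"
      proof (rule mult_left_mono)
        have "(\<Sum>k=m..<n. (norm (X k z))\<^sup>2) \<le> (\<Sum>k<n. (norm (X k z))\<^sup>2)"
          by (intro sum_mono2) auto
        then show "(\<Sum>k=m..<n. (norm (X k z))\<^sup>2) \<le> M'" using X[OF that(1), of n] M' by linarith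
      qed (auto intro: sum_nonneg)
      also have "\<dots> < e\<^sup>2"
        using N[OF that(2), of n] M' by (simp add: field_simps sum_nonneg)
      finally show ?thesis using e power2_less_imp_less by fastforce
    qed
    show "\<exists>M. \<forall>z\<in>S. \<forall>m\<ge>M. \<forall>n\<ge>M. dist (\<Sum>k<m. u k * X k z) (\<Sum>k<n. u k * X k z) < e"
    proof (intro exI[of _ N] ballI allI impI)
      fix z m n assume "z \<in> S" "m \<ge> N" "n \<ge> N"
      then show "dist (\<Sum>k<m. u k * X k z) (\<Sum>k<n. u k * X k z) < e"
        using main[of z m n] main[of z n m] by (cases "m \<le> n") (auto simp: dist_commute)
    qed
  qed
  then have "uniformly_convergent_on S (\<lambda>n z. \<Sum>k<n. u k * X k z)"
    by (rule Cauchy_uniformly_convergent)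
  then obtain l where l: "uniform_limit S (\<lambda>n z. \<Sum>k<n. u k * X k z) l sequentially"
    unfolding uniformly_convergent_on_def by blast
  then have sums: "(\<lambda>k. u k * X k z) sums l z" if "z \<in> S" for z
    using tendsto_uniform_limitI[OF l that] by (simp add: sums_def)
  then show "z \<in> S \<Longrightarrow> summable (\<lambda>k. u k * X k z)" by (auto simp: sums_iff)
  show "uniform_limit S (\<lambda>n z. \<Sum>k<n. u k * X k z) (\<lambda>z. \<Sum>k. u k * X k z) sequentially"
    using l sums by (subst uniform_limit_cong'[where i=l and g="\<lambda>n z. \<Sum>k<n. u k * X k z"])
      (auto simp: sums_iff)
qed

context moment_sequence
begin

abbreviation P :: "nat \<Rightarrow> complex \<Rightarrow> complex" where "P n z \<equiv> cpoly (p n) z"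
abbreviation R :: "nat \<Rightarrow> complex \<Rightarrow> complex" where "R n z \<equiv> cpoly (q n) z"

text \<open>The four functions form the transfer matrix expressing p_n(z) and q_n(z) through their
  values at 0. The sums stop before n, so that the relation at n involves only smaller indices; at n
  = 0 the entries are 0, -1, 1, 0.\<close>

definition An :: "nat \<Rightarrow> complex \<Rightarrow> complex" where "An n z = z * (\<Sum>k<n. R k 0 * R k z)"
definition Bn :: "nat \<Rightarrow> complex \<Rightarrow> complex" where "Bn n z = - 1 + z * (\<Sum>k<n. R k 0 * P k z)"
definition Cn :: "nat \<Rightarrow> complex \<Rightarrow> complex" where "Cn n z = 1 + z * (\<Sum>k<n. P k 0 * R k z)"
definition Dn :: "nat \<Rightarrow> complex \<Rightarrow> complex" where "Dn n z = z * (\<Sum>k<n. P k 0 * P k z)"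

lemmas ABCDn_def = An_def Bn_def Cn_def Dn_def

lemma P_eq: "P n z = - P n 0 * Bn n z + R n 0 * Dn n z"
proof -
  have "P n z = of_real (poly (p n) 0) + z * (\<Sum>k<n.
      (of_real (poly (p k) 0) * of_real (poly (q n) 0) - of_real (poly (p n) 0) * of_real (poly (q k) 0)) * P k z)"
    by (subst p_key) (simp add: cpoly_sum cpoly_smult)
  then show ?thesis unfolding ABCDn_def cpoly_at_0
    by (simp add: algebra_simps sum_subtractf sum_distrib_left sum_negf)
qed

lemma R_eq: "R n z = - P n 0 * An n z + R n 0 * Cn n z"
proof -
  have "R n z = of_real (poly (q n) 0) + z * (\<Sum>k<n.
      (of_real (poly (p k) 0) * of_real (poly (q n) 0) - of_real (poly (p n) 0) * of_real (poly (q k) 0)) * R k z)"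
    by (subst q_key) (simp add: cpoly_sum cpoly_smult)
  then show ?thesis unfolding ABCDn_def cpoly_at_0
    by (simp add: algebra_simps sum_subtractf sum_distrib_left sum_negf)
qed

lemma ABCDn_Suc:
  "An (Suc n) z = An n z + z * R n 0 * R n z" "Bn (Suc n) z = Bn n z + z * R n 0 * P n z"
  "Cn (Suc n) z = Cn n z + z * P n 0 * R n z" "Dn (Suc n) z = Dn n z + z * P n 0 * P n z"
  by (simp_all add: ABCDn_def algebra_simps)

lemma ABCDn_0: "An 0 z = 0" "Bn 0 z = -1" "Cn 0 z = 1" "Dn 0 z = 0"
  by (simp_all add: ABCDn_def)

text \<open>The relations for \<open>P n z\<close> and \<open>R n z\<close> turn the increment into
  z (R_n P_n - P_n R_n), which cancels.\<close>

lemma ABCDn_det: "An n z * Dn n z - Bn n z * Cn n z = 1"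
proof (induction n)
  case (Suc n)
  have "An (Suc n) z * Dn (Suc n) z - Bn (Suc n) z * Cn (Suc n) z =
      An n z * Dn n z - Bn n z * Cn n z
      + z * (P n z * (P n 0 * An n z - R n 0 * Cn n z) + R n z * (R n 0 * Dn n z - P n 0 * Bn n z))"
    unfolding ABCDn_Suc by (simp add: algebra_simps)
  also have "P n 0 * An n z - R n 0 * Cn n z = - R n z" using R_eq[of n z] by simp
  also have "R n 0 * Dn n z - P n 0 * Bn n z = P n z" using P_eq[of n z] by simp
  finally show ?case using Suc by (simp add: algebra_simps)
qed (simp add: ABCDn_0)

text \<open>Both sides start at 0, and the transfer relations at \<open>a\<close> and at
  \<open>z\<close> turn the increment of the right-hand side into (z - a) P_n(a) P_n(z).\<close>

lemma christoffel_darboux_P: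
  "(z - a) * (\<Sum>k<n. P k a * P k z) = Dn n a * Bn n z - Bn n a * Dn n z"
proof (induction n)
  case (Suc n)
  have "Dn (Suc n) a * Bn (Suc n) z - Bn (Suc n) a * Dn (Suc n) z =
      Dn n a * Bn n z - Bn n a * Dn n z
      + (a * P n a * (P n 0 * Bn n z - R n 0 * Dn n z) + z * P n z * (R n 0 * Dn n a - P n 0 * Bn n a))"
    unfolding ABCDn_Suc by (simp add: algebra_simps)
  also have "P n 0 * Bn n z - R n 0 * Dn n z = - P n z" using P_eq[of n z] by simp
  also have "R n 0 * Dn n a - P n 0 * Bn n a = P n a" using P_eq[of n a] by simp
  finally show ?case by (simp only: sum.lessThan_Suc distrib_left Suc) (simp add: algebra_simps)
qed (simp add: ABCDn_0)

text \<open>The same telescoping; the -1 compensates the initial value D_0 A_0 - B_0 C_0 =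
  1.\<close>

lemma christoffel_darboux_R:
  "(z - a) * (\<Sum>k<n. P k a * R k z) = Dn n a * An n z - Bn n a * Cn n z - 1"
proof (induction n)
  case (Suc n)
  have "Dn (Suc n) a * An (Suc n) z - Bn (Suc n) a * Cn (Suc n) z =
      Dn n a * An n z - Bn n a * Cn n z
      + (a * P n a * (P n 0 * An n z - R n 0 * Cn n z) + z * R n z * (R n 0 * Dn n a - P n 0 * Bn n a))"
    unfolding ABCDn_Suc by (simp add: algebra_simps)
  also have "P n 0 * An n z - R n 0 * Cn n z = - R n z" using R_eq[of n z] by simp
  also have "R n 0 * Dn n a - P n 0 * Bn n a = P n a" using P_eq[of n a] by simp
  finally show ?case by (simp only: sum.lessThan_Suc distrib_left Suc) (simp add: algebra_simps)
qed (simp add: ABCDn_0)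

text \<open>The transfer matrix has determinant 1 and can be inverted; this lets square summability
  travel from z back to 0.\<close>

lemma P_at_0_eq: "P n 0 = Cn n z * P n z - Dn n z * R n z"
proof -
  have "Cn n z * P n z - Dn n z * R n z = P n 0 * (An n z * Dn n z - Bn n z * Cn n z)"
    unfolding P_eq[of n z] R_eq[of n z] by (simp add: algebra_simps)
  then show ?thesis by (simp add: ABCDn_det)
qed

lemma R_at_0_eq: "R n 0 = An n z * P n z - Bn n z * R n z"
proof -
  have "An n z * P n z - Bn n z * R n z = R n 0 * (An n z * Dn n z - Bn n z * Cn n z)"
    unfolding P_eq[of n z] R_eq[of n z] by (simp add: algebra_simps)
  then show ?thesis by (simp add: ABCDn_det)
qed

lemma square_summable_at_0:
  assumes "\<And>n. (\<Sum>k<n. (norm (P k z))\<^sup>2 + (norm (R k z))\<^sup>2) \<le> E"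
  shows "(\<Sum>k<n. (norm (P k 0))\<^sup>2 + (norm (R k 0))\<^sup>2) \<le> exp (8 * (1 + (norm (- z))\<^sup>2 * E) * E)"
proof (rule square_sum_transfer[OF _ _ assms])
  fix n
  show "P n 0 = P n z * (1 - - z * (\<Sum>k<n. R k z * P k 0)) + R n z * (- z * (\<Sum>k<n. P k z * P k 0))"
    by (subst P_at_0_eq[of n z]) (simp add: ABCDn_def algebra_simps)
  show "R n 0 = - P n z * (- z * (\<Sum>k<n. R k z * R k 0)) + R n z * (1 + - z * (\<Sum>k<n. P k z * R k 0))"
    by (subst R_at_0_eq[of n z]) (simp add: ABCDn_def algebra_simps)
qed

lemma square_summable_from_0:
  assumes "\<And>n. (\<Sum>k<n. (norm (P k 0))\<^sup>2 + (norm (R k 0))\<^sup>2) \<le> E"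
  shows "(\<Sum>k<n. (norm (P k z))\<^sup>2 + (norm (R k z))\<^sup>2) \<le> exp (8 * (1 + (norm z)\<^sup>2 * E) * E)"
proof (rule square_sum_transfer[OF _ _ assms])
  fix n
  show "P n z = P n 0 * (1 - z * (\<Sum>k<n. R k 0 * P k z)) + R n 0 * (z * (\<Sum>k<n. P k 0 * P k z))"
    by (subst P_eq[of n z]) (simp add: ABCDn_def algebra_simps)
  show "R n z = - P n 0 * (z * (\<Sum>k<n. R k 0 * R k z)) + R n 0 * (1 + z * (\<Sum>k<n. P k 0 * R k z))"
    by (subst R_eq[of n z]) (simp add: ABCDn_def algebra_simps)
qed

end

section \<open>The Cauchy transform determines the measure\<close>

text \<open>The factor (n + 1)^2 is the reciprocal height of the Poisson kernel, and 1 / (n + 1)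
  shifts the endpoint. The shift tends to 0 more slowly than the height, so the limit at x = b is
  the full pi / 2 rather than 0, and an atom at \<open>b\<close> is counted completely.\<close>

lemma filterlim_arctan_step:
  fixes b x :: real
  shows "(\<lambda>n. arctan ((b + 1 / (real n + 1) - x) * (real n + 1)\<^sup>2)) \<longlonglongrightarrow>
    (if x \<le> b then pi / 2 else - (pi / 2))"
proof -
  have eq: "(b + 1 / (real n + 1) - x) * (real n + 1)\<^sup>2 = (b - x) * (real n + 1)\<^sup>2 + (real n + 1)" for n
    by (simp add: field_simps power2_eq_square)
  have top: "filterlim (\<lambda>n. real n + 1) at_top sequentially"
    by (rule filterlim_at_top_mono[OF filterlim_real_sequentially]) auto
  show ?thesis
  proof (cases "x \<le> b")
    case True
    have "filterlim (\<lambda>n. (b + 1 / (real n + 1) - x) * (real n + 1)\<^sup>2) at_top sequentially"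
      by (rule filterlim_at_top_mono[OF top]) (use True in \<open>auto simp: eq\<close>)
    then show ?thesis using True by (simp add: filterlim_compose[OF tendsto_arctan_at_top])
  next
    case False
    have ev: "eventually (\<lambda>n. real n + 1 \<ge> 2 / (x - b)) sequentially"
      using top by (simp add: filterlim_at_top)
    have "filterlim (\<lambda>n. - ((b + 1 / (real n + 1) - x) * (real n + 1)\<^sup>2)) at_top sequentially"
    proof (rule filterlim_at_top_mono[OF top], rule eventually_mono[OF ev])
      fix n assume "real n + 1 \<ge> 2 / (x - b)"
      then have "2 \<le> (x - b) * (real n + 1)" using False by (simp add: field_simps)
      then have "2 * (real n + 1) \<le> (x - b) * (real n + 1) * (real n + 1)"
        by (intro mult_right_mono) auto
      then show "real n + 1 \<le> - ((b + 1 / (real n + 1) - x) * (real n + 1)\<^sup>2)"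
        unfolding eq by (simp add: power2_eq_square algebra_simps)
    qed
    then have "filterlim (\<lambda>n. (b + 1 / (real n + 1) - x) * (real n + 1)\<^sup>2) at_bot sequentially"
      by (simp add: filterlim_uminus_at_top)
    then show ?thesis using False by (simp add: filterlim_compose[OF tendsto_arctan_at_bot])
  qed
qed

lemma filterlim_arctan_lower:
  fixes x :: real
  shows "(\<lambda>n. arctan ((- (real n + 1) - x) * (real n + 1)\<^sup>2)) \<longlonglongrightarrow> - (pi / 2)"
proof -
  have top: "filterlim (\<lambda>n. real n + 1) at_top sequentially"
    by (rule filterlim_at_top_mono[OF filterlim_real_sequentially]) auto
  then have ev: "eventually (\<lambda>n. real n + 1 \<ge> 1 - x) sequentially"
    unfolding filterlim_at_top by blast
  have "filterlim (\<lambda>n. - ((- (real n + 1) - x) * (real n + 1)\<^sup>2)) at_top sequentially"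
  proof (rule filterlim_at_top_mono[OF top], rule eventually_mono[OF ev])
    fix n assume "real n + 1 \<ge> 1 - x"
    then have "1 * (real n + 1)\<^sup>2 \<le> (real n + 1 + x) * (real n + 1)\<^sup>2" by (intro mult_right_mono) auto
    moreover have "real n + 1 \<le> (real n + 1)\<^sup>2" by (simp add: power2_eq_square)
    ultimately show "real n + 1 \<le> - ((- (real n + 1) - x) * (real n + 1)\<^sup>2)"
      by (simp add: algebra_simps)
  qed
  then have "filterlim (\<lambda>n. (- (real n + 1) - x) * (real n + 1)\<^sup>2) at_bot sequentially"
    by (simp add: filterlim_uminus_at_top)
  then show ?thesis by (simp add: filterlim_compose[OF tendsto_arctan_at_bot])
qed

lemma Im_cauchy_kernel:
  "Im (1 / (complex_of_real x - Complex u y)) = y / ((x - u)\<^sup>2 + y\<^sup>2)"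
  by (simp add: Im_divide power2_eq_square)

lemma nonreal_ne_of_real: "z \<notin> \<real> \<Longrightarrow> complex_of_real x \<noteq> z"
  by auto

lemma nonreal_dist:
  assumes "z \<notin> \<real>"
  shows "\<bar>Im z\<bar> > 0" "\<bar>Im z\<bar> \<le> norm (complex_of_real x - z)"
proof -
  show "\<bar>Im z\<bar> > 0" using assms complex_is_Real_iff by auto
  show "\<bar>Im z\<bar> \<le> norm (complex_of_real x - z)" using abs_Im_le_cmod[of "complex_of_real x - z"] by simp
qed

lemma measurable_cauchy_kernel [measurable]:
  "(\<lambda>x. 1 / (complex_of_real x - z)) \<in> borel_measurable borel"
  by measurable

lemma integrable_cauchy_kernel:
  assumes "finite_measure \<mu>" and sets: "sets \<mu> = sets borel"
    and \<delta>: "\<delta> > 0" "AE x in \<mu>. \<delta> \<le> norm (complex_of_real x - z)"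
  shows "integrable \<mu> (\<lambda>x. 1 / (complex_of_real x - z))"
proof -
  interpret finite_measure \<mu> by fact
  show ?thesis
  proof (rule integrable_const_bound[where B = "1 / \<delta>"])
    show "AE x in \<mu>. norm (1 / (complex_of_real x - z)) \<le> 1 / \<delta>"
      using \<delta>(2) by eventually_elim (use \<delta>(1) in \<open>auto simp: norm_divide intro!: divide_left_mono mult_pos_pos\<close>)
  qed (simp add: measurable_cong_sets[OF sets refl])
qed

text \<open>Tonelli's theorem, with arctan((u - x) / y) as antiderivative in u of the Poisson
  kernel.\<close>

lemma nn_integral_poisson:
  assumes fin: "finite_measure \<mu>" and sets: "sets \<mu> = sets borel" and y: "y > 0" and ab: "a \<le> b"
  shows "(\<integral>\<^sup>+u. ennreal (Im (\<integral>x. 1 / (complex_of_real x - Complex u y) \<partial>\<mu>)) * indicator {a..b} u \<partial>lborel)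
       = (\<integral>\<^sup>+x. ennreal (arctan ((b - x) / y) - arctan ((a - x) / y)) \<partial>\<mu>)"
proof -
  interpret finite_measure \<mu> by fact
  interpret pair_sigma_finite lborel \<mu> by standard
  have [measurable_cong]: "sets \<mu> = sets borel" by fact
  have Im_eq: "Im (\<integral>x. 1 / (complex_of_real x - Complex u y) \<partial>\<mu>) =
      (\<integral>x. y / ((x - u)\<^sup>2 + y\<^sup>2) \<partial>\<mu>)"
    and int: "integrable \<mu> (\<lambda>x. y / ((x - u)\<^sup>2 + y\<^sup>2))" for u
  proof -
    have nr: "Complex u y \<notin> \<real>" using y by (auto simp: complex_is_Real_iff)
    have i: "integrable \<mu> (\<lambda>x. 1 / (complex_of_real x - Complex u y))"
      using nonreal_dist[OF nr] by (intro integrable_cauchy_kernel[where \<delta> = "\<bar>Im (Complex u y)\<bar>"] fin sets) auto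
    show "Im (\<integral>x. 1 / (complex_of_real x - Complex u y) \<partial>\<mu>) = (\<integral>x. y / ((x - u)\<^sup>2 + y\<^sup>2) \<partial>\<mu>)"
      unfolding integral_Im[OF i, symmetric] Im_cauchy_kernel ..
    show "integrable \<mu> (\<lambda>x. y / ((x - u)\<^sup>2 + y\<^sup>2))"
      using integrable_Im[OF i] unfolding Im_cauchy_kernel .
  qed
  have "(\<integral>\<^sup>+u. ennreal (Im (\<integral>x. 1 / (complex_of_real x - Complex u y) \<partial>\<mu>)) * indicator {a..b} u \<partial>lborel)
     = (\<integral>\<^sup>+u. (\<integral>\<^sup>+x. ennreal (y / ((x - u)\<^sup>2 + y\<^sup>2)) * indicator {a..b} u \<partial>\<mu>) \<partial>lborel)"
    using y by (intro nn_integral_cong, subst nn_integral_multc)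
      (auto simp: Im_eq nn_integral_eq_integral[OF int])
  also have "\<dots> = (\<integral>\<^sup>+x. (\<integral>\<^sup>+u. ennreal (y / ((x - u)\<^sup>2 + y\<^sup>2)) * indicator {a..b} u \<partial>lborel) \<partial>\<mu>)"
    by (rule Fubini'[symmetric]) measurable
  also have "\<dots> = (\<integral>\<^sup>+x. ennreal (arctan ((b - x) / y) - arctan ((a - x) / y)) \<partial>\<mu>)"
  proof (rule nn_integral_cong)
    fix x
    have "y\<^sup>2 + (u - x)\<^sup>2 \<noteq> 0" for u using y by (simp add: sum_power2_eq_zero_iff)
    then have D: "((\<lambda>u. arctan ((u - x) / y)) has_real_derivative y / ((x - u)\<^sup>2 + y\<^sup>2)) (at u)" for u
      using y by (auto intro!: derivative_eq_intros simp: divide_simps power2_eq_square)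
        (simp_all add: algebra_simps)
    show "(\<integral>\<^sup>+u. ennreal (y / ((x - u)\<^sup>2 + y\<^sup>2)) * indicator {a..b} u \<partial>lborel) =
        ennreal (arctan ((b - x) / y) - arctan ((a - x) / y))"
      using y ab D
      by (subst nn_integral_FTC_Icc[where F = "\<lambda>u. arctan ((u - x) / y)"])
        (auto simp: has_real_derivative_iff_has_vector_derivative[symmetric])
  qed
  finally show ?thesis .
qed

text \<open>Stieltjes inversion along a sequence: arctan differences of shrinking height tend
  boundedly to pi times the indicator of {..b}, so the transforms determine the distribution
  functions at every b.\<close>

theorem cauchy_transform_unique:
  assumes \<mu>: "finite_measure \<mu>" "sets \<mu> = sets borel" and \<nu>: "finite_measure \<nu>" "sets \<nu> = sets borel"
    and eq: "\<And>z. z \<notin> \<real> \<Longrightarrow>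
      (\<integral>x. 1 / (complex_of_real x - z) \<partial>\<mu>) = (\<integral>x. 1 / (complex_of_real x - z) \<partial>\<nu>)"
  shows "\<mu> = \<nu>"
proof -
  define N where "N = (\<lambda>n. real n + 1)"
  define f where "f = (\<lambda>b n x. arctan ((b + 1 / N n - x) * (N n)\<^sup>2) - arctan ((- N n - x) * (N n)\<^sup>2))"
  have N: "N n > 0" for n unfolding N_def by simp
  have fb: "norm (f b n x) \<le> pi" for b n x
    unfolding f_def using arctan_bounded[of "(b + 1 / N n - x) * (N n)\<^sup>2"]
      arctan_bounded[of "(- N n - x) * (N n)\<^sup>2"] by auto
  have lim: "(\<lambda>n. \<integral>x. f b n x \<partial>\<rho>) \<longlonglongrightarrow> pi * measure \<rho> {..b}"
    if \<rho>: "finite_measure \<rho>" "sets \<rho> = sets borel" for b and \<rho> :: "real measure"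
  proof -
    interpret finite_measure \<rho> by fact
    have [measurable_cong]: "sets \<rho> = sets borel" by fact
    have sp: "space \<rho> = UNIV" using \<rho>(2) sets_eq_imp_space_eq by fastforce
    have "(\<lambda>n. \<integral>x. f b n x \<partial>\<rho>) \<longlonglongrightarrow> (\<integral>x. pi * indicator {..b} x \<partial>\<rho>)"
    proof (rule integral_dominated_convergence[where w = "\<lambda>_. pi"])
      show "AE x in \<rho>. (\<lambda>n. f b n x) \<longlonglongrightarrow> pi * indicator {..b} x"
      proof (rule AE_I2)
        fix x
        show "(\<lambda>n. f b n x) \<longlonglongrightarrow> pi * indicator {..b} x"
          using tendsto_diff[OF filterlim_arctan_step[of b x] filterlim_arctan_lower[of x]]
          unfolding f_def N_def by (auto simp: indicator_def split: if_splits)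
      qed
      show "AE x in \<rho>. norm (f b n x) \<le> pi" for n by (simp add: fb del: real_norm_def)
    qed (auto simp: f_def N_def)
    then show ?thesis by (simp add: sp)
  qed
  have same: "(\<integral>x. f b n x \<partial>\<mu>) = (\<integral>x. f b n x \<partial>\<nu>)" if n: "- N n \<le> b" for b n
  proof -
    define y where "y = 1 / (N n)\<^sup>2"
    have y: "y > 0" using N[of n] by (simp add: y_def)
    have le: "- N n \<le> b + 1 / N n" using n N[of n] by (smt (verit) divide_pos_pos)
    have fy: "f b n x = arctan ((b + 1 / N n - x) / y) - arctan ((- N n - x) / y)" for x
      unfolding f_def y_def by simp
    have nr: "Complex u y \<notin> \<real>" for u using y by (auto simp: complex_is_Real_iff)
    have f0: "f b n x \<ge> 0" for x
      unfolding fy using le y by (simp add: divide_right_mono arctan_le_iff)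
    have to_nn: "(\<integral>x. f b n x \<partial>\<rho>) = enn2real (\<integral>\<^sup>+x. ennreal (f b n x) \<partial>\<rho>)"
      if \<rho>: "sets \<rho> = sets borel" for \<rho> :: "real measure"
    proof -
      have [measurable_cong]: "sets \<rho> = sets borel" by fact
      show ?thesis by (rule integral_eq_nn_integral) (use f0 in \<open>auto simp: f_def\<close>)
    qed
    show ?thesis unfolding to_nn[OF \<mu>(2)] to_nn[OF \<nu>(2)] unfolding fy
      nn_integral_poisson[OF \<mu> y le, symmetric] nn_integral_poisson[OF \<nu> y le, symmetric]
      using eq[OF nr] by simp
  qed
  have "cdf \<mu> b = cdf \<nu> b" for b
  proof -
    have "eventually (\<lambda>n. - N n \<le> b) sequentially"
      using eventually_ge_at_top[of "nat \<lceil>- b\<rceil>"] by eventually_elim (unfold N_def, linarith)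
    then have "eventually (\<lambda>n. (\<integral>x. f b n x \<partial>\<mu>) = (\<integral>x. f b n x \<partial>\<nu>)) sequentially"
      by eventually_elim (rule same)
    then have "(\<lambda>n. \<integral>x. f b n x \<partial>\<nu>) \<longlonglongrightarrow> pi * measure \<mu> {..b}"
      using lim[OF \<mu>, of b] by (rule Lim_transform_eventually[rotated])
    then have "pi * measure \<mu> {..b} = pi * measure \<nu> {..b}"
      using lim[OF \<nu>, of b] LIMSEQ_unique by blast
    then show ?thesis by (simp add: cdf_def2)
  qed
  moreover have "finite_borel_measure \<mu>" "finite_borel_measure \<nu>"
    using \<mu> \<nu> by (auto simp: finite_borel_measure_def finite_borel_measure_axioms_def)
  ultimately show ?thesis by (intro cdf_unique') auto
qed

section \<open>Indeterminate sequences\<close>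

lemma summable_norm_square_combination:
  fixes u v :: "nat \<Rightarrow> complex"
  assumes "summable (\<lambda>k. (norm (u k))\<^sup>2)" "summable (\<lambda>k. (norm (v k))\<^sup>2)"
  shows "summable (\<lambda>k. (norm (a * u k + b * v k))\<^sup>2)"
proof (rule summable_comparison_test')
  show "summable (\<lambda>k. 2 * (norm a)\<^sup>2 * (norm (u k))\<^sup>2 + 2 * (norm b)\<^sup>2 * (norm (v k))\<^sup>2)"
    using assms by (intro summable_add summable_mult)
  fix k
  have "(norm (a * u k + b * v k))\<^sup>2 \<le> (norm (a * u k) + norm (b * v k))\<^sup>2"
    by (intro power_mono norm_triangle_ineq) auto
  also have "\<dots> \<le> 2 * (norm (a * u k))\<^sup>2 + 2 * (norm (b * v k))\<^sup>2"
    using sum_squares_bound[of "norm (a * u k)" "norm (b * v k)"] by (simp add: power2_sum)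
  finally show "norm ((norm (a * u k + b * v k))\<^sup>2) \<le>
    2 * (norm a)\<^sup>2 * (norm (u k))\<^sup>2 + 2 * (norm b)\<^sup>2 * (norm (v k))\<^sup>2"
    by (simp add: norm_mult power_mult_distrib)
qed

lemma poly_borel_measurable [measurable]: "poly (f :: real poly) \<in> borel_measurable borel"
  by (intro borel_measurable_continuous_onI continuous_intros)

lemma integrable_bounded_mult:
  fixes f :: "real \<Rightarrow> 'a::{real_normed_field,banach,second_countable_topology}" and g :: "real \<Rightarrow> 'a"
  assumes "integrable \<mu> g" "f \<in> borel_measurable \<mu>" "AE x in \<mu>. norm (f x) \<le> B"
  shows "integrable \<mu> (\<lambda>x. f x * g x)"
proof (rule Bochner_Integration.integrable_bound)
  show "integrable \<mu> (\<lambda>x. B * norm (g x))" using assms by simp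
  show "AE x in \<mu>. norm (f x * g x) \<le> norm (B * norm (g x))"
    using assms(3)
  proof eventually_elim
    fix x assume le: "norm (f x) \<le> B"
    then have "norm (f x) * norm (g x) \<le> \<bar>B\<bar> * norm (g x)" by (intro mult_right_mono) auto
    then show "norm (f x * g x) \<le> norm (B * norm (g x))" by (simp add: norm_mult abs_mult)
  qed
qed (use assms in measurable)

context moment_sequence
begin

lemma L_p_combination_square:
  "L ((\<Sum>k<n. smult (c k) (p k)) * (\<Sum>k<n. smult (c k) (p k))) = (\<Sum>k<n. (c k)\<^sup>2)"
proof -
  have "L ((\<Sum>k<n. smult (c k) (p k)) * (\<Sum>k<n. smult (c k) (p k))) =
    (\<Sum>j<n. \<Sum>k<n. c j * (c k * L (p j * p k)))"
    by (simp add: sum_product L_sum L_smult mult_ac)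
  also have "\<dots> = (\<Sum>j<n. \<Sum>k<n. if k = j then (c j)\<^sup>2 else 0)"
    by (intro sum.cong refl) (auto simp: L_p_p power2_eq_square)
  finally show ?thesis by simp
qed

lemma bessel_inequality:
  fixes f :: "real \<Rightarrow> real"
  assumes \<mu>: "\<mu> \<in> V s" and f: "f \<in> borel_measurable \<mu>" "AE x in \<mu>. norm (f x) \<le> B"
  shows "(\<Sum>k<n. (\<integral>x. f x * poly (p k) x \<partial>\<mu>)\<^sup>2) \<le> (\<integral>x. f x * f x \<partial>\<mu>)"
proof -
  interpret finite_measure \<mu> using V_D[OF \<mu>] by simp
  define c where "c k = (\<integral>x. f x * poly (p k) x \<partial>\<mu>)" for k
  define h where "h = (\<Sum>k<n. smult (c k) (p k))"
  have int: "integrable \<mu> (\<lambda>x. f x * poly g x)" for g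
    by (rule integrable_bounded_mult[OF V_D(5)[OF \<mu>] f])
  have "integrable \<mu> f" using f by (intro integrable_const_bound[where B = B]) auto
  then have ff: "integrable \<mu> (\<lambda>x. f x * f x)" by (rule integrable_bounded_mult[OF _ f])
  have "0 \<le> (\<integral>x. (f x - poly h x)\<^sup>2 \<partial>\<mu>)" by simp
  also have "\<dots> = (\<integral>x. f x * f x - 2 * (f x * poly h x) + poly (h * h) x \<partial>\<mu>)"
    by (intro Bochner_Integration.integral_cong) (auto simp: power2_eq_square algebra_simps)
  also have "\<dots> = (\<integral>x. f x * f x \<partial>\<mu>) - 2 * (\<integral>x. f x * poly h x \<partial>\<mu>) + L (h * h)"
    using ff int[of h] V_D(5)[OF \<mu>, of "h * h"] by (simp add: L_eq_integral[OF \<mu>])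
  also have "(\<integral>x. f x * poly h x \<partial>\<mu>) = (\<Sum>k<n. (c k)\<^sup>2)"
  proof -
    have "(\<integral>x. f x * poly h x \<partial>\<mu>) = (\<integral>x. (\<Sum>k<n. c k * (f x * poly (p k) x)) \<partial>\<mu>)"
      by (intro Bochner_Integration.integral_cong refl)
        (auto simp: h_def poly_sum sum_distrib_left mult_ac)
    also have "\<dots> = (\<Sum>k<n. (c k)\<^sup>2)" using int by (simp add: c_def power2_eq_square)
    finally show ?thesis .
  qed
  also have "L (h * h) = (\<Sum>k<n. (c k)\<^sup>2)" unfolding h_def by (rule L_p_combination_square)
  finally show ?thesis unfolding c_def by simp
qed

text \<open>Splits f(x) / (x - z) into f(z) / (x - z) and a difference quotient, whose integral is
  \<open>Q f\<close> at z. The hypothesis on \<delta> asks for a distance from almost all points, so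
  that z may also be real outside the support.\<close>

lemma integral_poly_cauchy_kernel:
  assumes \<mu>: "\<mu> \<in> V s" and \<delta>: "\<delta> > 0" "AE x in \<mu>. \<delta> \<le> norm (complex_of_real x - z)"
  defines "w \<equiv> (\<integral>x. 1 / (complex_of_real x - z) \<partial>\<mu>)"
  shows "integrable \<mu> (\<lambda>x. 1 / (complex_of_real x - z) * of_real (poly f x)) \<and>
    (\<integral>x. 1 / (complex_of_real x - z) * of_real (poly f x) \<partial>\<mu>) = w * cpoly f z + cpoly (Q f) z"
proof -
  note sets = V_D(1)[OF \<mu>]
  have [measurable_cong]: "sets \<mu> = sets borel" by fact
  define e where "e = (\<lambda>x. 1 / (complex_of_real x - z))"
  have [measurable]: "e \<in> borel_measurable borel" unfolding e_def by measurable
  have int1: "integrable \<mu> e"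
    unfolding e_def by (rule integrable_cauchy_kernel[OF V_D(3)[OF \<mu>] sets \<delta>])
  have w: "w = (\<integral>x. e x \<partial>\<mu>)" unfolding w_def e_def ..
  have ne: "AE x in \<mu>. complex_of_real x \<noteq> z" using \<delta>(2) by eventually_elim (use \<delta>(1) in auto)
  have "integrable \<mu> (\<lambda>x. e x * of_real (poly f x)) \<and>
    (\<integral>x. e x * of_real (poly f x) \<partial>\<mu>) = w * cpoly f z + cpoly (Q f) z"
  proof (induction f rule: pCons_induct)
    case 0
    show ?case by simp
  next
    case (pCons a g)
    define k where "k = (\<lambda>x. of_real a * e x + z * (e x * of_real (poly g x)) + of_real (poly g x))"
    have ig: "integrable \<mu> (\<lambda>x. complex_of_real (poly g x))" using V_D(5)[OF \<mu>] by simp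
    have k: "integrable \<mu> k" unfolding k_def using int1 pCons.IH ig by auto
    have AE: "AE x in \<mu>. e x * of_real (poly (pCons a g) x) = k x"
      using ne
    proof eventually_elim
      fix x assume "complex_of_real x \<noteq> z"
      then have ex: "e x * of_real x = 1 + z * e x" unfolding e_def by (simp add: divide_simps)
      have "e x * of_real (poly (pCons a g) x) = of_real a * e x + (e x * of_real x) * of_real (poly g x)"
        by (simp add: algebra_simps)
      then show "e x * of_real (poly (pCons a g) x) = k x"
        unfolding ex k_def by (simp add: algebra_simps)
    qed
    have meas: "(\<lambda>x. e x * of_real (poly (pCons a g) x)) \<in> borel_measurable \<mu>"
      by measurable
    have "(\<integral>x. k x \<partial>\<mu>) = of_real a * w + z * (w * cpoly g z + cpoly (Q g) z) + of_real (L g)"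
      unfolding k_def w using int1 pCons.IH ig by (simp add: L_eq_integral[OF \<mu>] w)
    then show ?case using k AE meas
      by (subst integrable_cong_AE[OF meas _ AE], simp, subst integral_cong_AE[OF meas _ AE])
        (auto simp: Q_pCons algebra_simps)
  qed
  then show ?thesis unfolding e_def .
qed

text \<open>The numbers w P_k(z) + R_k(z) are the Fourier coefficients of 1 / (x - z) with respect
  to the orthonormal polynomials; Bessel's inequality applies to its real and imaginary
  parts.\<close>

lemma cauchy_coefficient_summable:
  assumes \<mu>: "\<mu> \<in> V s" and z: "z \<notin> \<real>"
  defines "w \<equiv> (\<integral>x. 1 / (complex_of_real x - z) \<partial>\<mu>)"
  shows "summable (\<lambda>k. (norm (w * P k z + R k z))\<^sup>2)"
proof -
  note sets = V_D(1)[OF \<mu>]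
  have [measurable_cong]: "sets \<mu> = sets borel" by fact
  define \<delta> where "\<delta> = \<bar>Im z\<bar>"
  have \<delta>: "\<delta> > 0" "\<And>x. \<delta> \<le> norm (complex_of_real x - z)" using nonreal_dist[OF z] by (auto simp: \<delta>_def)
  define f where "f = (\<lambda>x. 1 / (complex_of_real x - z))"
  have nf: "norm (f x) \<le> 1 / \<delta>" for x
    using \<delta>(1) \<delta>(2)[of x] by (auto simp: f_def norm_divide intro!: divide_left_mono mult_pos_pos)
  have Re: "AE x in \<mu>. norm (Re (f x)) \<le> 1 / \<delta>" and Im: "AE x in \<mu>. norm (Im (f x)) \<le> 1 / \<delta>"
    using nf abs_Re_le_cmod abs_Im_le_cmod order_trans by (auto intro!: AE_I2) blast+
  have mRe: "(\<lambda>x. Re (f x)) \<in> borel_measurable \<mu>" and mIm: "(\<lambda>x. Im (f x)) \<in> borel_measurable \<mu>"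
    unfolding f_def by measurable
  have eq: "(norm (w * P k z + R k z))\<^sup>2 =
      (\<integral>x. Re (f x) * poly (p k) x \<partial>\<mu>)\<^sup>2 + (\<integral>x. Im (f x) * poly (p k) x \<partial>\<mu>)\<^sup>2" for k
  proof -
    have i: "integrable \<mu> (\<lambda>x. f x * of_real (poly (p k) x))"
      and e: "(\<integral>x. f x * of_real (poly (p k) x) \<partial>\<mu>) = w * P k z + R k z"
      using integral_poly_cauchy_kernel[OF \<mu> \<delta>(1), of z "p k"] \<delta>(2)
      by (auto simp: f_def w_def second_kind_eq_Q)
    show ?thesis unfolding cmod_power2 e[symmetric] integral_Re[OF i, symmetric] integral_Im[OF i, symmetric]
      by simp
  qed
  show ?thesis
  proof (rule summableI_nonneg_bounded)
    fix n
    show "(\<Sum>k<n. (norm (w * P k z + R k z))\<^sup>2) \<le>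
       (\<integral>x. Re (f x) * Re (f x) \<partial>\<mu>) + (\<integral>x. Im (f x) * Im (f x) \<partial>\<mu>)"
      unfolding eq sum.distrib
      by (intro add_mono bessel_inequality[OF \<mu> mRe Re] bessel_inequality[OF \<mu> mIm Im])
  qed simp
qed

text \<open>Two solutions have different transforms w and w' at some nonreal z. Subtracting the two
  square summable coefficient sequences isolates (w - w') P_k(z), then R_k(z) follows, and the
  inverted transfer relation carries summability to 0.\<close>

lemma indeterminate_square_summable:
  assumes ind: "indeterminate s"
  shows "summable (\<lambda>k. (norm (P k 0))\<^sup>2)" "summable (\<lambda>k. (norm (R k 0))\<^sup>2)"
proof -
  have "\<exists>\<mu> \<nu>. \<mu> \<in> V s \<and> \<nu> \<in> V s \<and> \<mu> \<noteq> \<nu>"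
    using ind unfolding indeterminate_def determinate_def by blast
  then obtain \<mu> \<nu> where mn: "\<mu> \<in> V s" "\<nu> \<in> V s" "\<mu> \<noteq> \<nu>" by blast
  then obtain z where z: "z \<notin> \<real>"
    "(\<integral>x. 1 / (complex_of_real x - z) \<partial>\<mu>) \<noteq> (\<integral>x. 1 / (complex_of_real x - z) \<partial>\<nu>)"
    using cauchy_transform_unique[of \<mu> \<nu>] V_D by metis
  define w where "w = (\<integral>x. 1 / (complex_of_real x - z) \<partial>\<mu>)"
  define w' where "w' = (\<integral>x. 1 / (complex_of_real x - z) \<partial>\<nu>)"
  have ne: "w - w' \<noteq> 0" using z by (simp add: w_def w'_def)
  have c: "summable (\<lambda>k. (norm (w * P k z + R k z))\<^sup>2)" "summable (\<lambda>k. (norm (w' * P k z + R k z))\<^sup>2)"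
    unfolding w_def w'_def by (intro cauchy_coefficient_summable mn z)+
  have P_eq: "P k z = 1 / (w - w') * (w * P k z + R k z) + - 1 / (w - w') * (w' * P k z + R k z)" for k
    using ne by (simp add: divide_simps) (simp add: algebra_simps)
  have sP: "summable (\<lambda>k. (norm (P k z))\<^sup>2)"
    by (subst P_eq) (rule summable_norm_square_combination[OF c])
  have "summable (\<lambda>k. (norm (1 * (w * P k z + R k z) + (- w) * P k z))\<^sup>2)"
    by (rule summable_norm_square_combination[OF c(1) sP])
  then have sR: "summable (\<lambda>k. (norm (R k z))\<^sup>2)" by simp
  define E where "E = (\<Sum>k. (norm (P k z))\<^sup>2 + (norm (R k z))\<^sup>2)"
  have "(\<Sum>k<n. (norm (P k z))\<^sup>2 + (norm (R k z))\<^sup>2) \<le> E" for n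
    unfolding E_def by (intro sum_le_suminf summable_add sP sR) auto
  note bound = square_summable_at_0[OF this]
  have "summable (\<lambda>k. (norm (P k 0))\<^sup>2 + (norm (R k 0))\<^sup>2)"
    by (rule summableI_nonneg_bounded[OF _ bound]) simp
  then show "summable (\<lambda>k. (norm (P k 0))\<^sup>2)" "summable (\<lambda>k. (norm (R k 0))\<^sup>2)"
    by (auto elim!: summable_comparison_test'[where N = 0])
qed

end

section \<open>Limits of the Nevanlinna polynomials\<close>

locale indeterminate_sequence = moment_sequence +
  assumes indeterminate: "indeterminate s"
begin

abbreviation A :: "complex \<Rightarrow> complex" where "A \<equiv> Nev_A s"
abbreviation B :: "complex \<Rightarrow> complex" where "B \<equiv> Nev_B s"
abbreviation C :: "complex \<Rightarrow> complex" where "C \<equiv> Nev_C s"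
abbreviation D :: "complex \<Rightarrow> complex" where "D \<equiv> Nev_D s"

text \<open>The Gronwall bound depends on z only through its modulus and increases with it, so one
  constant serves a whole disc. This is the source of the locally uniform convergence and of the
  continuity of A, B, C, D.\<close>

lemma locally_bounded_square_sums:
  "\<exists>M. \<forall>n. \<forall>z\<in>cball 0 r. (\<Sum>k<n. (norm (P k z))\<^sup>2) \<le> M \<and> (\<Sum>k<n. (norm (R k z))\<^sup>2) \<le> M"
proof -
  define E where "E = (\<Sum>k. (norm (P k 0))\<^sup>2 + (norm (R k 0))\<^sup>2)"
  have E: "(\<Sum>k<n. (norm (P k 0))\<^sup>2 + (norm (R k 0))\<^sup>2) \<le> E" for n
    unfolding E_def using indeterminate_square_summable[OF indeterminate]
    by (intro sum_le_suminf summable_add) auto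
  have E0: "E \<ge> 0" using E[of 0] by simp
  define M where "M = exp (8 * (1 + r\<^sup>2 * E) * E)"
  have bd: "(\<Sum>k<n. (norm (P k z))\<^sup>2 + (norm (R k z))\<^sup>2) \<le> M" if "z \<in> cball 0 r" for n z
  proof -
    have "(norm z)\<^sup>2 \<le> r\<^sup>2" using that by (intro power_mono) auto
    then have "(norm z)\<^sup>2 * E * E \<le> r\<^sup>2 * E * E" using E0 by (intro mult_right_mono) auto
    then have "exp (8 * (1 + (norm z)\<^sup>2 * E) * E) \<le> M"
      unfolding M_def by (simp add: algebra_simps)
    then show ?thesis using square_summable_from_0[OF E, where n = n and z = z] by linarith
  qed
  have nn: "(\<Sum>k<n. (norm (f k z))\<^sup>2) \<ge> 0" for n and f :: "nat \<Rightarrow> complex \<Rightarrow> complex" and z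
    by (intro sum_nonneg) auto
  show ?thesis
  proof (intro exI[of _ M] allI ballI)
    fix n z assume "z \<in> cball (0::complex) r"
    from bd[OF this, of n] nn[where f = P and z = z and n = n] nn[where f = R and z = z and n = n]
    show "(\<Sum>k<n. (norm (P k z))\<^sup>2) \<le> M \<and> (\<Sum>k<n. (norm (R k z))\<^sup>2) \<le> M"
      unfolding sum.distrib by linarith
  qed
qed

lemma square_summable:
  "summable (\<lambda>k. (norm (P k z))\<^sup>2)" "summable (\<lambda>k. (norm (R k z))\<^sup>2)"
proof -
  obtain M where M: "\<And>n z'. z' \<in> cball 0 (norm z) \<Longrightarrow>
      (\<Sum>k<n. (norm (P k z'))\<^sup>2) \<le> M \<and> (\<Sum>k<n. (norm (R k z'))\<^sup>2) \<le> M"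
    using locally_bounded_square_sums[of "norm z"] by blast
  show "summable (\<lambda>k. (norm (P k z))\<^sup>2)" "summable (\<lambda>k. (norm (R k z))\<^sup>2)"
    using M[of z] by (auto intro!: summableI_nonneg_bounded[where x = M])
qed

lemma kernel_limit:
  assumes u: "summable (\<lambda>k. (norm (u k))\<^sup>2)" and X: "X = P \<or> X = R"
  shows "uniform_limit (cball 0 r) (\<lambda>n z. \<Sum>k<n. u k * X k z) (\<lambda>z. \<Sum>k. u k * X k z) sequentially"
    and "summable (\<lambda>k. u k * X k z)"
    and "continuous_on UNIV (\<lambda>z. \<Sum>k. u k * X k z)"
proof -
  have *: "\<exists>M. \<forall>z n. z \<in> cball 0 r \<longrightarrow> (\<Sum>k<n. (norm (X k z))\<^sup>2) \<le> M" for r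
    using locally_bounded_square_sums[of r] X by blast
  show ul: "uniform_limit (cball 0 r) (\<lambda>n z. \<Sum>k<n. u k * X k z) (\<lambda>z. \<Sum>k. u k * X k z) sequentially" for r
    using *[of r] uniform_limit_square_summable(1)[OF u, where S = "cball 0 r" and X = X] by blast
  show "summable (\<lambda>k. u k * X k z)"
    using *[of "norm z"] uniform_limit_square_summable(2)[OF u, where S = "cball 0 (norm z)" and X = X and z = z] by auto
  have cont: "continuous_on S (X k)" for S k
    using X by (auto simp: cpoly_def intro!: continuous_intros)
  have "continuous_on (cball 0 r) (\<lambda>z. \<Sum>k. u k * X k z)" for r
    by (rule uniform_limit_theorem[OF always_eventually ul])
      (auto intro!: continuous_intros cont)
  then have "continuous_on (ball 0 r) (\<lambda>z. \<Sum>k. u k * X k z)" for r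
    using ball_subset_cball continuous_on_subset by blast
  moreover have "(\<Union>r\<in>UNIV. ball (0::complex) r) = UNIV"
    by (auto intro: gt_ex)
  ultimately show "continuous_on UNIV (\<lambda>z. \<Sum>k. u k * X k z)"
    using continuous_on_open_UN[of UNIV "\<lambda>r. ball 0 r" "\<lambda>z. \<Sum>k. u k * X k z"] by auto
qed

lemma kernel_limit_0:
  assumes X: "X = P \<or> X = R" and Y: "Y = P \<or> Y = R"
  shows "uniform_limit (cball 0 r) (\<lambda>n z. c + z * (\<Sum>k<n. Y k 0 * X k z)) (\<lambda>z. c + z * (\<Sum>k. Y k 0 * X k z)) sequentially"
    and "continuous_on UNIV (\<lambda>z. c + z * (\<Sum>k. Y k 0 * X k z))"
proof -
  have Y: "summable (\<lambda>k. (norm (Y k 0))\<^sup>2)" using Y square_summable by blast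
  note k = kernel_limit[OF Y X]
  show "continuous_on UNIV (\<lambda>z. c + z * (\<Sum>k. Y k 0 * X k z))"
    by (intro continuous_intros k(3))
  have "compact ((\<lambda>z. \<Sum>k. Y k 0 * X k z) ` cball 0 r)"
    by (intro compact_continuous_image continuous_on_subset[OF k(3)]) auto
  then have b: "bounded ((\<lambda>z. \<Sum>k. Y k 0 * X k z) ` cball 0 r)" by (rule compact_imp_bounded)
  show "uniform_limit (cball 0 r) (\<lambda>n z. c + z * (\<Sum>k<n. Y k 0 * X k z)) (\<lambda>z. c + z * (\<Sum>k. Y k 0 * X k z)) sequentially"
    by (intro uniform_limit_add uniform_limit_const uniform_lim_mult k(1) b) auto
qed

lemma uniform_limit_ABCD:
  "uniform_limit (cball 0 r) An A sequentially" "uniform_limit (cball 0 r) Bn B sequentially"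
  "uniform_limit (cball 0 r) Cn C sequentially" "uniform_limit (cball 0 r) Dn D sequentially"
  using kernel_limit_0(1)[of R R 0 r] kernel_limit_0(1)[of P R "-1" r]
    kernel_limit_0(1)[of R P 1 r] kernel_limit_0(1)[of P P 0 r]
  unfolding ABCDn_def[abs_def] Nev_A_def[abs_def] Nev_B_def[abs_def] Nev_C_def[abs_def] Nev_D_def[abs_def]
  by auto

lemma tendsto_ABCD:
  "(\<lambda>n. An n z) \<longlonglongrightarrow> A z" "(\<lambda>n. Bn n z) \<longlonglongrightarrow> B z"
  "(\<lambda>n. Cn n z) \<longlonglongrightarrow> C z" "(\<lambda>n. Dn n z) \<longlonglongrightarrow> D z"
  by (rule tendsto_uniform_limitI[OF uniform_limit_ABCD(1)[of "norm z"]]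
      tendsto_uniform_limitI[OF uniform_limit_ABCD(2)[of "norm z"]]
      tendsto_uniform_limitI[OF uniform_limit_ABCD(3)[of "norm z"]]
      tendsto_uniform_limitI[OF uniform_limit_ABCD(4)[of "norm z"]]; simp)+

lemma continuous_ABCD:
  "continuous_on UNIV A" "continuous_on UNIV B" "continuous_on UNIV C" "continuous_on UNIV D"
  using kernel_limit_0(2)[of R R 0] kernel_limit_0(2)[of P R "-1"]
    kernel_limit_0(2)[of R P 1] kernel_limit_0(2)[of P P 0]
  unfolding Nev_A_def[abs_def] Nev_B_def[abs_def] Nev_C_def[abs_def] Nev_D_def[abs_def] by auto

lemma ABCD_det: "A z * D z - B z * C z = 1"
proof -
  have "(\<lambda>n. An n z * Dn n z - Bn n z * Cn n z) \<longlonglongrightarrow> A z * D z - B z * C z"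
    by (intro tendsto_intros tendsto_ABCD)
  then show ?thesis by (simp add: ABCDn_det LIMSEQ_const_iff)
qed

text \<open>The reproducing kernel in bilinear form; \<open>N\<close> is its second-kind companion.
  Together they give the transform of a solution with maximal mass at \<open>a\<close>.\<close>

definition K :: "complex \<Rightarrow> complex \<Rightarrow> complex" where "K a z = (\<Sum>k. P k a * P k z)"
definition N :: "complex \<Rightarrow> complex \<Rightarrow> complex" where "N a z = (\<Sum>k. P k a * R k z)"

lemma tendsto_KN:
  "(\<lambda>n. \<Sum>k<n. P k a * P k z) \<longlonglongrightarrow> K a z" "(\<lambda>n. \<Sum>k<n. P k a * R k z) \<longlonglongrightarrow> N a z"
  unfolding K_def N_def
  by (intro summable_LIMSEQ kernel_limit(2)[of "\<lambda>k. P k a"] square_summable; simp)+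

lemma continuous_KN: "continuous_on UNIV (K a)" "continuous_on UNIV (N a)"
  unfolding K_def[abs_def] N_def[abs_def]
  by (intro kernel_limit(3)[of "\<lambda>k. P k a"] square_summable; simp)+

lemma K_eq: "(z - a) * K a z = D a * B z - B a * D z"
proof (rule LIMSEQ_unique)
  show "(\<lambda>n. (z - a) * (\<Sum>k<n. P k a * P k z)) \<longlonglongrightarrow> (z - a) * K a z"
    by (intro tendsto_intros tendsto_KN)
  show "(\<lambda>n. (z - a) * (\<Sum>k<n. P k a * P k z)) \<longlonglongrightarrow> D a * B z - B a * D z"
    unfolding christoffel_darboux_P by (intro tendsto_intros tendsto_ABCD)
qed

lemma N_eq: "(z - a) * N a z = D a * A z - B a * C z - 1"
proof (rule LIMSEQ_unique)
  show "(\<lambda>n. (z - a) * (\<Sum>k<n. P k a * R k z)) \<longlonglongrightarrow> (z - a) * N a z"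
    by (intro tendsto_intros tendsto_KN)
  show "(\<lambda>n. (z - a) * (\<Sum>k<n. P k a * R k z)) \<longlonglongrightarrow> D a * A z - B a * C z - 1"
    unfolding christoffel_darboux_R by (intro tendsto_intros tendsto_ABCD)
qed

end

section \<open>Quadrature and compactness\<close>

lemma abs_le_one_plus_square: "\<bar>y :: real\<bar> \<le> 1 + y\<^sup>2"
proof -
  have "2 * \<bar>y\<bar> \<le> 1 + y\<^sup>2" using sum_squares_bound[of 1 "\<bar>y\<bar>"] by simp
  then show ?thesis by linarith
qed

lemma cpoly_mult: "cpoly (f * g) z = cpoly f z * cpoly g z"
  by (induction f rule: pCons_induct) (simp_all add: cpoly_add cpoly_smult algebra_simps)

lemma ex_complex_root:
  assumes "degree f > 0"
  shows "\<exists>z. cpoly f z = 0"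
proof -
  have "degree (map_poly complex_of_real f) > 0" using assms by (simp add: degree_map_poly)
  then have "\<not> constant (poly (map_poly complex_of_real f))" by (simp add: constant_degree)
  then show ?thesis unfolding cpoly_def by (rule fundamental_theorem_of_algebra)
qed

text \<open>The remainder of f modulo the real quadratic with roots z and its conjugate is real and
  of degree at most 1; vanishing at a nonreal point, it is 0.\<close>

lemma nonreal_root_quadratic_dvd:
  assumes "cpoly f z = 0" "Im z \<noteq> 0"
  shows "[:(norm z)\<^sup>2, - 2 * Re z, 1:] dvd f"
proof -
  define h where "h = [:(norm z)\<^sup>2, - 2 * Re z, 1:]"
  have h0: "h \<noteq> 0" by (simp add: h_def)
  have hz: "cpoly h z = 0"
    unfolding h_def cmod_power2 by (simp add: complex_eq_iff power2_eq_square algebra_simps)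
  have "degree (f mod h) < 2 \<or> f mod h = 0"
    using degree_mod_less[OF h0, of f] by (auto simp: h_def)
  then obtain r0 r1 where r: "f mod h = [:r0, r1:]"
  proof -
    assume a: "\<And>r0 r1. f mod h = [:r0, r1:] \<Longrightarrow> thesis"
    have "f mod h = [:coeff (f mod h) 0, coeff (f mod h) 1:]"
      using \<open>degree (f mod h) < 2 \<or> f mod h = 0\<close>
      by (intro poly_eqI) (auto simp: coeff_pCons coeff_eq_0 split: nat.splits)
    then show thesis by (rule a)
  qed
  have "cpoly f z = cpoly (f div h * h + f mod h) z" by simp
  then have "complex_of_real r0 + z * of_real r1 = 0"
    using assms(1) unfolding cpoly_add cpoly_mult hz r by simp
  then have "r0 = 0 \<and> r1 = 0" using assms(2) by (auto simp: complex_eq_iff)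
  then show ?thesis using r by (simp add: h_def dvd_eq_mod_eq_0)
qed

text \<open>\<open>point_measure\<close> lives on the space \<open>S\<close> with every subset
  measurable; its image under the identity is a Borel measure on the line, as weak convergence
  requires.\<close>

definition discrete_measure :: "real set \<Rightarrow> (real \<Rightarrow> real) \<Rightarrow> real measure" where
  "discrete_measure S w = distr (point_measure S (\<lambda>a. ennreal (w a))) borel (\<lambda>x. x)"

lemma sets_discrete_measure [simp, measurable_cong]: "sets (discrete_measure S w) = sets borel"
  by (simp add: discrete_measure_def)

lemma measurable_point_measure_real: "f \<in> measurable (point_measure S w) (borel :: real measure)"
  by (auto simp: measurable_def space_point_measure sets_point_measure)

lemma
  fixes f :: "real \<Rightarrow> 'a::{banach, second_countable_topology}"
  assumes "finite S" "\<And>a. a \<in> S \<Longrightarrow> w a \<ge> 0" "f \<in> borel_measurable borel"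
  shows integrable_discrete_measure: "integrable (discrete_measure S w) f"
    and integral_discrete_measure: "(\<integral>x. f x \<partial>discrete_measure S w) = (\<Sum>a\<in>S. w a *\<^sub>R f a)"
  using assms unfolding discrete_measure_def
  by (auto simp: integrable_distr_eq integral_distr measurable_point_measure_real
     integrable_point_measure_finite lebesgue_integral_point_measure_finite)

lemma real_distribution_discrete_measure:
  assumes "finite S" "\<And>a. a \<in> S \<Longrightarrow> w a \<ge> 0" "(\<Sum>a\<in>S. w a) = 1"
  shows "real_distribution (discrete_measure S w)"
proof -
  have "emeasure (discrete_measure S w) UNIV = emeasure (point_measure S (\<lambda>a. ennreal (w a))) S"
    unfolding discrete_measure_def
    by (subst emeasure_distr) (auto simp: measurable_point_measure_real space_point_measure)
  also have "\<dots> = 1" using assms by (simp add: emeasure_point_measure_finite sum_ennreal)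
  finally have "prob_space (discrete_measure S w)"
    by (intro prob_spaceI) (simp add: sets_eq_imp_space_eq[OF sets_discrete_measure])
  then show ?thesis by (simp add: real_distribution_def real_distribution_axioms_def)
qed

context moment_sequence
begin

text \<open>A quasi-orthogonal polynomial has no factor \<open>h \<ge> 0\<close> of degree two: if \<open>g = h T\<close>, then
  \<open>L (g T) = L (h T\<^sup>2) > 0\<close>. Hence its roots are real and simple.\<close>

lemma quasi_orthogonal_roots:
  assumes g0: "g \<noteq> 0" and deg: "degree g \<le> n + 2"
    and orth: "\<And>f. degree f \<le> n \<Longrightarrow> L (g * f) = 0"
  shows "card {x. poly g x = 0} = degree g"
proof -
  have no_dvd: False if h: "h dvd g" "degree h = 2" "\<And>x. poly h x \<ge> 0" for h
  proof -
    obtain T where T: "g = h * T" using h(1) by (elim dvdE)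
    have "T \<noteq> 0" "h \<noteq> 0" using T g0 by auto
    then have "degree g = 2 + degree T" using T h(2) by (simp add: degree_mult_eq)
    then have "L (g * T) = 0" using deg by (intro orth) simp
    moreover obtain \<mu> where "\<mu> \<in> V s" using V_nonempty by auto
    then have "L (g * T) > 0"
      using \<open>T \<noteq> 0\<close> \<open>h \<noteq> 0\<close> h(3) unfolding T
      by (intro L_pos) (auto simp: mult.assoc intro!: mult_nonneg_nonneg)
    ultimately show False by simp
  qed
  have "\<exists>S. finite S \<and> card S = k \<and> (\<Prod>a\<in>S. [:- a, 1:]) dvd g" if "k \<le> degree g" for k
    using that
  proof (induction k)
    case 0
    show ?case by (intro exI[of _ "{}"]) simp
  next
    case (Suc k)
    then obtain S T where S: "finite S" "card S = k" and T: "g = (\<Prod>a\<in>S. [:- a, 1:]) * T"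
      by (metis Suc_leD dvdE)
    have prod0: "(\<Prod>a\<in>S. [:- a, 1:]) \<noteq> 0" "T \<noteq> 0" using g0 T by auto
    have "degree (\<Prod>a\<in>S. [:- a, 1:]) = k" using S by (simp add: degree_prod_eq_sum_degree)
    then have "degree g = k + degree T" using degree_mult_eq[OF prod0] T by simp
    then have "degree T > 0" using Suc.prems by simp
    then obtain z where z: "cpoly T z = 0" using ex_complex_root by blast
    have gz: "cpoly g z = 0" by (simp add: T cpoly_mult z)
    have "Im z = 0"
    proof (rule ccontr)
      assume im: "Im z \<noteq> 0"
      have nn: "poly [:(norm z)\<^sup>2, - 2 * Re z, 1:] x \<ge> 0" for x
      proof -
        have "poly [:(norm z)\<^sup>2, - 2 * Re z, 1:] x = (x - Re z)\<^sup>2 + (Im z)\<^sup>2"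
          unfolding cmod_power2 by (simp add: power2_eq_square algebra_simps)
        then show ?thesis by simp
      qed
      then show False using no_dvd[OF nonreal_root_quadratic_dvd[OF gz im]] by simp
    qed
    then obtain b where b: "z = of_real b" by (metis complex_is_Real_iff Reals_cases)
    then have "poly T b = 0" using z by (simp add: cpoly_of_real)
    then have bT: "[:- b, 1:] dvd T" by (simp add: poly_eq_0_iff_dvd)
    have "b \<notin> S"
    proof
      assume "b \<in> S"
      then have "[:- b, 1:] dvd (\<Prod>a\<in>S. [:- a, 1:])" using S by (intro dvd_prodI) auto
      then have "[:- b, 1:] * [:- b, 1:] dvd g" unfolding T using bT by (rule mult_dvd_mono)
      moreover have "degree ([:- b, 1:] * [:- b, 1:]) = 2" by simp
      moreover have "poly ([:- b, 1:] * [:- b, 1:]) x \<ge> 0" for x unfolding poly_mult by simp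
      ultimately show False by (rule no_dvd)
    qed
    moreover have "[:- b, 1:] * (\<Prod>a\<in>S. [:- a, 1:]) dvd g"
      unfolding T using mult_dvd_mono[OF dvd_refl bT, of "\<Prod>a\<in>S. [:- a, 1:]"] by (simp only: mult.commute)
    ultimately show ?case using S by (intro exI[of _ "insert b S"]) auto
  qed
  from this[of "degree g"] obtain S where S: "finite S" "card S = degree g" "(\<Prod>a\<in>S. [:- a, 1:]) dvd g"
    by auto
  have "S \<subseteq> {x. poly g x = 0}"
  proof
    fix a assume "a \<in> S"
    then have "[:- a, 1:] dvd g" using S dvd_trans[OF dvd_prodI[of S a "\<lambda>a. [:- a, 1:]"]] by blast
    then show "a \<in> {x. poly g x = 0}" by (simp add: poly_eq_0_iff_dvd)
  qed
  then have "degree g \<le> card {x. poly g x = 0}"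
    using card_mono[OF poly_roots_finite[OF g0]] S by metis
  then show ?thesis using card_poly_roots_bound[OF g0] by simp
qed

text \<open>Dividing f by \<open>g\<close> leaves a remainder that Lagrange interpolation at the
  simple real roots reproduces, while the multiple of \<open>g\<close> is annihilated by
  \<open>L\<close>. The weight at a root is \<open>L\<close> of the squared Lagrange polynomial,
  hence nonnegative; that square has degree at most 2 deg g - 2, and deg g \<le> n + 2 brings it
  within the range of exactness.\<close>

lemma quadrature:
  assumes g0: "g \<noteq> 0" and deg: "degree g \<le> n + 2"
    and orth: "\<And>f. degree f \<le> n \<Longrightarrow> L (g * f) = 0"
  defines "S \<equiv> {x. poly g x = 0}"
  obtains w where "finite S" "\<And>a. a \<in> S \<Longrightarrow> w a \<ge> 0" "degree g > n"
    "\<And>f. degree f \<le> degree g + n \<Longrightarrow> L f = (\<Sum>a\<in>S. w a * poly f a)"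
proof -
  have fin: "finite S" unfolding S_def by (rule poly_roots_finite[OF g0])
  have card: "card S = degree g" unfolding S_def by (rule quasi_orthogonal_roots[OF g0 deg orth])
  \<comment> \<open>Otherwise \<open>g\<close> would be orthogonal to itself.\<close>
  have dn: "degree g > n" using L_square_pos[OF g0] orth[of g] by (cases "degree g \<le> n") auto
  define l where "l a = (\<Prod>b\<in>S - {a}. smult (1 / (a - b)) [:- b, 1:])" for a
  have ll: "poly (l a) c = (if a = c then 1 else 0)" if "a \<in> S" "c \<in> S" for a c
    using fin that unfolding l_def poly_prod by (auto intro!: prod.neutral simp: divide_simps)
  have dl: "degree (l a) < degree g" if "a \<in> S" for a
  proof -
    have "degree (l a) \<le> (\<Sum>b\<in>S - {a}. degree (smult (1 / (a - b)) [:- b, 1:]))"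
      using degree_prod_sum_le[of "S - {a}" "\<lambda>b. smult (1 / (a - b)) [:- b, 1:]"] fin
      unfolding l_def o_def by blast
    also have "\<dots> \<le> (\<Sum>b\<in>S - {a}. 1)" by (intro sum_mono) (simp add: degree_smult_eq)
    also have "\<dots> < card S" using card_Diff1_less[OF fin that] by (simp only: card_eq_sum[symmetric])
    finally show ?thesis using card by simp
  qed
  define w where "w a = L (l a)" for a
  have exact: "L f = (\<Sum>a\<in>S. w a * poly f a)" if f: "degree f \<le> degree g + n" for f
  proof -
    define r where "r = f mod g"
    have "degree r < degree g \<or> r = 0" unfolding r_def using degree_mod_less[OF g0] by blast
    then have dr: "degree r < degree g" using dn by auto
    have fr: "f = g * (f div g) + r" unfolding r_def by simp
    have "degree (f div g) \<le> n"
    proof (cases "f div g = 0")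
      case False
      then have "degree (g * (f div g)) = degree g + degree (f div g)" using g0 by (rule degree_mult_eq[rotated])
      moreover have "degree (g * (f div g)) \<le> degree g + n"
        using fr f dr by (metis add_diff_cancel_right' degree_diff_le less_imp_le trans_le_add1)
      ultimately show ?thesis by simp
    qed simp
    then have "L f = L r" by (subst fr) (simp add: L_add orth)
    also have "r = (\<Sum>a\<in>S. smult (poly r a) (l a))"
    proof (rule poly_eqI_degree[of S])
      fix c assume c: "c \<in> S"
      have "poly (\<Sum>a\<in>S. smult (poly r a) (l a)) c = (\<Sum>a\<in>S. if a = c then poly r a else 0)"
        unfolding poly_sum using c by (intro sum.cong) (auto simp: ll)
      then show "poly r c = poly (\<Sum>a\<in>S. smult (poly r a) (l a)) c" using c fin by simp
    next
      show "degree (\<Sum>a\<in>S. smult (poly r a) (l a)) < card S"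
        unfolding card using dl dn by (intro degree_sum_less) (auto intro: le_less_trans[OF degree_smult_le])
    qed (simp add: card dr)
    also have "L (\<Sum>a\<in>S. smult (poly r a) (l a)) = (\<Sum>a\<in>S. w a * poly r a)"
      by (simp add: L_sum L_smult w_def mult.commute)
    also have "\<dots> = (\<Sum>a\<in>S. w a * poly f a)"
    proof (intro sum.cong refl)
      fix a assume "a \<in> S"
      then show "w a * poly r a = w a * poly f a"
        using arg_cong[OF fr, of "\<lambda>h. poly h a"] by (simp add: S_def)
    qed
    finally show ?thesis .
  qed
  have "w a \<ge> 0" if a: "a \<in> S" for a
  proof -
    have l0: "l a \<noteq> 0" using ll[OF a a] by auto
    have "degree (l a * l a) \<le> degree g + n" using dl[OF a] deg l0 by (simp add: degree_mult_eq)
    then have "L (l a * l a) = (\<Sum>b\<in>S. if b = a then w b else 0)"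
      unfolding exact[OF \<open>degree (l a * l a) \<le> _\<close>] using a by (intro sum.cong) (auto simp: ll)
    then have "L (l a * l a) = w a" using a fin by simp
    then show ?thesis using L_square_pos[OF l0] by simp
  qed
  then show ?thesis using that fin dn exact by blast
qed

text \<open>The division identity for 1 / (x - z) again, with a finite sum in place of a solution;
  the degree bound is what allows the sum to be exchanged for \<open>L f\<close>.\<close>

lemma quadrature_cauchy:
  assumes ex: "\<And>f. degree f \<le> d \<Longrightarrow> L f = (\<Sum>a\<in>S. w a * poly f a)"
    and z: "z \<notin> \<real>" and f: "degree f \<le> d"
  shows "(\<Sum>a\<in>S. of_real (w a) * (1 / (complex_of_real a - z)) * of_real (poly f a)) =
    (\<Sum>a\<in>S. of_real (w a) * (1 / (complex_of_real a - z))) * cpoly f z + cpoly (Q f) z"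
  using f
proof (induction f rule: pCons_induct)
  case (pCons c f)
  have df: "degree f \<le> d" using pCons.prems by (simp split: if_splits)
  define e where "e a = 1 / (complex_of_real a - z)" for a
  have ea: "e a * of_real a = 1 + z * e a" for a
    unfolding e_def using nonreal_ne_of_real[OF z, of a] by (simp add: divide_simps)
  have "(\<Sum>a\<in>S. of_real (w a) * e a * of_real (poly (pCons c f) a)) =
    (\<Sum>a\<in>S. of_real c * (of_real (w a) * e a) + z * (of_real (w a) * e a * of_real (poly f a)) + of_real (w a * poly f a))"
  proof (intro sum.cong refl)
    fix a
    have "of_real (w a) * e a * of_real (poly (pCons c f) a) =
      of_real (w a) * (of_real c * e a + (e a * of_real a) * of_real (poly f a))"
      by (simp add: algebra_simps)
    then show "of_real (w a) * e a * of_real (poly (pCons c f) a) = of_real c * (of_real (w a) * e a)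
       + z * (of_real (w a) * e a * of_real (poly f a)) + of_real (w a * poly f a)"
      unfolding ea by (simp add: algebra_simps)
  qed
  also have "\<dots> = of_real c * (\<Sum>a\<in>S. of_real (w a) * e a)
      + z * (\<Sum>a\<in>S. of_real (w a) * e a * of_real (poly f a)) + of_real (L f)"
    by (simp only: ex[OF df] sum.distrib sum_distrib_left of_real_sum)
  also have "(\<Sum>a\<in>S. of_real (w a) * e a * of_real (poly f a)) =
    (\<Sum>a\<in>S. of_real (w a) * e a) * cpoly f z + cpoly (Q f) z"
    using pCons.IH[OF df] unfolding e_def .
  finally show ?case unfolding e_def[symmetric] by (simp add: Q_pCons algebra_simps)
qed simp

section \<open>Weak limits with prescribed moments\<close>

lemma tight_of_second_moment:
  assumes rd: "\<And>n. real_distribution (\<sigma> n)" and int: "\<And>n. integrable (\<sigma> n) (\<lambda>x. x ^ 2)"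
    and m: "\<And>n. (\<integral>x. x ^ 2 \<partial>\<sigma> n) \<le> c"
  shows "tight \<sigma>"
  unfolding tight_def
proof (intro conjI allI impI)
  fix \<epsilon> :: real assume \<epsilon>: "\<epsilon> > 0"
  define T where "T = sqrt ((\<bar>c\<bar> + 1) / \<epsilon>)"
  have T0: "T > 0" unfolding T_def using \<epsilon> by simp
  have T2: "T\<^sup>2 = (\<bar>c\<bar> + 1) / \<epsilon>" unfolding T_def using \<epsilon> by simp
  show "\<exists>a b. a < b \<and> (\<forall>n. measure (\<sigma> n) {a<..b} > 1 - \<epsilon>)"
  proof (rule exI[of _ "- T"], rule exI[of _ T], intro conjI allI)
    fix n
    interpret real_distribution "\<sigma> n" by (rule rd)
    have "measure (\<sigma> n) (- {- T<..T}) = (\<integral>x. indicator (- {- T<..T}) x \<partial>\<sigma> n)" by simp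
    also have "\<dots> \<le> (\<integral>x. x ^ 2 / T\<^sup>2 \<partial>\<sigma> n)"
    proof (rule integral_mono)
      fix x
      have "T\<^sup>2 \<le> x\<^sup>2" if "x \<notin> {- T<..T}"
      proof -
        have "T \<le> \<bar>x\<bar>" using that by auto
        then have "T\<^sup>2 \<le> \<bar>x\<bar>\<^sup>2" using T0 by (intro power_mono) auto
        then show ?thesis by simp
      qed
      then show "indicator (- {- T<..T}) x \<le> x ^ 2 / T\<^sup>2"
        using T0 by (auto simp: indicator_def divide_simps)
    next
      show "integrable (\<sigma> n) (indicator (- {- T<..T}) :: real \<Rightarrow> real)"
        by (intro integrable_real_indicator) (auto simp: emeasure_eq_measure)
    qed (use int in auto)
    also have "\<dots> \<le> c / T\<^sup>2" using m[of n] T0 by (simp add: divide_right_mono)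
    also have "\<dots> < \<epsilon>" unfolding T2 using \<epsilon> by (simp add: field_simps) (smt (verit) mult_less_cancel_left_pos)
    finally have "measure (\<sigma> n) (- {- T<..T}) < \<epsilon>" .
    moreover have "measure (\<sigma> n) (- {- T<..T}) = 1 - measure (\<sigma> n) {- T<..T}"
      using prob_compl[of "{- T<..T}"] by (simp add: Compl_eq_Diff_UNIV)
    ultimately show "measure (\<sigma> n) {- T<..T} > 1 - \<epsilon>" by simp
  qed (use T0 in auto)
qed (rule rd)

text \<open>With y = x^k the truncation y / (1 + \<epsilon> y^2) is bounded and continuous, and its
  distance from y is at most \<epsilon> |y|^3 \<le> \<epsilon> (1 + y^4), which the moment of order
  4k controls.\<close>

lemma power_truncation_error:
  fixes x \<epsilon> :: real
  assumes "\<epsilon> > 0"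
  shows "\<bar>x ^ k - x ^ k / (1 + \<epsilon> * x ^ (2 * k))\<bar> \<le> \<epsilon> * (1 + x ^ (4 * k))"
    "\<bar>x ^ k / (1 + \<epsilon> * x ^ (2 * k))\<bar> \<le> 1 + 1 / \<epsilon>"
proof -
  define y where "y = x ^ k"
  have y2: "x ^ (2 * k) = y\<^sup>2" and y4: "x ^ (4 * k) = (y\<^sup>2)\<^sup>2"
    unfolding y_def by (simp_all add: power_mult[symmetric] mult_ac)
  have pos: "1 + \<epsilon> * y\<^sup>2 > 0" using assms by (intro add_pos_nonneg) auto
  have "y - y / (1 + \<epsilon> * y\<^sup>2) = \<epsilon> * (y * y\<^sup>2) / (1 + \<epsilon> * y\<^sup>2)"
    using pos by (simp add: divide_simps) (simp add: algebra_simps)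
  then have "\<bar>y - y / (1 + \<epsilon> * y\<^sup>2)\<bar> = \<epsilon> * (\<bar>y\<bar> * y\<^sup>2) / (1 + \<epsilon> * y\<^sup>2)"
    using assms by (simp add: abs_mult)
  also have "\<dots> \<le> \<epsilon> * (\<bar>y\<bar> * y\<^sup>2) / 1"
    using assms pos by (intro divide_left_mono) auto
  also have "\<bar>y\<bar> * y\<^sup>2 \<le> 1 + (y\<^sup>2)\<^sup>2"
  proof -
    have "2 * (\<bar>y\<bar> * y\<^sup>2) \<le> y\<^sup>2 + (y\<^sup>2)\<^sup>2" using sum_squares_bound[of "\<bar>y\<bar>" "y\<^sup>2"] by (simp add: mult_ac)
    moreover have "2 * y\<^sup>2 \<le> 1 + (y\<^sup>2)\<^sup>2" using sum_squares_bound[of 1 "y\<^sup>2"] by simp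
    ultimately show ?thesis using zero_le_power2[of y] zero_le_power2[of "y\<^sup>2"] by linarith
  qed
  finally show "\<bar>x ^ k - x ^ k / (1 + \<epsilon> * x ^ (2 * k))\<bar> \<le> \<epsilon> * (1 + x ^ (4 * k))"
    unfolding y2 y4 y_def[symmetric] using assms by simp
  have "\<bar>y\<bar> \<le> 1 + y\<^sup>2" by (rule abs_le_one_plus_square)
  also have "\<dots> \<le> (1 + 1 / \<epsilon>) * (1 + \<epsilon> * y\<^sup>2)"
    using assms by (simp add: field_simps)
  finally show "\<bar>x ^ k / (1 + \<epsilon> * x ^ (2 * k))\<bar> \<le> 1 + 1 / \<epsilon>"
    unfolding y2 y_def[symmetric] using pos by (simp add: abs_divide pos_divide_le_eq)
qed

text \<open>Tightness comes from the second moment, which is why exactness is required up to n + 2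
  and not just n. Weak convergence tests only bounded functions, so the limit first gets finite even
  moments by cutting off at height \<open>m\<close>, and then the right moments by the smooth
  truncation.\<close>

lemma helly_moments:
  assumes rd: "\<And>n. real_distribution (\<sigma> n)" and int: "\<And>n k. integrable (\<sigma> n) (\<lambda>x. x ^ k)"
    and mom: "\<And>n k. k \<le> n + 2 \<Longrightarrow> (\<integral>x. x ^ k \<partial>\<sigma> n) = s k"
  obtains r M where "strict_mono (r :: nat \<Rightarrow> nat)" "M \<in> V s" "real_distribution M" "weak_conv_m (\<sigma> \<circ> r) M"
proof -
  have "tight \<sigma>" by (rule tight_of_second_moment[OF rd int, where c = "s 2"]) (simp add: mom)
  from tight_imp_convergent_subsubsequence[OF this strict_mono_id] obtain r M where
    r: "strict_mono (r :: nat \<Rightarrow> nat)" and M: "real_distribution M" and wc: "weak_conv_m (\<sigma> \<circ> r) M"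
    by auto
  interpret M: real_distribution M by fact
  have lim: "(\<lambda>n. \<integral>x. f x \<partial>\<sigma> (r n)) \<longlonglongrightarrow> (\<integral>x. f x \<partial>M)"
    if "\<And>x. isCont f x" "\<And>x. norm (f x) \<le> b" for f :: "real \<Rightarrow> real" and b
    using weak_conv_imp_integral_bdd_continuous_conv[OF _ M wc that] rd by simp
  have ev: "eventually (\<lambda>n. (\<integral>x. x ^ k \<partial>\<sigma> (r n)) = s k) sequentially" for k
    using eventually_ge_at_top[of k]
  proof eventually_elim
    fix n assume "k \<le> n"
    then have "k \<le> r n + 2" using seq_suble[OF r, of n] by linarith
    then show "(\<integral>x. x ^ k \<partial>\<sigma> (r n)) = s k" by (rule mom)
  qed
  have even_int: "integrable M (\<lambda>x. x ^ (2 * j))" for j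
  proof -
    define f where "f m x = min (x ^ (2 * j)) (real m)" for m :: nat and x :: real
    have fnn: "0 \<le> f m x" for m x unfolding f_def by simp
    have fb: "norm (f m x) \<le> real m" for m x using fnn[of m x] by (simp add: f_def)
    have fc: "isCont (f m) x" for m x unfolding f_def by (intro continuous_intros)
    have [measurable]: "f m \<in> borel_measurable borel" for m unfolding f_def by measurable
    have fi: "integrable M (f m)" for m by (rule M.integrable_const_bound[of _ "real m"]) (auto simp: fb simp del: real_norm_def)
    have le: "(\<integral>x. f m x \<partial>M) \<le> s (2 * j)" for m
    proof (rule tendsto_upperbound[OF lim[OF fc fb]])
      show "eventually (\<lambda>n. (\<integral>x. f m x \<partial>\<sigma> (r n)) \<le> s (2 * j)) sequentially"
        using ev[of "2 * j"]
      proof eventually_elim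
        fix n assume e: "(\<integral>x. x ^ (2 * j) \<partial>\<sigma> (r n)) = s (2 * j)"
        interpret S: real_distribution "\<sigma> (r n)" by (rule rd)
        have "(\<integral>x. f m x \<partial>\<sigma> (r n)) \<le> (\<integral>x. x ^ (2 * j) \<partial>\<sigma> (r n))"
        proof (rule integral_mono[OF _ int])
          show "integrable (\<sigma> (r n)) (f m)"
            by (rule S.integrable_const_bound[of _ "real m"]) (auto simp: fb simp del: real_norm_def)
        qed (simp add: f_def)
        then show "(\<integral>x. f m x \<partial>\<sigma> (r n)) \<le> s (2 * j)" using e by simp
      qed
    qed simp
    have mono: "incseq (\<lambda>m. \<integral>x. f m x \<partial>M)"
      by (intro incseq_SucI integral_mono fi) (auto simp: f_def)
    then have "convergent (\<lambda>m. \<integral>x. f m x \<partial>M)"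
      using le by (intro Bseq_mono_convergent Bseq_eq_bounded[THEN iffD2] boundedI[of _ "s (2 * j)"])
        (auto simp: incseq_def integral_nonneg_AE[OF AE_I2] fnn abs_of_nonneg Bochner_Integration.integral_nonneg)
    then obtain y where y: "(\<lambda>m. \<integral>x. f m x \<partial>M) \<longlonglongrightarrow> y" by (auto simp: convergent_def)
    show ?thesis
    proof (rule integrable_monotone_convergence[OF fi _ _ y])
      show "AE x in M. mono (\<lambda>n. f n x)" by (rule AE_I2) (auto simp: mono_def f_def)
      show "AE x in M. (\<lambda>i. f i x) \<longlonglongrightarrow> x ^ (2 * j)"
      proof (rule AE_I2)
        fix x :: real
        have "eventually (\<lambda>i. f i x = x ^ (2 * j)) sequentially"
          using eventually_ge_at_top[of "nat \<lceil>x ^ (2 * j)\<rceil>"]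
        proof eventually_elim
          fix i assume "nat \<lceil>x ^ (2 * j)\<rceil> \<le> i"
          then have "x ^ (2 * j) \<le> real i" by linarith
          then show "f i x = x ^ (2 * j)" by (simp add: f_def)
        qed
        then show "(\<lambda>i. f i x) \<longlonglongrightarrow> x ^ (2 * j)" by (rule tendsto_eventually)
      qed
    qed simp
  qed
  have intM: "integrable M (\<lambda>x. x ^ k)" for k
  proof (rule Bochner_Integration.integrable_bound)
    show "integrable M (\<lambda>x. 1 + x ^ (2 * k))" using even_int by simp
    show "AE x in M. norm (x ^ k) \<le> norm (1 + x ^ (2 * k))"
    proof (rule AE_I2)
      fix x :: real
      have "\<bar>x ^ k\<bar> \<le> 1 + (x ^ k)\<^sup>2" by (rule abs_le_one_plus_square)
      then show "norm (x ^ k) \<le> norm (1 + x ^ (2 * k))" by (simp add: power_mult[symmetric] mult.commute)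
    qed
  qed simp
  have momM: "(\<integral>x. x ^ k \<partial>M) = s k" for k
  proof -
    have trunc: "\<bar>(\<integral>x. x ^ k \<partial>\<rho>) - (\<integral>x. x ^ k / (1 + \<epsilon> * x ^ (2 * k)) \<partial>\<rho>)\<bar>
        \<le> \<epsilon> * (1 + (\<integral>x. x ^ (4 * k) \<partial>\<rho>))"
      if \<epsilon>: "\<epsilon> > 0" and \<rho>: "real_distribution \<rho>" "\<And>k. integrable \<rho> (\<lambda>x. x ^ k)" for \<epsilon> \<rho>
    proof -
      interpret real_distribution \<rho> by fact
      have [measurable]: "(\<lambda>x::real. x ^ k / (1 + \<epsilon> * x ^ (2 * k))) \<in> borel_measurable borel" by measurable
      have i: "integrable \<rho> (\<lambda>x. x ^ k / (1 + \<epsilon> * x ^ (2 * k)))"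
        by (rule integrable_const_bound[of _ "1 + 1 / \<epsilon>"]) (use power_truncation_error(2)[OF \<epsilon>] in auto)
      have "\<bar>(\<integral>x. x ^ k \<partial>\<rho>) - (\<integral>x. x ^ k / (1 + \<epsilon> * x ^ (2 * k)) \<partial>\<rho>)\<bar> =
        \<bar>\<integral>x. x ^ k - x ^ k / (1 + \<epsilon> * x ^ (2 * k)) \<partial>\<rho>\<bar>" using i \<rho>(2) by simp
      also have "\<dots> \<le> (\<integral>x. \<bar>x ^ k - x ^ k / (1 + \<epsilon> * x ^ (2 * k))\<bar> \<partial>\<rho>)" by (rule integral_abs_bound)
      also have "\<dots> \<le> (\<integral>x. \<epsilon> * (1 + x ^ (4 * k)) \<partial>\<rho>)"
        using i \<rho>(2) power_truncation_error(1)[OF \<epsilon>] by (intro integral_mono) auto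
      also have "\<dots> = \<epsilon> * (1 + (\<integral>x. x ^ (4 * k) \<partial>\<rho>))" using \<rho>(2) prob_space by simp
      finally show ?thesis .
    qed
    define c where "c = 2 + s (4 * k) + (\<integral>x. x ^ (4 * k) \<partial>M)"
    have main: "\<bar>s k - (\<integral>x. x ^ k \<partial>M)\<bar> \<le> \<epsilon> * c" if \<epsilon>: "\<epsilon> > 0" for \<epsilon>
    proof -
      define f where "f = (\<lambda>x::real. x ^ k / (1 + \<epsilon> * x ^ (2 * k)))"
      have ne: "1 + \<epsilon> * x ^ (2 * k) \<noteq> 0" for x
        using \<epsilon> by (metis add_nonneg_pos add.commute less_irrefl less_numeral_extra(1) mult_nonneg_nonneg
           less_imp_le zero_le_even_power' power_even_eq zero_le_power2)
      have "(\<lambda>n. \<integral>x. f x \<partial>\<sigma> (r n)) \<longlonglongrightarrow> (\<integral>x. f x \<partial>M)"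
      proof (rule lim)
        show "isCont f x" for x unfolding f_def by (intro continuous_intros ne)
        show "norm (f x) \<le> 1 + 1 / \<epsilon>" for x unfolding f_def using power_truncation_error(2)[OF \<epsilon>] by simp
      qed
      then have "(\<lambda>n. \<bar>s k - (\<integral>x. f x \<partial>\<sigma> (r n))\<bar>) \<longlonglongrightarrow> \<bar>s k - (\<integral>x. f x \<partial>M)\<bar>"
        by (intro tendsto_intros)
      moreover have "eventually (\<lambda>n. \<bar>s k - (\<integral>x. f x \<partial>\<sigma> (r n))\<bar> \<le> \<epsilon> * (1 + s (4 * k))) sequentially"
        using ev[of k] ev[of "4 * k"]
      proof eventually_elim
        case (elim n)
        then show ?case using trunc[OF \<epsilon> rd int, of "r n"] by (simp add: f_def)
      qed
      ultimately have "\<bar>s k - (\<integral>x. f x \<partial>M)\<bar> \<le> \<epsilon> * (1 + s (4 * k))"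
        by (rule tendsto_upperbound) simp
      then show ?thesis using trunc[OF \<epsilon> M intM] unfolding f_def c_def by (simp add: algebra_simps)
    qed
    have "\<bar>s k - (\<integral>x. x ^ k \<partial>M)\<bar> \<le> 0 + e" if "e > 0" for e
    proof -
      have "e / (\<bar>c\<bar> + 1) > 0" using that by simp
      from main[OF this] have "\<bar>s k - (\<integral>x. x ^ k \<partial>M)\<bar> \<le> e / (\<bar>c\<bar> + 1) * c" .
      also have "\<dots> \<le> e"
      proof -
        have "e * c \<le> e * (\<bar>c\<bar> + 1)" using that by (intro mult_left_mono) auto
        then show ?thesis by (simp add: pos_divide_le_eq)
      qed
      finally show ?thesis by simp
    qed
    then have "\<bar>s k - (\<integral>x. x ^ k \<partial>M)\<bar> \<le> 0" by (rule field_le_epsilon)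
    then show ?thesis by simp
  qed
  have "M \<in> V s" by (rule V_I[OF V_nonempty _ intM momM]) simp
  then show ?thesis using that r M wc by blast
qed

end

lemma weak_conv_discrete_measure:
  fixes f :: "real \<Rightarrow> 'a::{banach, second_countable_topology}"
  assumes "\<And>j. finite (S j)" "\<And>j a. a \<in> S j \<Longrightarrow> w j a \<ge> 0"
    and "\<And>j. real_distribution (discrete_measure (S j) (w j))" "real_distribution M"
    and "weak_conv_m (\<lambda>j. discrete_measure (S j) (w j)) M"
    and f: "\<And>x. isCont f x" "\<And>x. norm (f x) \<le> c"
  shows "(\<lambda>j. \<Sum>a\<in>S j. w j a *\<^sub>R f a) \<longlonglongrightarrow> (\<integral>x. f x \<partial>M)"
proof -
  have "f \<in> borel_measurable borel"
    using f(1) by (intro borel_measurable_continuous_onI) (simp add: continuous_at_imp_continuous_on)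
  then show ?thesis
    using weak_conv_imp_integral_bdd_continuous_conv[OF assms(3-5) f] assms(1,2)
    by (simp add: integral_discrete_measure)
qed

section \<open>Kernel polynomials and solutions of maximal mass\<close>

context moment_sequence
begin

text \<open>The Christoffel-Darboux kernel as a polynomial in its second argument.\<close>

definition kern :: "real \<Rightarrow> nat \<Rightarrow> real poly" where
  "kern a n = (\<Sum>k<n. smult (poly (p k) a) (p k))"

lemma kern_reproducing:
  assumes "h = 0 \<or> degree h < n"
  shows "L (kern a n * h) = poly h a"
proof -
  have "L (kern a n * h) = (\<Sum>k<n. poly (p k) a * L (h * p k))"
    by (simp add: kern_def sum_distrib_right L_sum L_smult mult.commute[of h])
  also have "\<dots> = poly (\<Sum>k<n. smult (L (h * p k)) (p k)) a"
    by (simp add: poly_sum mult.commute)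
  also have "\<dots> = poly h a" using p_expansion[OF assms] by simp
  finally show ?thesis .
qed

lemma poly_kern_diagonal: "poly (kern a n) a = (\<Sum>k<n. (poly (p k) a)\<^sup>2)"
  by (simp add: kern_def poly_sum power2_eq_square)

lemma kern_diagonal_ge_1: "n > 0 \<Longrightarrow> poly (kern a n) a \<ge> 1"
proof -
  assume "n > 0"
  then have "(\<Sum>k\<in>{0}. (poly (p k) a)\<^sup>2) \<le> (\<Sum>k<n. (poly (p k) a)\<^sup>2)"
    by (intro sum_mono2) auto
  then show ?thesis by (simp add: poly_kern_diagonal p_0)
qed

lemma degree_kern: "n > 0 \<Longrightarrow> degree (kern a n) < n"
  unfolding kern_def by (rule degree_sum_less) (auto intro: le_less_trans[OF degree_smult_le])

lemma L_kern_square: "L (kern a n * kern a n) = poly (kern a n) a"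
proof (cases "n = 0")
  case True
  then show ?thesis by (simp add: kern_def)
next
  case False
  then show ?thesis using degree_kern by (intro kern_reproducing) auto
qed

text \<open>The quadratures are returned together with their limit, because weights, transforms and
  the position of the nodes are computed before passing to the limit. Degree at most m + 3 with
  orthogonality up to m + 1 fits \<open>quadrature\<close>; the exactness obtained covers degree m +
  2, as \<open>helly_moments\<close> demands. Real and complex test functions need separate clauses
  because the existential admits no type variable for the codomain.\<close>

lemma quasi_orthogonal_limit:
  assumes g: "\<And>m. g m \<noteq> 0" "\<And>m. degree (g m) \<le> m + 3"
    "\<And>m. \<forall>f. degree f \<le> m + 1 \<longrightarrow> L (g m * f) = 0"
  shows "\<exists>M r w. M \<in> V s \<and> strict_mono (r :: nat \<Rightarrow> nat) \<and>
    (\<forall>m. finite {x. poly (g m) x = 0}) \<and> (\<forall>m a. poly (g m) a = 0 \<longrightarrow> w m a \<ge> 0) \<and>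
    (\<forall>m f. degree f \<le> degree (g m) + (m + 1) \<longrightarrow>
      L f = (\<Sum>a | poly (g m) a = 0. w m a * poly f a)) \<and>
    (\<forall>(f :: real \<Rightarrow> complex) c. (\<forall>x. isCont f x) \<longrightarrow> (\<forall>x. norm (f x) \<le> c) \<longrightarrow>
      (\<lambda>j. \<Sum>a | poly (g (r j)) a = 0. of_real (w (r j) a) * f a) \<longlonglongrightarrow> (\<integral>x. f x \<partial>M)) \<and>
    (\<forall>(f :: real \<Rightarrow> real) c. (\<forall>x. isCont f x) \<longrightarrow> (\<forall>x. norm (f x) \<le> c) \<longrightarrow>
      (\<lambda>j. \<Sum>a | poly (g (r j)) a = 0. w (r j) a * f a) \<longlonglongrightarrow> (\<integral>x. f x \<partial>M))"
proof -
  have "\<exists>w. finite {x. poly (g m) x = 0} \<and> (\<forall>a. poly (g m) a = 0 \<longrightarrow> w a \<ge> 0) \<and> degree (g m) > m + 1 \<and>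
    (\<forall>f. degree f \<le> degree (g m) + (m + 1) \<longrightarrow> L f = (\<Sum>a | poly (g m) a = 0. w a * poly f a))" for m
    by (rule quadrature[of "g m" "m + 1"]) (use g in \<open>auto simp: numeral_3_eq_3\<close>)
  then obtain w where fin: "\<And>m. finite {x. poly (g m) x = 0}"
    and w: "\<And>m a. poly (g m) a = 0 \<Longrightarrow> w m a \<ge> 0" and deg: "\<And>m. degree (g m) > m + 1"
    and ex: "\<And>m f. degree f \<le> degree (g m) + (m + 1) \<Longrightarrow>
        L f = (\<Sum>a | poly (g m) a = 0. w m a * poly f a)"
    by metis
  define \<sigma> where "\<sigma> m = discrete_measure {x. poly (g m) x = 0} (w m)" for m
  have int: "(\<integral>x. f x \<partial>\<sigma> m) = (\<Sum>a | poly (g m) a = 0. w m a * f a)"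
    if "f \<in> borel_measurable borel" for f :: "real \<Rightarrow> real" and m
    unfolding \<sigma>_def using fin w that by (subst integral_discrete_measure) auto
  have integrable: "integrable (\<sigma> m) f" if "f \<in> borel_measurable borel" for f :: "real \<Rightarrow> real" and m
    unfolding \<sigma>_def using fin w that by (intro integrable_discrete_measure) auto
  have rd: "real_distribution (\<sigma> m)" for m
    unfolding \<sigma>_def using fin w ex[of 1 m] by (intro real_distribution_discrete_measure) auto
  have mom: "(\<integral>x. x ^ k \<partial>\<sigma> m) = s k" if "k \<le> m + 2" for k m
  proof -
    have "s k = L (monom 1 k)"
      by (simp add: moment_functional_def degree_monom_eq if_distrib[of "\<lambda>x. x * _"] cong: if_cong)
    also have "\<dots> = (\<Sum>a | poly (g m) a = 0. w m a * a ^ k)"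
      using ex[of "monom 1 k" m] that deg[of m] by (simp add: degree_monom_eq poly_monom)
    finally show ?thesis by (simp add: int)
  qed
  obtain r M where r: "strict_mono (r :: nat \<Rightarrow> nat)" and M: "M \<in> V s" "real_distribution M"
    and wc: "weak_conv_m (\<sigma> \<circ> r) M"
    by (rule helly_moments[of \<sigma>, OF rd _ mom]) (auto intro!: integrable)
  have wc': "weak_conv_m (\<lambda>j. discrete_measure {x. poly (g (r j)) x = 0} (w (r j))) M"
    using wc by (simp add: \<sigma>_def[abs_def] o_def)
  note conv = weak_conv_discrete_measure[OF _ _ _ M(2) wc']
  show ?thesis
  proof (intro exI[of _ M] exI[of _ r] exI[of _ w] conjI allI impI)
    fix f :: "real \<Rightarrow> complex" and c
    assume "\<forall>x. isCont f x" "\<forall>x. norm (f x) \<le> c"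
    then have f: "\<And>x. isCont f x" "\<And>x. norm (f x) \<le> c" by auto
    have "(\<lambda>j. \<Sum>a | poly (g (r j)) a = 0. w (r j) a *\<^sub>R f a) \<longlonglongrightarrow> (\<integral>x. f x \<partial>M)"
      by (rule conv[OF _ _ _ f]) (use fin w rd in \<open>auto simp: \<sigma>_def\<close>)
    then show "(\<lambda>j. \<Sum>a | poly (g (r j)) a = 0. of_real (w (r j) a) * f a) \<longlonglongrightarrow> (\<integral>x. f x \<partial>M)"
      by (simp add: scaleR_conv_of_real)
  next
    fix f :: "real \<Rightarrow> real" and c
    assume "\<forall>x. isCont f x" "\<forall>x. norm (f x) \<le> c"
    then have f: "\<And>x. isCont f x" "\<And>x. norm (f x) \<le> c" by auto
    have "(\<lambda>j. \<Sum>a | poly (g (r j)) a = 0. w (r j) a *\<^sub>R f a) \<longlonglongrightarrow> (\<integral>x. f x \<partial>M)"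
      by (rule conv[OF _ _ _ f]) (use fin w rd in \<open>auto simp: \<sigma>_def\<close>)
    then show "(\<lambda>j. \<Sum>a | poly (g (r j)) a = 0. w (r j) a * f a) \<longlonglongrightarrow> (\<integral>x. f x \<partial>M)"
      by simp
  qed (use M(1) r fin w ex in auto)
qed

text \<open>The polynomial (x - a) K_n(a, x) is quasi-orthogonal and yields a quadrature with node a
  of weight 1 / K_n(a, a) \<ge> 1 / \<kappa>. Weak limits do not lose mass on the closed set {a}.
  Only a bound on the kernel is assumed, so that the contrapositive applies to a determinate
  sequence later.\<close>

lemma max_mass_solution:
  assumes bound: "\<And>n. (\<Sum>k<n. (poly (p k) a)\<^sup>2) \<le> \<kappa>"
  shows "\<exists>\<mu>\<in>V s. measure \<mu> {a} * \<kappa> \<ge> 1"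
proof -
  define g where "g m = [:- a, 1:] * kern a (m + 3)" for m
  have k0: "kern a (m + 3) \<noteq> 0" for m using kern_diagonal_ge_1[of "m + 3" a] by auto
  have g0: "g m \<noteq> 0" for m using k0[of m] unfolding g_def by (metis mult_eq_0_iff one_neq_zero pCons_eq_0_iff)
  have dg: "degree (g m) = 1 + degree (kern a (m + 3))" for m
    unfolding g_def using k0[of m] by (subst degree_mult_eq) auto
  have g3: "degree (g m) \<le> m + 3" for m using dg[of m] degree_kern[of "m + 3" a] by simp
  have go': "L (g m * f) = 0" if "degree f \<le> m + 1" for f m
  proof -
    have "L (kern a (m + 3) * ([:- a, 1:] * f)) = poly ([:- a, 1:] * f) a"
      using that degree_mult_le[of "[:- a, 1:]" f] by (intro kern_reproducing) auto
    then show ?thesis by (simp only: g_def mult_ac) simp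
  qed
  have go: "\<forall>f. degree f \<le> m + 1 \<longrightarrow> L (g m * f) = 0" for m using go' by blast
  obtain M r w where M: "M \<in> V s" and "strict_mono (r :: nat \<Rightarrow> nat)"
    and fin': "\<forall>m. finite {x. poly (g m) x = 0}" and w': "\<forall>m b. poly (g m) b = 0 \<longrightarrow> w m b \<ge> 0"
    and ex': "\<forall>m f. degree f \<le> degree (g m) + (m + 1) \<longrightarrow>
      L f = (\<Sum>b | poly (g m) b = 0. w m b * poly f b)"
    and "\<forall>(f :: real \<Rightarrow> complex) c. (\<forall>x. isCont f x) \<longrightarrow> (\<forall>x. norm (f x) \<le> c) \<longrightarrow>
      (\<lambda>j. \<Sum>a | poly (g (r j)) a = 0. of_real (w (r j) a) * f a) \<longlonglongrightarrow> (\<integral>x. f x \<partial>M)"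
    and conv': "\<forall>(f :: real \<Rightarrow> real) c. (\<forall>x. isCont f x) \<longrightarrow> (\<forall>x. norm (f x) \<le> c) \<longrightarrow>
      (\<lambda>j. \<Sum>b | poly (g (r j)) b = 0. w (r j) b * f b) \<longlonglongrightarrow> (\<integral>x. f x \<partial>M)"
    using quasi_orthogonal_limit[of g, OF g0 g3 go] by (elim exE conjE) (rule that)
  have fin: "finite {x. poly (g m) x = 0}" and w: "poly (g m) b = 0 \<Longrightarrow> w m b \<ge> 0"
    and ex: "degree f \<le> degree (g m) + (m + 1) \<Longrightarrow> L f = (\<Sum>b | poly (g m) b = 0. w m b * poly f b)"
    for m b f using fin' w' ex' by blast+
  have conv: "(\<lambda>j. \<Sum>b | poly (g (r j)) b = 0. w (r j) b * f b) \<longlonglongrightarrow> (\<integral>x. f x \<partial>M)"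
    if "\<And>x. isCont f x" "\<And>x. norm (f x) \<le> c" for f :: "real \<Rightarrow> real" and c
    using conv' that by blast
  have wa: "w m a \<ge> 1 / \<kappa>" for m
  proof -
    \<comment> \<open>Every node other than \<open>a\<close> is a root of h, so the exact quadrature
      of h^2 reduces to its term at \<open>a\<close>, while \<open>L\<close> of h^2 is h(a).\<close>
    define h where "h = kern a (m + 3)"
    have ha: "poly h a \<ge> 1" unfolding h_def by (rule kern_diagonal_ge_1) simp
    have "poly h a = L (h * h)" unfolding h_def by (rule L_kern_square[symmetric])
    also have "\<dots> = (\<Sum>b | poly (g m) b = 0. w m b * poly (h * h) b)"
      using degree_mult_le[of h h] dg[of m] degree_kern[of "m + 3" a] by (intro ex) (simp add: h_def)
    also have "\<dots> = (\<Sum>b | poly (g m) b = 0. if b = a then w m b * poly (h * h) b else 0)"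
      by (intro sum.cong) (auto simp: g_def h_def)
    also have "\<dots> = w m a * (poly h a * poly h a)" using fin by (simp add: g_def)
    finally have "w m a * poly h a = 1" using ha by simp
    then have "w m a = 1 / poly h a" using ha by (simp add: field_simps)
    moreover have "poly h a \<le> \<kappa>" unfolding h_def poly_kern_diagonal by (rule bound)
    ultimately show ?thesis using ha by (simp add: divide_left_mono)
  qed
  interpret finite_measure M using V_D[OF M] by simp
  have sM: "sets M = sets borel" "space M = UNIV" using V_D[OF M] by auto
  have [measurable_cong]: "sets M = sets borel" by fact
  \<comment> \<open>Tents decreasing to the indicator of {a}: bounded and continuous for the weak
    limit, and equal to 1 at the node.\<close>
  define \<phi> where "\<phi> j x = max 0 (1 - real j * \<bar>x - a\<bar>)" for j x
  have \<phi>b: "norm (\<phi> j x) \<le> 1" for j x unfolding \<phi>_def by auto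
  have "(\<integral>x. \<phi> j x \<partial>M) \<ge> 1 / \<kappa>" for j
  proof (rule tendsto_lowerbound)
    show "(\<lambda>i. \<Sum>b | poly (g (r i)) b = 0. w (r i) b * \<phi> j b) \<longlonglongrightarrow> (\<integral>x. \<phi> j x \<partial>M)"
      by (rule conv[OF _ \<phi>b]) (auto simp: \<phi>_def intro!: continuous_intros)
    show "eventually (\<lambda>i. 1 / \<kappa> \<le> (\<Sum>b | poly (g (r i)) b = 0. w (r i) b * \<phi> j b)) sequentially"
    proof (rule always_eventually, rule allI)
      fix i
      have "1 / \<kappa> \<le> w (r i) a * \<phi> j a" using wa by (simp add: \<phi>_def)
      also have "\<dots> \<le> (\<Sum>b | poly (g (r i)) b = 0. w (r i) b * \<phi> j b)"
        using fin w by (intro member_le_sum) (auto simp: \<phi>_def g_def)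
      finally show "1 / \<kappa> \<le> (\<Sum>b | poly (g (r i)) b = 0. w (r i) b * \<phi> j b)" .
    qed
  qed simp
  moreover have "(\<lambda>j. \<integral>x. \<phi> j x \<partial>M) \<longlonglongrightarrow> (\<integral>x. indicator {a} x \<partial>M)"
  proof (rule integral_dominated_convergence[where w = "\<lambda>_. 1"])
    show "AE x in M. (\<lambda>j. \<phi> j x) \<longlonglongrightarrow> indicator {a} x"
    proof (rule AE_I2)
      fix x
      show "(\<lambda>j. \<phi> j x) \<longlonglongrightarrow> indicator {a} x"
      proof (cases "x = a")
        case False
        have "eventually (\<lambda>j. \<phi> j x = 0) sequentially"
          using eventually_ge_at_top[of "nat \<lceil>1 / \<bar>x - a\<bar>\<rceil>"]
        proof eventually_elim
          fix j assume "nat \<lceil>1 / \<bar>x - a\<bar>\<rceil> \<le> j"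
          then have "1 / \<bar>x - a\<bar> \<le> real j" by linarith
          then show "\<phi> j x = 0" using False by (simp add: \<phi>_def field_simps)
        qed
        then show ?thesis using False by (simp add: tendsto_eventually)
      qed (simp add: \<phi>_def)
    qed
    show "AE x in M. norm (\<phi> j x) \<le> 1" for j using \<phi>b by auto
  qed (auto simp: \<phi>_def)
  ultimately have "1 / \<kappa> \<le> (\<integral>x. indicator {a} x \<partial>M)"
    by (intro tendsto_lowerbound[where f = "\<lambda>j. \<integral>x. \<phi> j x \<partial>M"]) auto
  then have "1 / \<kappa> \<le> measure M {a}" using sM by simp
  moreover have "\<kappa> \<ge> 1" using bound[of 1] by (simp add: p_0)
  ultimately have "1 \<le> measure M {a} * \<kappa>" by (simp add: field_simps)
  then show ?thesis using M by blast
qed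

section \<open>Quasi-orthogonality of the Nevanlinna polynomials\<close>

definition Bp :: "nat \<Rightarrow> real poly" where "Bp n = pCons (- 1) (\<Sum>k<n. smult (poly (q k) 0) (p k))"
definition Dp :: "nat \<Rightarrow> real poly" where "Dp n = pCons 0 (kern 0 n)"

lemma cpoly_Bp: "cpoly (Bp n) z = Bn n z" and cpoly_Dp: "cpoly (Dp n) z = Dn n z"
  by (simp_all add: Bp_def Dp_def kern_def Bn_def Dn_def cpoly_sum cpoly_smult cpoly_at_0)

lemma L_p: "L (p k) = (if k = 0 then 1 else 0)"
  using L_p_p[of k 0] by (simp add: p_0)

text \<open>\<open>Q\<close> produces the numerator of the transform from its denominator. The
  constant term is the sum of q_k(0) L(p_k), which vanishes because L(p_k) = 0 for k > 0 and q_0 =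
  0; for \<open>Dp\<close> the corresponding sum is 1.\<close>

lemma cpoly_Q_Bp: "cpoly (Q (Bp n)) z = An n z"
proof -
  have "(\<Sum>k<n. poly (q k) 0 * L (p k)) = 0"
    by (intro sum.neutral) (simp add: L_p q_0)
  then show ?thesis
    by (simp add: Bp_def Q_pCons Q_sum Q_smult L_sum L_smult An_def cpoly_sum cpoly_smult
       cpoly_at_0 second_kind_eq_Q)
qed

lemma cpoly_Q_Dp: "n > 0 \<Longrightarrow> cpoly (Q (Dp n)) z = Cn n z"
proof -
  assume "n > 0"
  have "(\<Sum>k<n. poly (p k) 0 * L (p k)) = (\<Sum>k<n. if k = 0 then 1 else 0)"
    by (intro sum.cong) (auto simp: L_p p_0)
  also have "\<dots> = 1" using \<open>n > 0\<close> by simp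
  finally show ?thesis
    by (simp add: Dp_def kern_def Q_pCons Q_sum Q_smult L_sum L_smult Cn_def cpoly_sum cpoly_smult
       cpoly_at_0 second_kind_eq_Q)
qed

lemma degree_BDp: "n > 0 \<Longrightarrow> degree (Bp n) \<le> n" "n > 0 \<Longrightarrow> degree (Dp n) \<le> n"
proof -
  assume n: "n > 0"
  have "degree (\<Sum>k<n. smult (poly (q k) 0) (p k)) < n"
    using n by (intro degree_sum_less) (auto intro: le_less_trans[OF degree_smult_le])
  then show "degree (Bp n) \<le> n" using degree_pCons_le by (auto simp: Bp_def)
  show "degree (Dp n) \<le> n" using degree_kern[OF n, of 0] by (auto simp: Dp_def)
qed

text \<open>Put h = x f, whose degree must stay below n. Reproduction at 0 gives L(D_n f) = h(0) =
  0. For \<open>Bp\<close> the sum becomes the value of \<open>Q h\<close> at 0, which is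
  \<open>L f\<close> and cancels against the term -1.\<close>

lemma BDp_quasi_orthogonal:
  assumes "degree f + 1 < n"
  shows "L (Bp n * f) = 0" "L (Dp n * f) = 0"
proof -
  define h where "h = pCons 0 f"
  have h: "h = 0 \<or> degree h < n" using assms by (auto simp: h_def)
  have "Dp n * f = kern 0 n * h" by (simp add: Dp_def h_def mult.commute)
  then show "L (Dp n * f) = 0" using kern_reproducing[OF h, of 0] by (simp add: h_def)
  have "Bp n * f = (\<Sum>k<n. smult (poly (q k) 0) (p k)) * h - f"
    by (simp add: Bp_def h_def algebra_simps)
  then have "L (Bp n * f) = (\<Sum>k<n. poly (q k) 0 * L (h * p k)) - L f"
    by (simp add: L_diff sum_distrib_right L_sum L_smult mult.commute[of h])
  also have "(\<Sum>k<n. poly (q k) 0 * L (h * p k)) = poly (Q (\<Sum>k<n. smult (L (h * p k)) (p k))) 0"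
    by (simp add: Q_sum Q_smult poly_sum second_kind_eq_Q mult.commute)
  also have "(\<Sum>k<n. smult (L (h * p k)) (p k)) = h" by (rule p_expansion[OF h, symmetric])
  also have "poly (Q h) 0 = L f" by (simp add: h_def Q_pCons)
  finally show "L (Bp n * f) = 0" by simp
qed

end

section \<open>N-extremal solutions\<close>

lemma integral_indicator_singleton_mult:
  fixes f :: "real \<Rightarrow> 'a::{real_normed_field, banach, second_countable_topology}"
  assumes "finite_measure \<mu>" and sets: "sets \<mu> = sets borel"
  shows "integrable \<mu> (\<lambda>x. f x * of_real (indicator {a} x))"
    "(\<integral>x. f x * of_real (indicator {a} x) \<partial>\<mu>) = of_real (measure \<mu> {a}) * f a"
proof -
  interpret finite_measure \<mu> by fact
  have sp: "space \<mu> = UNIV" using sets_eq_imp_space_eq[OF sets] by simp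
  have eq: "(\<lambda>x. f x * of_real (indicator {a} x)) = (\<lambda>x. indicator {a} x *\<^sub>R f a)"
    by (auto simp: indicator_def scaleR_conv_of_real)
  have i: "integrable \<mu> (indicator {a} :: real \<Rightarrow> real)"
    by (intro integrable_real_indicator) (auto simp: sets emeasure_eq_measure)
  show "integrable \<mu> (\<lambda>x. f x * of_real (indicator {a} x))"
    unfolding eq using i by (rule integrable_scaleR_left)
  show "(\<integral>x. f x * of_real (indicator {a} x) \<partial>\<mu>) = of_real (measure \<mu> {a}) * f a"
    unfolding eq using i by (subst integral_scaleR_left) (auto simp: sp scaleR_conv_of_real)
qed

lemma integral_abs_squared_le:
  fixes h :: "real \<Rightarrow> real"
  assumes "prob_space \<mu>" and h: "integrable \<mu> h" "integrable \<mu> (\<lambda>x. h x * h x)"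
  shows "(\<integral>x. \<bar>h x\<bar> \<partial>\<mu>)\<^sup>2 \<le> (\<integral>x. h x * h x \<partial>\<mu>)"
proof -
  interpret prob_space \<mu> by fact
  define c where "c = (\<integral>x. \<bar>h x\<bar> \<partial>\<mu>)"
  have "0 \<le> (\<integral>x. (\<bar>h x\<bar> - c)\<^sup>2 \<partial>\<mu>)" by simp
  also have "\<dots> = (\<integral>x. h x * h x - 2 * c * \<bar>h x\<bar> + c\<^sup>2 \<partial>\<mu>)"
    by (intro Bochner_Integration.integral_cong) (auto simp: power2_eq_square algebra_simps)
  also have "\<dots> = (\<integral>x. h x * h x \<partial>\<mu>) - 2 * c * c + c\<^sup>2"
    using h by (simp add: prob_space c_def)
  finally show ?thesis unfolding c_def by (simp add: power2_eq_square)
qed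

lemma (in moment_sequence) V_prob_space: "\<mu> \<in> V s \<Longrightarrow> prob_space \<mu>"
proof -
  assume \<mu>: "\<mu> \<in> V s"
  interpret finite_measure \<mu> using V_D[OF \<mu>] by simp
  have "measure \<mu> (space \<mu>) = 1" using L_eq_integral[OF \<mu>, of 1] by simp
  then show ?thesis by (intro prob_spaceI) (simp add: emeasure_eq_measure)
qed

context moment_sequence
begin

text \<open>With c = \<kappa>(a), nonnegativity of this squared distance bounds the mass at
  \<open>a\<close>, and its convergence to 0 is what maximal mass amounts to.\<close>

lemma kern_deviation:
  fixes c a :: real
  assumes \<mu>: "\<mu> \<in> V s"
  defines "h \<equiv> (\<lambda>n x. c * indicator {a} x - poly (kern a n) x)"
  shows "integrable \<mu> (h n)" "integrable \<mu> (\<lambda>x. h n x * h n x)"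
    "(\<integral>x. h n x * h n x \<partial>\<mu>) =
      c\<^sup>2 * measure \<mu> {a} - 2 * c * measure \<mu> {a} * poly (kern a n) a + poly (kern a n) a"
proof -
  note sets = V_D(1)[OF \<mu>]
  have fin: "finite_measure \<mu>" using V_D[OF \<mu>] by simp
  note ind = integral_indicator_singleton_mult[OF fin sets, where 'a = real, simplified]
  show "integrable \<mu> (h n)"
    unfolding h_def using ind(1)[of "\<lambda>_. c" a] V_D(5)[OF \<mu>] by simp
  define f1 f2 f3 where "f1 = (\<lambda>x. c\<^sup>2 * indicator {a} x)"
    and "f2 = (\<lambda>x. (2 * c * poly (kern a n) x) * indicator {a} x)"
    and "f3 = poly (kern a n * kern a n)"
  have i: "integrable \<mu> f1" "integrable \<mu> f2" "integrable \<mu> f3"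
    unfolding f1_def f2_def f3_def by (intro ind V_D(5)[OF \<mu>])+
  have eq: "h n x * h n x = f1 x - f2 x + f3 x" for x
    unfolding h_def f1_def f2_def f3_def by (auto simp: indicator_def power2_eq_square algebra_simps)
  show "integrable \<mu> (\<lambda>x. h n x * h n x)"
    unfolding eq using i by auto
  have "(\<integral>x. h n x * h n x \<partial>\<mu>) = (\<integral>x. f1 x \<partial>\<mu>) - (\<integral>x. f2 x \<partial>\<mu>) + (\<integral>x. f3 x \<partial>\<mu>)"
    unfolding eq using i by simp
  also have "(\<integral>x. f1 x \<partial>\<mu>) = measure \<mu> {a} * c\<^sup>2"
    unfolding f1_def by (rule ind(2))
  also have "(\<integral>x. f2 x \<partial>\<mu>) = measure \<mu> {a} * (2 * c * poly (kern a n) a)"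
    unfolding f2_def by (rule ind(2))
  also have "(\<integral>x. f3 x \<partial>\<mu>) = poly (kern a n) a"
    unfolding f3_def L_eq_integral[OF \<mu>, symmetric] by (rule L_kern_square)
  finally show "(\<integral>x. h n x * h n x \<partial>\<mu>) =
      c\<^sup>2 * measure \<mu> {a} - 2 * c * measure \<mu> {a} * poly (kern a n) a + poly (kern a n) a"
    by (simp add: mult_ac)
qed

end

section \<open>Maximal mass at a point and the family of N-extremal solutions\<close>

context indeterminate_sequence
begin

text \<open>Reciprocal of the limiting Christoffel function at \<open>a\<close>; the series
  converges because \<open>s\<close> is indeterminate.\<close>

definition \<kappa> :: "real \<Rightarrow> real" where "\<kappa> a = (\<Sum>k. (poly (p k) a)\<^sup>2)"

lemma summable_\<kappa>: "summable (\<lambda>k. (poly (p k) a)\<^sup>2)"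
  using square_summable(1)[of "of_real a"] by (simp add: cpoly_of_real)

lemma \<kappa>_bound: "(\<Sum>k<n. (poly (p k) a)\<^sup>2) \<le> \<kappa> a"
  unfolding \<kappa>_def by (intro sum_le_suminf summable_\<kappa>) auto

lemma \<kappa>_ge_1: "\<kappa> a \<ge> 1"
  using \<kappa>_bound[of a 1] by (simp add: p_0)

lemma kern_tendsto_\<kappa>: "(\<lambda>n. poly (kern a n) a) \<longlonglongrightarrow> \<kappa> a"
  unfolding poly_kern_diagonal \<kappa>_def by (rule summable_LIMSEQ[OF summable_\<kappa>])

lemma K_diagonal: "K (of_real a) (of_real a) = of_real (\<kappa> a)"
proof (rule LIMSEQ_unique[OF tendsto_KN(1)])
  show "(\<lambda>n. \<Sum>k<n. P k (of_real a) * P k (of_real a)) \<longlonglongrightarrow> of_real (\<kappa> a)"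
    using tendsto_of_real[OF kern_tendsto_\<kappa>, of a, where 'a = complex]
    by (simp add: poly_kern_diagonal cpoly_of_real power2_eq_square)
qed

lemma mass_le:
  assumes \<mu>: "\<mu> \<in> V s"
  shows "measure \<mu> {a} * \<kappa> a \<le> 1"
proof -
  have "(\<lambda>n. (\<kappa> a)\<^sup>2 * measure \<mu> {a} - 2 * \<kappa> a * measure \<mu> {a} * poly (kern a n) a + poly (kern a n) a)
    \<longlonglongrightarrow> (\<kappa> a)\<^sup>2 * measure \<mu> {a} - 2 * \<kappa> a * measure \<mu> {a} * \<kappa> a + \<kappa> a"
    by (intro tendsto_intros kern_tendsto_\<kappa>)
  moreover have "0 \<le> (\<kappa> a)\<^sup>2 * measure \<mu> {a} - 2 * \<kappa> a * measure \<mu> {a} * poly (kern a n) a + poly (kern a n) a" for n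
    unfolding kern_deviation(3)[OF \<mu>, symmetric] by simp
  ultimately have "0 \<le> (\<kappa> a)\<^sup>2 * measure \<mu> {a} - 2 * \<kappa> a * measure \<mu> {a} * \<kappa> a + \<kappa> a"
    by (intro tendsto_lowerbound[OF _ always_eventually]) auto
  then have "0 \<le> \<kappa> a * (1 - measure \<mu> {a} * \<kappa> a)" by (simp add: power2_eq_square algebra_simps)
  then show ?thesis using \<kappa>_ge_1[of a] by (simp add: zero_le_mult_iff)
qed

text \<open>If \<open>\<mu>\<close> has maximal mass at \<open>a\<close>, then \<open>K\<^sub>n(a, \<cdot>)\<close> converges in \<open>L\<^sup>2(\<mu>)\<close> to
  \<open>\<kappa>(a)\<close> times the indicator of \<open>{a}\<close>. Testing this against \<open>1 / (x - z)\<close> computes the transform.\<close>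

lemma max_mass_transform:
  assumes \<mu>: "\<mu> \<in> V s" and mass: "measure \<mu> {a} * \<kappa> a \<ge> 1"
    and \<delta>: "\<delta> > 0" "AE x in \<mu>. \<delta> \<le> norm (complex_of_real x - z)"
  shows "(\<integral>x. 1 / (complex_of_real x - z) \<partial>\<mu>) * (D (of_real a) * B z - B (of_real a) * D z) =
    - (D (of_real a) * A z - B (of_real a) * C z)"
proof -
  note sets = V_D(1)[OF \<mu>]
  have [measurable_cong]: "sets \<mu> = sets borel" by fact
  interpret prob_space \<mu> by (rule V_prob_space[OF \<mu>])
  have fin: "finite_measure \<mu>" using V_D[OF \<mu>] by simp
  define w where "w = (\<integral>x. 1 / (complex_of_real x - z) \<partial>\<mu>)"
  define e where "e = (\<lambda>x. 1 / (complex_of_real x - z))"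
  define h where "h = (\<lambda>n x. \<kappa> a * indicator {a} x - poly (kern a n) x)"
  have [measurable]: "e \<in> borel_measurable borel" unfolding e_def by measurable
  have dev: "integrable \<mu> (h n)" "integrable \<mu> (\<lambda>x. h n x * h n x)"
    "(\<integral>x. h n x * h n x \<partial>\<mu>) =
      (\<kappa> a)\<^sup>2 * measure \<mu> {a} - 2 * \<kappa> a * measure \<mu> {a} * poly (kern a n) a + poly (kern a n) a" for n
    unfolding h_def by (rule kern_deviation[OF \<mu>])+
  have mk: "measure \<mu> {a} * \<kappa> a = 1" using mass mass_le[OF \<mu>, of a] by simp
  have eb: "AE x in \<mu>. norm (e x) \<le> 1 / \<delta>"
    using \<delta>(2) by eventually_elim (use \<delta>(1) in \<open>auto simp: e_def norm_divide intro!: divide_left_mono mult_pos_pos\<close>)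
  have ek: "integrable \<mu> (\<lambda>x. e x * of_real (poly f x))" "(\<integral>x. e x * of_real (poly f x) \<partial>\<mu>) = w * cpoly f z + cpoly (Q f) z" for f
    using integral_poly_cauchy_kernel[OF \<mu> \<delta>, of f] by (auto simp: e_def w_def)
  have "(\<lambda>n. \<integral>x. h n x * h n x \<partial>\<mu>) \<longlonglongrightarrow> (\<kappa> a)\<^sup>2 * measure \<mu> {a} - 2 * \<kappa> a * measure \<mu> {a} * \<kappa> a + \<kappa> a"
    unfolding dev(3) by (intro tendsto_intros kern_tendsto_\<kappa>)
  also have "(\<kappa> a)\<^sup>2 * measure \<mu> {a} - 2 * \<kappa> a * measure \<mu> {a} * \<kappa> a + \<kappa> a = \<kappa> a * (1 - measure \<mu> {a} * \<kappa> a)"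
    by (simp add: power2_eq_square algebra_simps)
  also have "\<dots> = 0" by (simp add: mk)
  finally have h0: "(\<lambda>n. sqrt (\<integral>x. h n x * h n x \<partial>\<mu>) / \<delta>) \<longlonglongrightarrow> sqrt 0 / \<delta>"
    using \<delta>(1) by (intro tendsto_intros) auto
  have eh: "(\<integral>x. e x * of_real (h n x) \<partial>\<mu>) = e a - (w * cpoly (kern a n) z + cpoly (Q (kern a n)) z)" for n
  proof -
    note ind = integral_indicator_singleton_mult[OF fin sets, of "\<lambda>x. e x * of_real (\<kappa> a)" a]
    have "(\<lambda>x. e x * of_real (h n x)) = (\<lambda>x. (e x * of_real (\<kappa> a)) * of_real (indicator {a} x) - e x * of_real (poly (kern a n) x))"
      by (simp add: h_def fun_eq_iff algebra_simps)
    then have "(\<integral>x. e x * of_real (h n x) \<partial>\<mu>) = of_real (measure \<mu> {a}) * (e a * of_real (\<kappa> a)) - (w * cpoly (kern a n) z + cpoly (Q (kern a n)) z)"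
      using ind ek[of "kern a n"] by simp
    also have "of_real (measure \<mu> {a}) * (e a * of_real (\<kappa> a)) = e a * of_real (measure \<mu> {a} * \<kappa> a)" by simp
    finally show ?thesis by (simp add: mk)
  qed
  have le: "norm (\<integral>x. e x * of_real (h n x) \<partial>\<mu>) \<le> sqrt (\<integral>x. h n x * h n x \<partial>\<mu>) / \<delta>" for n
  proof -
    have [measurable]: "h n \<in> borel_measurable borel" unfolding h_def by measurable
    have i: "integrable \<mu> (\<lambda>x. e x * of_real (h n x))"
      using dev(1) by (intro integrable_bounded_mult[OF _ _ eb]) auto
    have "norm (\<integral>x. e x * of_real (h n x) \<partial>\<mu>) \<le> (\<integral>x. norm (e x * of_real (h n x)) \<partial>\<mu>)"
      by (rule integral_norm_bound)
    also have "\<dots> \<le> (\<integral>x. 1 / \<delta> * \<bar>h n x\<bar> \<partial>\<mu>)"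
    proof (rule integral_mono_AE)
      show "AE x in \<mu>. norm (e x * of_real (h n x)) \<le> 1 / \<delta> * \<bar>h n x\<bar>"
        using eb by eventually_elim (unfold norm_mult norm_of_real, rule mult_right_mono, auto)
    qed (use i dev(1) in auto)
    also have "\<dots> = (\<integral>x. \<bar>h n x\<bar> \<partial>\<mu>) / \<delta>" by simp
    also have "\<dots> \<le> sqrt (\<integral>x. h n x * h n x \<partial>\<mu>) / \<delta>"
      using \<delta>(1) integral_abs_squared_le[OF V_prob_space[OF \<mu>] dev(1,2)]
      by (intro divide_right_mono real_le_rsqrt) auto
    finally show ?thesis .
  qed
  have "(\<lambda>n. \<integral>x. e x * of_real (h n x) \<partial>\<mu>) \<longlonglongrightarrow> 0"
    by (rule Lim_null_comparison[OF always_eventually h0[simplified]]) (use le in auto)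
  then have "(\<lambda>n. e a - (w * cpoly (kern a n) z + cpoly (Q (kern a n)) z)) \<longlonglongrightarrow> 0"
    unfolding eh .
  moreover have "cpoly (kern a n) z = (\<Sum>k<n. P k (of_real a) * P k z)" for n
    by (simp add: kern_def cpoly_sum cpoly_smult cpoly_of_real)
  moreover have "cpoly (Q (kern a n)) z = (\<Sum>k<n. P k (of_real a) * R k z)" for n
    by (simp add: kern_def Q_sum Q_smult cpoly_sum cpoly_smult cpoly_of_real second_kind_eq_Q)
  moreover have "(\<lambda>n. e a - (w * (\<Sum>k<n. P k (of_real a) * P k z) + (\<Sum>k<n. P k (of_real a) * R k z)))
      \<longlonglongrightarrow> e a - (w * K (of_real a) z + N (of_real a) z)"
    by (intro tendsto_intros tendsto_KN)
  ultimately have ea: "e a = w * K (of_real a) z + N (of_real a) z"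
    using LIMSEQ_unique by fastforce
  \<comment> \<open>A real z is permitted, but it keeps the distance \<delta> from almost every
    point and so cannot be the atom \<open>a\<close>.\<close>
  have az: "complex_of_real a \<noteq> z"
  proof
    assume az: "complex_of_real a = z"
    have "AE x in \<mu>. x \<notin> {a}" using \<delta>(2) by eventually_elim (use \<delta>(1) az in auto)
    then have "measure \<mu> {a} = 0"
      by (subst measure_eq_0_null_sets) (auto simp: AE_iff_null_sets)
    then show False using mk by simp
  qed
  have "- 1 = (z - of_real a) * e a" using az by (simp add: e_def field_simps)
  also have "\<dots> = w * ((z - of_real a) * K (of_real a) z) + (z - of_real a) * N (of_real a) z"
    unfolding ea by (simp add: algebra_simps)
  finally show ?thesis unfolding K_eq N_eq w_def by (simp add: algebra_simps)
qed

text \<open>Numerator and denominator of the transform of \<open>\<mu>\<^sub>t\<close>, with the case \<open>t = \<infinity>\<close> included.\<close>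

definition G :: "ereal \<Rightarrow> complex \<Rightarrow> complex" where
  "G t z = (if \<bar>t\<bar> = \<infinity> then D z else B z + of_real (real_of_ereal t) * D z)"
definition H :: "ereal \<Rightarrow> complex \<Rightarrow> complex" where
  "H t z = (if \<bar>t\<bar> = \<infinity> then C z else A z + of_real (real_of_ereal t) * C z)"

lemma Nev_transform_eq: "Nev_transform s t z = - (H t z / G t z)"
  by (simp add: Nev_transform_def G_def H_def)

text \<open>A D - B C does not change when t times (C, D) is added to (A, B), so a common zero would
  contradict the determinant 1.\<close>

lemma G_H_no_common_zero: "G t z = 0 \<Longrightarrow> H t z \<noteq> 0"
proof
  assume "G t z = 0" "H t z = 0"
  moreover have "A z * D z - B z * C z =
      (A z + of_real (real_of_ereal t) * C z) * D z - (B z + of_real (real_of_ereal t) * D z) * C z"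
    by (simp add: algebra_simps)
  ultimately have "A z * D z - B z * C z = 0" by (simp add: G_def H_def split: if_splits)
  then show False by (simp add: ABCD_det)
qed

lemma continuous_GH: "continuous_on S (G t)" "continuous_on S (H t)"
proof -
  have c: "continuous_on S A" "continuous_on S B" "continuous_on S C" "continuous_on S D"
    using continuous_ABCD continuous_on_subset by blast+
  show "continuous_on S (G t)" "continuous_on S (H t)"
    unfolding G_def[abs_def] H_def[abs_def]
    by (cases "\<bar>t\<bar> = \<infinity>"; simp add: c continuous_on_add continuous_on_mult)+
qed

text \<open>u B_n + v D_n vanishes at all nodes of its quadrature, so the division identity
  collapses to a product formula for the transform, which survives the limit. It is kept multiplied
  by \<open>G\<close> because the absence of nonreal zeros of \<open>G\<close> is itself deduced
  from it. Near a real point where \<open>G\<close> is nonzero, uniform convergence keeps the nodes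
  away, so the limit has no support there.\<close>

lemma N_extremal_solution_exists:
  "\<exists>\<mu>\<in>V s. supp \<mu> \<subseteq> {x. G t (of_real x) = 0} \<and>
    (\<forall>z. z \<notin> \<real> \<longrightarrow> (\<integral>x. 1 / (complex_of_real x - z) \<partial>\<mu>) * G t z = - H t z)"
proof -
  define u where "u = (if \<bar>t\<bar> = \<infinity> then 0 else 1 :: real)"
  define v where "v = (if \<bar>t\<bar> = \<infinity> then 1 else real_of_ereal t)"
  have Guv: "G t z = of_real u * B z + of_real v * D z" and Huv: "H t z = of_real u * A z + of_real v * C z" for z
    by (auto simp: G_def H_def u_def v_def)
  \<comment> \<open>The shift by 3 gives degree at most m + 3 and orthogonality to degree m +
    1.\<close>
  define g where "g m = smult u (Bp (m + 3)) + smult v (Dp (m + 3))" for m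
  have cg: "cpoly (g m) z = of_real u * Bn (m + 3) z + of_real v * Dn (m + 3) z" for m z
    by (simp add: g_def cpoly_add cpoly_smult cpoly_Bp cpoly_Dp)
  have cQg: "cpoly (Q (g m)) z = of_real u * An (m + 3) z + of_real v * Cn (m + 3) z" for m z
    by (simp add: g_def Q_add Q_smult cpoly_add cpoly_smult cpoly_Q_Bp cpoly_Q_Dp)
  have g0: "g m \<noteq> 0" for m
  proof
    assume "g m = 0"
    then have a: "cpoly (g m) z = 0" "cpoly (Q (g m)) z = 0" for z by auto
    \<comment> \<open>If numerator and denominator both vanished, the determinant 1 would make u and
      v both 0, but one of them is 1.\<close>
    have "of_real u * (An (m + 3) 0 * Dn (m + 3) 0 - Bn (m + 3) 0 * Cn (m + 3) 0) = (0 :: complex)"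
      "of_real v * (An (m + 3) 0 * Dn (m + 3) 0 - Bn (m + 3) 0 * Cn (m + 3) 0) = (0 :: complex)"
      using a[of 0] unfolding cg cQg by algebra+
    then show False unfolding ABCDn_det by (auto simp: u_def v_def split: if_splits)
  qed
  have g3: "degree (g m) \<le> m + 3" for m
    unfolding g_def using degree_BDp[of "m + 3"]
    by (intro degree_add_le order_trans[OF degree_smult_le]) auto
  have go': "L (g m * f) = 0" if "degree f \<le> m + 1" for f m
    using BDp_quasi_orthogonal[of f "m + 3"] that by (simp add: g_def distrib_right L_add L_smult)
  have go: "\<forall>f. degree f \<le> m + 1 \<longrightarrow> L (g m * f) = 0" for m using go' by blast
  obtain M r w where M: "M \<in> V s" and r: "strict_mono (r :: nat \<Rightarrow> nat)"
    and fin': "\<forall>m. finite {x. poly (g m) x = 0}" and w': "\<forall>m b. poly (g m) b = 0 \<longrightarrow> w m b \<ge> 0"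
    and ex': "\<forall>m f. degree f \<le> degree (g m) + (m + 1) \<longrightarrow>
      L f = (\<Sum>b | poly (g m) b = 0. w m b * poly f b)"
    and convc: "\<forall>(f :: real \<Rightarrow> complex) c. (\<forall>x. isCont f x) \<longrightarrow> (\<forall>x. norm (f x) \<le> c) \<longrightarrow>
      (\<lambda>j. \<Sum>a | poly (g (r j)) a = 0. of_real (w (r j) a) * f a) \<longlonglongrightarrow> (\<integral>x. f x \<partial>M)"
    and conv': "\<forall>(f :: real \<Rightarrow> real) c. (\<forall>x. isCont f x) \<longrightarrow> (\<forall>x. norm (f x) \<le> c) \<longrightarrow>
      (\<lambda>j. \<Sum>b | poly (g (r j)) b = 0. w (r j) b * f b) \<longlonglongrightarrow> (\<integral>x. f x \<partial>M)"
    using quasi_orthogonal_limit[of g, OF g0 g3 go] by (elim exE conjE) (rule that)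
  have fin: "finite {x. poly (g m) x = 0}" and w: "poly (g m) b = 0 \<Longrightarrow> w m b \<ge> 0"
    and ex: "degree f \<le> degree (g m) + (m + 1) \<Longrightarrow> L f = (\<Sum>b | poly (g m) b = 0. w m b * poly f b)"
    for m b f using fin' w' ex' by blast+
  have conv: "(\<lambda>j. \<Sum>b | poly (g (r j)) b = 0. w (r j) b * f b) \<longlonglongrightarrow> (\<integral>x. f x \<partial>M)"
    if "\<And>x. isCont f x" "\<And>x. norm (f x) \<le> c" for f :: "real \<Rightarrow> real" and c
    using conv' that by blast
  have sub: "filterlim (\<lambda>j. r j + 3) sequentially sequentially"
    by (rule filterlim_compose[OF filterlim_add_const_nat_at_top filterlim_subseq[OF r]])
  have "(\<integral>x. 1 / (complex_of_real x - z) \<partial>M) * G t z = - H t z" if z: "z \<notin> \<real>" for z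
  proof -
    define e where "e = (\<lambda>x. 1 / (complex_of_real x - z))"
    define W where "W m = (\<Sum>a | poly (g m) a = 0. of_real (w m a) * e a)" for m
    have "W m * cpoly (g m) z = - cpoly (Q (g m)) z" for m
    proof -
      have "(\<Sum>a | poly (g m) a = 0. of_real (w m a) * e a * of_real (poly (g m) a)) = 0"
        by (intro sum.neutral) auto
      moreover have "(\<Sum>a | poly (g m) a = 0. of_real (w m a) * e a * of_real (poly (g m) a)) =
          W m * cpoly (g m) z + cpoly (Q (g m)) z"
        unfolding W_def e_def
        by (rule quadrature_cauchy[where d = "degree (g m) + (m + 1)", OF _ z]) (use ex in auto)
      ultimately show ?thesis by (simp add: add_eq_0_iff)
    qed
    then have eq: "W m * (of_real u * Bn (m + 3) z + of_real v * Dn (m + 3) z) =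
        - (of_real u * An (m + 3) z + of_real v * Cn (m + 3) z)" for m
      unfolding cg cQg .
    have W: "(\<lambda>j. W (r j)) \<longlonglongrightarrow> (\<integral>x. e x \<partial>M)"
      unfolding W_def
    proof (rule convc[rule_format])
      show "isCont e x" for x unfolding e_def using nonreal_ne_of_real[OF z]
        by (intro continuous_intros) auto
      show "norm (e x) \<le> 1 / \<bar>Im z\<bar>" for x
        using nonreal_dist(1)[OF z] nonreal_dist(2)[OF z, of x] by (auto simp: e_def norm_divide intro!: divide_left_mono mult_pos_pos)
    qed
    note lims = filterlim_compose[OF tendsto_ABCD(1)[of z] sub] filterlim_compose[OF tendsto_ABCD(2)[of z] sub]
      filterlim_compose[OF tendsto_ABCD(3)[of z] sub] filterlim_compose[OF tendsto_ABCD(4)[of z] sub]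
    have "(\<lambda>j. W (r j) * (of_real u * Bn (r j + 3) z + of_real v * Dn (r j + 3) z)) \<longlonglongrightarrow> (\<integral>x. e x \<partial>M) * G t z"
      unfolding Guv by (intro tendsto_intros W lims)
    moreover have "(\<lambda>j. - (of_real u * An (r j + 3) z + of_real v * Cn (r j + 3) z)) \<longlonglongrightarrow> - H t z"
      unfolding Huv by (intro tendsto_intros lims)
    ultimately show ?thesis unfolding eq e_def using LIMSEQ_unique by blast
  qed
  moreover have "supp M \<subseteq> {x. G t (of_real x) = 0}"
  proof
    fix x0 assume x0: "x0 \<in> supp M"
    show "x0 \<in> {x. G t (of_real x) = 0}"
    proof (rule ccontr)
      assume "x0 \<notin> {x. G t (of_real x) = 0}"
      then have G0: "G t (of_real x0) \<noteq> 0" by simp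
      define \<eta> where "\<eta> = norm (G t (of_real x0)) / 2"
      have \<eta>: "\<eta> > 0" using G0 by (simp add: \<eta>_def)
      have "isCont (G t) (of_real x0)" using continuous_GH(1)[of UNIV t] by (simp add: continuous_on_eq_continuous_at)
      then obtain d where d: "d > 0" "\<And>z. dist z (of_real x0) < d \<Longrightarrow> dist (G t z) (G t (of_real x0)) < \<eta>"
        using \<eta> unfolding continuous_at_eps_delta dist_norm by blast
      define \<rho> where "\<rho> = norm (complex_of_real x0) + d"
      have ul: "uniform_limit (cball 0 \<rho>) (\<lambda>n z. of_real u * Bn n z + of_real v * Dn n z) (G t) sequentially"
        unfolding Guv[abs_def]
        by (intro uniform_limit_intros uniform_limit_ABCD)
      then have "eventually (\<lambda>n. \<forall>z\<in>cball 0 \<rho>. dist (of_real u * Bn n z + of_real v * Dn n z) (G t z) < \<eta>) sequentially"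
        using \<eta> by (simp add: uniform_limit_iff)
      then have ev: "eventually (\<lambda>j. \<forall>z\<in>cball 0 \<rho>. dist (of_real u * Bn (r j + 3) z + of_real v * Dn (r j + 3) z) (G t z) < \<eta>) sequentially"
        by (rule eventually_compose_filterlim[OF _ sub])
      define \<phi> where "\<phi> x = max 0 (d - \<bar>x - x0\<bar>)" for x
      have \<phi>0: "\<phi> x \<ge> 0" and \<phi>d: "norm (\<phi> x) \<le> d" for x using d(1) by (auto simp: \<phi>_def)
      have \<phi>c: "isCont \<phi> x" for x unfolding \<phi>_def by (intro continuous_intros)
      have "eventually (\<lambda>j. (\<Sum>b | poly (g (r j)) b = 0. w (r j) b * \<phi> b) = 0) sequentially"
        using ev
      proof eventually_elim
        case (elim j)
        have "\<phi> b = 0" if b: "poly (g (r j)) b = 0" for b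
        proof (rule ccontr)
          assume "\<phi> b \<noteq> 0"
          then have "\<bar>b - x0\<bar> < d" by (auto simp: \<phi>_def max_def split: if_splits)
          then have db: "dist (complex_of_real b) (of_real x0) < d"
            unfolding dist_norm of_real_diff[symmetric] norm_of_real .
          then have "complex_of_real b \<in> cball 0 \<rho>"
            using norm_triangle_sub[of "complex_of_real b" "of_real x0"] by (simp add: \<rho>_def dist_norm)
          then have "dist (cpoly (g (r j)) (of_real b)) (G t (of_real b)) < \<eta>"
            using elim unfolding cg by blast
          then have "norm (G t (of_real b)) < \<eta>" by (simp add: cpoly_of_real b)
          moreover have "dist (G t (of_real b)) (G t (of_real x0)) < \<eta>" by (rule d(2)[OF db])
          ultimately have "norm (G t (of_real x0)) < \<eta> + \<eta>"
            using norm_triangle_sub[of "G t (of_real x0)" "G t (of_real b)"]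
            by (simp add: dist_norm norm_minus_commute)
          then show False by (simp add: \<eta>_def)
        qed
        then show ?case by (intro sum.neutral) auto
      qed
      then have "(\<integral>x. \<phi> x \<partial>M) = 0"
        by (intro LIMSEQ_unique[OF conv[OF \<phi>c \<phi>d]] tendsto_eventually)
      moreover have "integrable M \<phi>"
      proof -
        interpret finite_measure M using V_D[OF M] by simp
        have "\<phi> \<in> borel_measurable borel" unfolding \<phi>_def by measurable
        then have "\<phi> \<in> borel_measurable M" by (simp add: measurable_cong_sets[OF V_D(1)[OF M] refl])
        then show ?thesis by (intro integrable_const_bound[of _ d]) (auto simp: \<phi>d simp del: real_norm_def)
      qed
      ultimately have "AE x in M. \<phi> x = 0"
        using integral_nonneg_eq_0_iff_AE[of M \<phi>] \<phi>0 by auto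
      then have "AE x in M. x \<in> - ball x0 d"
        by eventually_elim (auto simp: \<phi>_def dist_real_def max_def abs_minus_commute split: if_splits)
      then have "supp M \<subseteq> - ball x0 d" by (intro supp_subset_closed V_D(1)[OF M]) auto
      then show False using x0 d(1) by auto
    qed
  qed
  ultimately show ?thesis using M by blast
qed

lemma G_nonzero: "z \<notin> \<real> \<Longrightarrow> G t z \<noteq> 0"
proof
  assume "z \<notin> \<real>" and G0: "G t z = 0"
  moreover obtain \<mu> where "\<forall>z. z \<notin> \<real> \<longrightarrow> (\<integral>x. 1 / (complex_of_real x - z) \<partial>\<mu>) * G t z = - H t z"
    using N_extremal_solution_exists[of t] by blast
  ultimately have "(\<integral>x. 1 / (complex_of_real x - z) \<partial>\<mu>) * 0 = - H t z" by metis
  then have "H t z = 0" by simp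
  then show False using G_H_no_common_zero[OF G0] by contradiction
qed

lemma V_eqI:
  assumes "\<mu> \<in> V s" "\<nu> \<in> V s"
    "\<And>z. z \<notin> \<real> \<Longrightarrow> (\<integral>x. 1 / (complex_of_real x - z) \<partial>\<mu>) * G t z = - H t z"
    "\<And>z. z \<notin> \<real> \<Longrightarrow> (\<integral>x. 1 / (complex_of_real x - z) \<partial>\<nu>) * G t z = - H t z"
  shows "\<mu> = \<nu>"
proof (rule cauchy_transform_unique)
  fix z :: complex assume z: "z \<notin> \<real>"
  show "(\<integral>x. 1 / (complex_of_real x - z) \<partial>\<mu>) = (\<integral>x. 1 / (complex_of_real x - z) \<partial>\<nu>)"
    using assms(3,4)[OF z] G_nonzero[OF z, of t] by (metis mult_right_cancel)
qed (use assms V_D in auto)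

lemma N_ext:
  "N_ext s t \<in> V s" "supp (N_ext s t) \<subseteq> {x. G t (of_real x) = 0}"
  and N_ext_unique: "\<mu> \<in> V s \<Longrightarrow>
    (\<And>z. z \<notin> \<real> \<Longrightarrow> (\<integral>x. 1 / (complex_of_real x - z) \<partial>\<mu>) * G t z = - H t z) \<Longrightarrow> \<mu> = N_ext s t"
proof -
  obtain \<nu> where \<nu>: "\<nu> \<in> V s" "supp \<nu> \<subseteq> {x. G t (of_real x) = 0}"
    "\<And>z. z \<notin> \<real> \<Longrightarrow> (\<integral>x. 1 / (complex_of_real x - z) \<partial>\<nu>) * G t z = - H t z"
    using N_extremal_solution_exists[of t] by blast
  have iff: "(w = Nev_transform s t z) \<longleftrightarrow> (w * G t z = - H t z)" if "z \<notin> \<real>" for w z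
    using G_nonzero[OF that, of t] by (auto simp: Nev_transform_eq field_simps)
  have "N_ext s t = \<nu>"
    unfolding N_ext_def
  proof (rule the_equality)
    show "\<nu> \<in> V s \<and> (\<forall>z. z \<notin> \<real> \<longrightarrow> (\<integral>x. 1 / (complex_of_real x - z) \<partial>\<nu>) = Nev_transform s t z)"
      using \<nu>(1,3) iff by blast
    fix \<mu>
    assume a: "\<mu> \<in> V s \<and> (\<forall>z. z \<notin> \<real> \<longrightarrow> (\<integral>x. 1 / (complex_of_real x - z) \<partial>\<mu>) = Nev_transform s t z)"
    show "\<mu> = \<nu>"
      by (rule V_eqI[OF _ \<nu>(1) _ \<nu>(3)]) (use a iff in blast)+
  qed
  then show "N_ext s t \<in> V s" "supp (N_ext s t) \<subseteq> {x. G t (of_real x) = 0}"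
    "\<mu> \<in> V s \<Longrightarrow>
    (\<And>z. z \<notin> \<real> \<Longrightarrow> (\<integral>x. 1 / (complex_of_real x - z) \<partial>\<mu>) * G t z = - H t z) \<Longrightarrow> \<mu> = N_ext s t"
    using \<nu> V_eqI[of \<mu> \<nu> t] by auto
qed

text \<open>At a zero of G_t one has B(a) = -t D(a), or D(a) = 0 if t is infinite. The factor is
  D(a), respectively -B(a), and the determinant keeps it nonzero.\<close>

lemma G_zero_proportional:
  assumes "G t (of_real a) = 0"
  obtains c where "c \<noteq> 0" "\<And>z. D (of_real a) * B z - B (of_real a) * D z = c * G t z"
    "\<And>z. D (of_real a) * A z - B (of_real a) * C z = c * H t z"
proof (cases "\<bar>t\<bar> = \<infinity>")
  case True
  then have "D (of_real a) = 0" using assms by (simp add: G_def)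
  moreover have "B (of_real a) \<noteq> 0" using ABCD_det[of "of_real a"] calculation by auto
  ultimately show ?thesis using True by (intro that[of "- B (of_real a)"]) (auto simp: G_def H_def)
next
  case False
  then have e: "B (of_real a) = - of_real (real_of_ereal t) * D (of_real a)"
    using assms by (simp add: G_def add_eq_0_iff2)
  then have "D (of_real a) \<noteq> 0" using ABCD_det[of "of_real a"] by auto
  then show ?thesis using False e by (intro that[of "D (of_real a)"]) (auto simp: G_def H_def algebra_simps)
qed

lemma max_mass_eq_N_ext:
  assumes "G t (of_real a) = 0" "\<mu> \<in> V s" "measure \<mu> {a} * \<kappa> a \<ge> 1"
  shows "\<mu> = N_ext s t"
proof (rule N_ext_unique[OF assms(2)])
  obtain c where c: "c \<noteq> 0" "\<And>z. D (of_real a) * B z - B (of_real a) * D z = c * G t z"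
    "\<And>z. D (of_real a) * A z - B (of_real a) * C z = c * H t z"
    using G_zero_proportional[OF assms(1)] by blast
  fix z :: complex assume z: "z \<notin> \<real>"
  have "(\<integral>x. 1 / (complex_of_real x - z) \<partial>\<mu>) * (c * G t z) = - (c * H t z)"
    unfolding c(2,3)[symmetric]
    by (rule max_mass_transform[OF assms(2,3) nonreal_dist(1)[OF z]]) (use nonreal_dist(2)[OF z] in auto)
  then have "c * ((\<integral>x. 1 / (complex_of_real x - z) \<partial>\<mu>) * G t z) = c * (- H t z)" by (simp add: mult_ac)
  then show "(\<integral>x. 1 / (complex_of_real x - z) \<partial>\<mu>) * G t z = - H t z" using c(1) by (metis mult_left_cancel)
qed

text \<open>Some solution has maximal mass at \<open>a\<close>, and such a solution can only be
  \<mu>_t; the mass is thus found without computing a residue.\<close>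

lemma N_ext_mass:
  assumes "G t (of_real a) = 0"
  shows "measure (N_ext s t) {a} * \<kappa> a = 1"
proof -
  obtain \<mu> where \<mu>: "\<mu> \<in> V s" "measure \<mu> {a} * \<kappa> a \<ge> 1"
    using max_mass_solution[OF \<kappa>_bound] by blast
  then have "\<mu> = N_ext s t" using max_mass_eq_N_ext[OF assms] by blast
  then show ?thesis using \<mu> mass_le[OF \<mu>(1), of a] by simp
qed

lemma supp_N_ext: "supp (N_ext s t) = {x. G t (of_real x) = 0}"
proof
  show "{x. G t (of_real x) = 0} \<subseteq> supp (N_ext s t)"
  proof
    fix x assume "x \<in> {x. G t (of_real x) = 0}"
    then have "measure (N_ext s t) {x} \<noteq> 0" using N_ext_mass[of t x] by auto
    then have "emeasure (N_ext s t) {x} \<noteq> 0" by (auto simp: measure_def)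
    then show "x \<in> supp (N_ext s t)"
      using V_D(1)[OF N_ext(1)] by (intro in_supp_if_atom) (auto simp: zero_less_iff_neq_zero)
  qed
qed (rule N_ext(2))

text \<open>The defining identity of \<mu>_t covers nonreal z. Maximal mass at one support point
  extends it to real z off the support, where the comparison with Gauss quadratures takes
  place.\<close>

lemma N_ext_transform:
  assumes "G t (of_real a) = 0" and "\<delta> > 0" "AE x in N_ext s t. \<delta> \<le> norm (complex_of_real x - z)"
  shows "(\<integral>x. 1 / (complex_of_real x - z) \<partial>N_ext s t) * G t z = - H t z"
proof -
  obtain c where c: "c \<noteq> 0" "\<And>z. D (of_real a) * B z - B (of_real a) * D z = c * G t z"
    "\<And>z. D (of_real a) * A z - B (of_real a) * C z = c * H t z"
    using G_zero_proportional[OF assms(1)] by blast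
  have "(\<integral>x. 1 / (complex_of_real x - z) \<partial>N_ext s t) * (c * G t z) = - (c * H t z)"
    unfolding c(2,3)[symmetric] using N_ext_mass[OF assms(1)]
    by (intro max_mass_transform[OF N_ext(1) _ assms(2,3)]) simp
  then have "c * ((\<integral>x. 1 / (complex_of_real x - z) \<partial>N_ext s t) * G t z) = c * (- H t z)" by (simp add: mult_ac)
  then show ?thesis using c(1) by (metis mult_left_cancel)
qed

end

section \<open>Stieltjes sequences and the Friedrichs solution\<close>

context moment_sequence
begin

text \<open>A root x would give p_n = (y - x) T with deg T < n, although L(p_n T) is the integral of
  (y - x) T^2 and hence positive.\<close>

lemma p_no_root_below:
  assumes \<mu>: "\<mu> \<in> V s" "supp \<mu> \<subseteq> {a..}" and x: "x \<le> a"
  shows "poly (p n) x \<noteq> 0"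
proof
  assume "poly (p n) x = 0"
  then obtain T where T: "p n = [:- x, 1:] * T" by (metis poly_eq_0_iff_dvd dvdE)
  have T0: "T \<noteq> 0" using p_nonzero[of n] T by (metis mult_zero_right)
  have "degree (p n) = 1 + degree T" unfolding T using T0 by (subst degree_mult_eq) auto
  then have "L (p n * T) = 0" by (intro L_p_lower) simp
  moreover have "L (p n * T) > 0"
  proof (rule L_pos[OF \<mu>(1)])
    show "p n * T \<noteq> 0" using T0 by simp
    fix y assume "y \<in> supp \<mu>"
    then have "y \<ge> x" using \<mu>(2) x by force
    moreover have e: "poly (p n * T) y = (y - x) * (poly T y * poly T y)" unfolding T by (simp add: algebra_simps)
    ultimately show "poly (p n * T) y \<ge> 0" unfolding e by (simp add: mult_nonneg_nonneg)
  qed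
  ultimately show False by simp
qed

lemma p_same_sign_below:
  assumes \<mu>: "\<mu> \<in> V s" "supp \<mu> \<subseteq> {a..}" and x: "x \<le> a" "y \<le> a"
  shows "poly (p n) x * poly (p n) y > 0"
proof (rule ccontr)
  assume "\<not> ?thesis"
  then have neg: "poly (p n) x * poly (p n) y < 0"
    using p_no_root_below[OF \<mu>] x by (metis mult_eq_0_iff not_less_iff_gr_or_eq)
  have *: False if "u < v" "poly (p n) u * poly (p n) v < 0" "v \<le> a" for u v
    using poly_IVT[OF that(1,2)] p_no_root_below[OF \<mu>] that(3) by force
  show False using *[of x y] *[of y x] neg x by (cases x y rule: linorder_cases) (auto simp: mult.commute)
qed

lemma synthetic_div_square:
  "synthetic_div (f * f) x = synthetic_div f x * (f + [:poly f x:])" for f :: "real poly"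
proof -
  define S where "S = synthetic_div f x"
  have f: "f = [:- x, 1:] * S + [:poly f x:]" unfolding S_def by (rule synthetic_div_correct'[symmetric])
  have "poly (f * f + smult x (S * (f + [:poly f x:]))) y = poly (pCons (poly f x * poly f x) (S * (f + [:poly f x:]))) y" for y
  proof -
    have e: "poly f y = (y - x) * poly S y + poly f x"
      using arg_cong[OF f, of "\<lambda>h. poly h y"] by (simp add: algebra_simps)
    show ?thesis by (simp add: e) (simp add: algebra_simps)
  qed
  then have "f * f + smult x (S * (f + [:poly f x:])) = pCons (poly f x * poly f x) (S * (f + [:poly f x:]))"
    by (simp add: poly_eq_poly_eq_iff[symmetric] fun_eq_iff)
  then show ?thesis unfolding S_def using synthetic_div_unique by metis
qed

lemma L_synthetic_div_p_mult: "L (synthetic_div (p n) x * p n) = 0"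
  using L_p_lower[of "synthetic_div (p n) x" n] degree_synthetic_div[of "p n" x]
    synthetic_div_eq_0_iff[of "p n" x] by (cases n) (auto simp: mult.commute)

text \<open>With p_n = (y - x) S + p_n(x), orthogonality of S to p_n gives p_n(x) q_n(x) = - L((y -
  x) S^2).\<close>

lemma p_q_nonpos:
  assumes \<mu>: "\<mu> \<in> V s" "supp \<mu> \<subseteq> {x..}"
  shows "poly (p n) x * poly (q n) x \<le> 0"
proof -
  define S where "S = synthetic_div (p n) x"
  have pn: "p n = [:- x, 1:] * S + [:poly (p n) x:]" unfolding S_def by (rule synthetic_div_correct'[symmetric])
  have "S * p n = [:- x, 1:] * S * S + smult (poly (p n) x) S"
    by (subst pn) (simp add: algebra_simps)
  then have "L ([:- x, 1:] * S * S) + poly (p n) x * poly (q n) x = 0"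
    using L_synthetic_div_p_mult[of n x]
    by (simp add: S_def[symmetric] L_add L_smult second_kind_eq_Q poly_Q)
  moreover have "L ([:- x, 1:] * S * S) \<ge> 0"
    unfolding L_eq_integral[OF \<mu>(1)]
  proof (rule integral_nonneg_AE)
    show "AE y in \<mu>. 0 \<le> poly ([:- x, 1:] * S * S) y"
      using AE_in_supp[OF V_D(1)[OF \<mu>(1)]]
    proof eventually_elim
      fix y assume "y \<in> supp \<mu>"
      then have "y \<ge> x" using \<mu>(2) by auto
      moreover have e: "poly ([:- x, 1:] * S * S) y = (y - x) * (poly S y * poly S y)" by (simp add: algebra_simps)
      ultimately show "0 \<le> poly ([:- x, 1:] * S * S) y" unfolding e by (simp add: mult_nonneg_nonneg)
    qed
  qed
  ultimately show ?thesis by simp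
qed

lemma real_cauchy_kernel:
  assumes \<mu>: "\<mu> \<in> V s" and \<delta>: "\<delta> > 0" "AE y in \<mu>. x + \<delta> \<le> y"
  shows "AE y in \<mu>. \<delta> \<le> norm (complex_of_real y - of_real x)"
    "integrable \<mu> (\<lambda>y. 1 / (y - x))"
    "(\<integral>y. 1 / (complex_of_real y - of_real x) \<partial>\<mu>) = of_real (\<integral>y. 1 / (y - x) \<partial>\<mu>)"
proof -
  interpret finite_measure \<mu> using V_D[OF \<mu>] by simp
  have [measurable_cong]: "sets \<mu> = sets borel" using V_D[OF \<mu>] by simp
  show "AE y in \<mu>. \<delta> \<le> norm (complex_of_real y - of_real x)"
    using \<delta>(2) by eventually_elim (unfold of_real_diff[symmetric] norm_of_real, simp)
  have b: "AE y in \<mu>. norm (1 / (y - x)) \<le> 1 / \<delta>"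
    using \<delta>(2) by eventually_elim (use \<delta>(1) in \<open>auto simp: abs_divide intro!: divide_left_mono mult_pos_pos\<close>)
  show "integrable \<mu> (\<lambda>y. 1 / (y - x))"
    by (rule integrable_const_bound[OF b]) measurable
  have "(\<integral>y. 1 / (complex_of_real y - of_real x) \<partial>\<mu>) = (\<integral>y. complex_of_real (1 / (y - x)) \<partial>\<mu>)"
    by (intro Bochner_Integration.integral_cong refl) simp
  then show "(\<integral>y. 1 / (complex_of_real y - of_real x) \<partial>\<mu>) = of_real (\<integral>y. 1 / (y - x) \<partial>\<mu>)"
    unfolding integral_complex_of_real .
qed

text \<open>The expression is the integral of p_n(y)^2 / (y - x), evaluated by the division
  identity. Divided by p_n(x)^2 it says that the Gauss quadrature, whose transform at x is -q_n(x) /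
  p_n(x), never exceeds the transform of the solution.\<close>

lemma gauss_bound:
  assumes \<mu>: "\<mu> \<in> V s" and \<delta>: "\<delta> > 0" "AE y in \<mu>. x + \<delta> \<le> y"
  shows "poly (p n) x * ((\<integral>y. 1 / (y - x) \<partial>\<mu>) * poly (p n) x + poly (q n) x) \<ge> 0"
proof -
  note k = real_cauchy_kernel[OF \<mu> \<delta>]
  define w where "w = (\<integral>y. 1 / (y - x) \<partial>\<mu>)"
  have "L (synthetic_div (p n * p n) x) = poly (p n) x * poly (q n) x"
    unfolding synthetic_div_square distrib_left
    by (simp add: L_add L_smult L_synthetic_div_p_mult second_kind_eq_Q poly_Q)
  then have Q2: "poly (Q (p n * p n)) x = poly (p n) x * poly (q n) x" by (simp add: poly_Q)
  have "(\<integral>y. 1 / (complex_of_real y - of_real x) * of_real (poly (p n * p n) y) \<partial>\<mu>) =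
     of_real w * cpoly (p n * p n) (of_real x) + cpoly (Q (p n * p n)) (of_real x)"
    using integral_poly_cauchy_kernel[OF \<mu> \<delta>(1) k(1), of "p n * p n"] k(3) by (simp add: w_def)
  also have "\<dots> = of_real (poly (p n) x * (w * poly (p n) x + poly (q n) x))"
    unfolding cpoly_of_real Q2 by (simp add: algebra_simps)
  also have "(\<integral>y. 1 / (complex_of_real y - of_real x) * of_real (poly (p n * p n) y) \<partial>\<mu>) =
    (\<integral>y. complex_of_real (1 / (y - x) * poly (p n * p n) y) \<partial>\<mu>)"
    by (intro Bochner_Integration.integral_cong refl) simp
  also have "\<dots> = of_real (\<integral>y. 1 / (y - x) * poly (p n * p n) y \<partial>\<mu>)"
    by (rule integral_complex_of_real)
  finally have "(\<integral>y. 1 / (y - x) * poly (p n * p n) y \<partial>\<mu>) = poly (p n) x * (w * poly (p n) x + poly (q n) x)"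
    by (simp only: of_real_eq_iff)
  moreover have "(\<integral>y. 1 / (y - x) * poly (p n * p n) y \<partial>\<mu>) \<ge> 0"
    by (rule integral_nonneg_AE) (use \<delta>(2) in eventually_elim, use \<delta>(1) in auto)
  ultimately show ?thesis by (simp add: w_def)
qed

text \<open>The parameter for which B_n + \<tau>_n D_n is a multiple of p_n. It is minus the
  reciprocal of the ratio in the definition of \<open>\<alpha>\<close>, so a finite positive limit
  is the Friedrichs parameter.\<close>

definition \<tau> :: "nat \<Rightarrow> real" where "\<tau> n = - poly (q n) 0 / poly (p n) 0"

text \<open>Up to the leading coefficient of p_n, this is the top coefficient of (p_{n+1}(x) -
  p_{n+1}(0)) / x in its orthonormal expansion, hence a quotient of positive leading
  coefficients.\<close>

lemma p_q_wronskian_pos: "poly (p n) 0 * poly (q (Suc n)) 0 - poly (p (Suc n)) 0 * poly (q n) 0 > 0"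
proof -
  let ?c = "\<lambda>k. poly (p k) 0 * poly (q (Suc n)) 0 - poly (p (Suc n)) 0 * poly (q k) 0"
  have "coeff (p (Suc n)) (Suc n) = coeff (synthetic_div (p (Suc n)) 0) n"
    by (subst p_decomposition) simp
  also have "\<dots> = (\<Sum>k<Suc n. ?c k * coeff (p k) n)"
    unfolding synthetic_div_p by (simp add: coeff_sum)
  also have "\<dots> = ?c n * coeff (p n) n"
    by (simp add: coeff_eq_0)
  finally have "?c n * coeff (p n) n > 0" using lead_coeff_p[of "Suc n"] by simp
  moreover have "coeff (p n) n > 0" using lead_coeff_p[of n] by simp
  ultimately show ?thesis by (simp add: zero_less_mult_iff)
qed

section \<open>Signs at 0 and monotonicity for Stieltjes sequences\<close>

context
  fixes \<mu>
  assumes \<mu>: "\<mu> \<in> V s" "supp \<mu> \<subseteq> {0..}"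
begin

text \<open>The sign (-1)^n of p_n near minus infinity persists up to 0, since there is no root on
  the way.\<close>

lemma p_0_sign: "(- 1) ^ n * poly (p n) 0 > 0"
proof -
  define f where "f = smult ((- 1) ^ n) (pcompose (p n) [:0, - 1:])"
  have "lead_coeff f = (- 1) ^ n * (lead_coeff (p n) * (- 1) ^ n)"
    unfolding f_def lead_coeff_smult by (subst lead_coeff_comp) auto
  then have "lead_coeff f > 0" using lead_coeff_p[of n] by (simp add: mult_ac flip: power_mult_distrib)
  then obtain m where m: "\<And>x. x \<ge> m \<Longrightarrow> poly f x \<ge> lead_coeff f" using poly_pinfty_gt_lc by blast
  define x where "x = max m 0"
  have "poly f x > 0" using m[of x] \<open>lead_coeff f > 0\<close> by (simp add: x_def)
  then have "(- 1) ^ n * poly (p n) (- x) > 0" by (simp add: f_def poly_pcompose)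
  moreover have "poly (p n) (- x) * poly (p n) 0 > 0"
    by (rule p_same_sign_below[OF \<mu>]) (simp_all add: x_def)
  ultimately show ?thesis by (auto simp: zero_less_mult_iff)
qed

lemma \<tau>_strict_incseq: "\<tau> n < \<tau> (Suc n)"
proof -
  have a: "poly (p n) 0 * poly (p (Suc n)) 0 < 0"
    using p_0_sign[of n] p_0_sign[of "Suc n"] by (auto simp: zero_less_mult_iff mult_less_0_iff)
  then have nz: "poly (p n) 0 \<noteq> 0" "poly (p (Suc n)) 0 \<noteq> 0" by auto
  have "\<tau> (Suc n) - \<tau> n = (poly (p (Suc n)) 0 * poly (q n) 0 - poly (p n) 0 * poly (q (Suc n)) 0)
    / (poly (p n) 0 * poly (p (Suc n)) 0)"
    using nz by (simp add: \<tau>_def field_simps)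
  also have "\<dots> > 0" using p_q_wronskian_pos[of n] a by (intro divide_neg_neg) auto
  finally show ?thesis by simp
qed

lemma \<tau>_pos: "n > 0 \<Longrightarrow> \<tau> n > 0"
proof -
  assume "n > 0"
  then have "\<tau> 0 < \<tau> n" by (rule lift_Suc_mono_less[of \<tau>, OF \<tau>_strict_incseq])
  then show ?thesis by (simp add: \<tau>_def q_0)
qed

end

text \<open>\<open>U\<close> and \<open>W\<close> are B_n + \<tau>_n D_n and A_n + \<tau>_n C_n on
  the real line: the Gauss quadrature as the finite counterpart of \<mu>_t with t =
  \<tau>_n.\<close>

definition U :: "nat \<Rightarrow> real \<Rightarrow> real" where "U n x = - poly (p n) x / poly (p n) 0"
definition W :: "nat \<Rightarrow> real \<Rightarrow> real" where "W n x = - poly (q n) x / poly (p n) 0"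

lemma UW_eq:
  assumes "poly (p n) 0 \<noteq> 0"
  shows "of_real (U n x) = Bn n (of_real x) + of_real (\<tau> n) * Dn n (of_real x)"
    "of_real (W n x) = An n (of_real x) + of_real (\<tau> n) * Cn n (of_real x)"
proof -
  have nz: "complex_of_real (poly (p n) 0) \<noteq> 0" using assms by simp
  show "of_real (U n x) = Bn n (of_real x) + of_real (\<tau> n) * Dn n (of_real x)"
    using P_eq[of n "of_real x"] nz unfolding cpoly_of_real cpoly_at_0
    by (simp add: U_def \<tau>_def field_simps)
  show "of_real (W n x) = An n (of_real x) + of_real (\<tau> n) * Cn n (of_real x)"
    using R_eq[of n "of_real x"] nz unfolding cpoly_of_real cpoly_at_0
    by (simp add: W_def \<tau>_def field_simps)
qed

lemma UW_bounds:
  assumes \<mu>: "\<mu> \<in> V s" "supp \<mu> \<subseteq> {0..}" and \<delta>: "\<delta> > 0" "AE y in \<mu>. x + \<delta> \<le> y"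
  shows "U n x < 0" "W n x \<ge> 0" "(\<integral>y. 1 / (y - x) \<partial>\<mu>) * U n x + W n x \<le> 0"
proof -
  have "supp \<mu> \<subseteq> {x + \<delta>..}" using \<delta> by (intro supp_subset_closed V_D(1)[OF \<mu>(1)]) auto
  then have sx: "supp \<mu> \<subseteq> {max 0 x..}" "supp \<mu> \<subseteq> {x..}" using \<mu>(2) \<delta>(1) by force+
  have pp: "poly (p n) x * poly (p n) 0 > 0" by (rule p_same_sign_below[OF \<mu>(1) sx(1)]) auto
  then have nz: "poly (p n) x \<noteq> 0" "poly (p n) 0 \<noteq> 0" by auto
  have "poly (p n) x / poly (p n) 0 > 0" using pp by (simp add: zero_less_divide_iff zero_less_mult_iff)
  then show "U n x < 0" by (simp add: U_def)
  define w where "w = (\<integral>y. 1 / (y - x) \<partial>\<mu>)"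
  have 1: "poly (p n) x * poly (q n) x \<le> 0" by (rule p_q_nonpos[OF \<mu>(1) sx(2)])
  have 2: "poly (p n) x * (w * poly (p n) x + poly (q n) x) \<ge> 0" unfolding w_def by (rule gauss_bound[OF \<mu>(1) \<delta>])
  have "W n x = - (poly (p n) x * poly (q n) x) / (poly (p n) x * poly (p n) 0)"
    using nz by (simp add: W_def)
  also have "\<dots> \<ge> 0" using 1 pp by (intro divide_nonneg_pos) auto
  finally show "W n x \<ge> 0" .
  have "w * U n x + W n x = - (poly (p n) x * (w * poly (p n) x + poly (q n) x)) / (poly (p n) x * poly (p n) 0)"
    using nz by (simp add: U_def W_def divide_simps)
  also have "\<dots> \<le> 0" using 2 pp by (intro divide_nonpos_pos) auto
  finally show "(\<integral>y. 1 / (y - x) \<partial>\<mu>) * U n x + W n x \<le> 0" unfolding w_def .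
qed

end

section \<open>Restriction to the real line\<close>

context indeterminate_sequence
begin

definition g :: "ereal \<Rightarrow> real \<Rightarrow> real" where "g t x = Re (G t (of_real x))"
definition h :: "ereal \<Rightarrow> real \<Rightarrow> real" where "h t x = Re (H t (of_real x))"
text \<open>The restriction of \<open>D\<close>, written as a real series because its sign is read
  off from the terms.\<close>

definition d :: "real \<Rightarrow> real" where "d x = x * (\<Sum>k. poly (p k) 0 * poly (p k) x)"

lemma ABCD_real: "A (of_real x) \<in> \<real>" "B (of_real x) \<in> \<real>" "C (of_real x) \<in> \<real>" "D (of_real x) \<in> \<real>"
proof -
  have "An n (of_real x) \<in> \<real>" "Bn n (of_real x) \<in> \<real>" "Cn n (of_real x) \<in> \<real>" "Dn n (of_real x) \<in> \<real>" for n
    unfolding ABCDn_def cpoly_of_real cpoly_at_0 by (auto intro!: sum_in_Reals)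
  then show "A (of_real x) \<in> \<real>" "B (of_real x) \<in> \<real>" "C (of_real x) \<in> \<real>" "D (of_real x) \<in> \<real>"
    using closed_sequentially[OF closed_complex_Reals _ tendsto_ABCD(1)]
      closed_sequentially[OF closed_complex_Reals _ tendsto_ABCD(2)]
      closed_sequentially[OF closed_complex_Reals _ tendsto_ABCD(3)]
      closed_sequentially[OF closed_complex_Reals _ tendsto_ABCD(4)] by blast+
qed

lemma g_eq: "G t (of_real x) = of_real (g t x)" and h_eq: "H t (of_real x) = of_real (h t x)"
proof -
  have "G t (of_real x) \<in> \<real>" "H t (of_real x) \<in> \<real>"
    using ABCD_real[of x] by (auto simp: G_def H_def)
  then show "G t (of_real x) = of_real (g t x)" "H t (of_real x) = of_real (h t x)"
    unfolding g_def h_def by (metis of_real_Re)+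
qed

lemma g_no_common_zero: "g t x = 0 \<Longrightarrow> h t x \<noteq> 0"
  using G_H_no_common_zero[of t "of_real x"] by (auto simp: g_eq h_eq)

lemma summable_p_0_mult_p: "summable (\<lambda>k. poly (p k) 0 * poly (p k) x)"
proof -
  have "summable (\<lambda>k. P k 0 * P k (of_real x))"
    using kernel_limit(2)[of "\<lambda>k. P k 0" P "of_real x"] square_summable by blast
  then have "summable (\<lambda>k. complex_of_real (poly (p k) 0 * poly (p k) x))"
    by (simp add: cpoly_of_real cpoly_at_0)
  then show ?thesis by (simp only: summable_of_real_iff)
qed

lemma D_of_real: "D (of_real x) = of_real (d x)"
proof -
  have "(\<lambda>n. of_real (x * (\<Sum>k<n. poly (p k) 0 * poly (p k) x))) \<longlonglongrightarrow> D (of_real x)"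
    using tendsto_ABCD(4)[of "of_real x"] by (simp add: Dn_def cpoly_of_real cpoly_at_0)
  moreover have "(\<lambda>n. complex_of_real (x * (\<Sum>k<n. poly (p k) 0 * poly (p k) x))) \<longlonglongrightarrow> of_real (d x)"
    unfolding d_def by (intro tendsto_of_real tendsto_mult tendsto_const summable_LIMSEQ summable_p_0_mult_p)
  ultimately show ?thesis using LIMSEQ_unique by blast
qed

lemma g_finite: "g (ereal t) x = g (ereal t') x + (t - t') * d x"
proof -
  have "complex_of_real (g (ereal t) x) = of_real (g (ereal t') x + (t - t') * d x)"
    unfolding of_real_add of_real_mult g_eq[symmetric] D_of_real[symmetric] by (simp add: G_def algebra_simps)
  then show ?thesis by (simp only: of_real_eq_iff)
qed

lemma g_at_0: "g (ereal t) 0 = - 1"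
proof -
  have "complex_of_real (g (ereal t) 0) = of_real (- 1)"
    unfolding g_eq[symmetric] by (simp add: G_def Nev_B_def Nev_D_def)
  then show ?thesis by (simp only: of_real_eq_iff)
qed

lemma continuous_gh: "continuous_on S (g t)" "continuous_on S (h t)"
proof -
  have "continuous_on S (\<lambda>x. Re (G t (complex_of_real x)))" "continuous_on S (\<lambda>x. Re (H t (complex_of_real x)))"
    by (intro continuous_on_Re continuous_on_compose2[OF continuous_GH(1)[of UNIV t]]
       continuous_on_compose2[OF continuous_GH(2)[of UNIV t]] continuous_intros; simp)+
  then show "continuous_on S (g t)" "continuous_on S (h t)" unfolding g_def[abs_def] h_def[abs_def] .
qed

lemma supp_N_ext_eq: "supp (N_ext s t) = {x. g t x = 0}"
  unfolding supp_N_ext g_eq by simp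

lemma N_ext_real_transform:
  assumes "g t a = 0" and \<delta>: "\<delta> > 0" "AE y in N_ext s t. x + \<delta> \<le> y"
  shows "(\<integral>y. 1 / (y - x) \<partial>N_ext s t) * g t x + h t x = 0"
proof -
  note k = real_cauchy_kernel[OF N_ext(1) \<delta>]
  have "(\<integral>y. 1 / (complex_of_real y - of_real x) \<partial>N_ext s t) * G t (of_real x) = - H t (of_real x)"
    using assms(1) by (intro N_ext_transform[of t a, OF _ \<delta>(1) k(1)]) (simp add: g_eq)
  then have "complex_of_real ((\<integral>y. 1 / (y - x) \<partial>N_ext s t) * g t x) = of_real (- h t x)"
    unfolding k(3) g_eq h_eq by simp
  then show ?thesis by (simp only: of_real_eq_iff)
qed

text \<open>Up to a nonzero factor G_t(z) is (z - a) K(a, z), and K(a, a) = \<kappa>(a) \<ge> 1, so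
  continuity of \<open>K\<close> isolates the zero.\<close>

lemma g_zero_isolated:
  assumes "g t a = 0"
  shows "\<exists>\<epsilon>>0. \<forall>x. 0 < \<bar>x - a\<bar> \<and> \<bar>x - a\<bar> < \<epsilon> \<longrightarrow> g t x \<noteq> 0"
proof -
  have "G t (of_real a) = 0" by (simp add: g_eq assms)
  then obtain c where c: "c \<noteq> 0" "\<And>z. D (of_real a) * B z - B (of_real a) * D z = c * G t z"
    "\<And>z. D (of_real a) * A z - B (of_real a) * C z = c * H t z"
    using G_zero_proportional by blast
  have "isCont (K (of_real a)) (of_real a)"
    using continuous_KN(1)[of "of_real a"] by (simp add: continuous_on_eq_continuous_at)
  moreover have "K (of_real a) (of_real a) \<noteq> 0" using K_diagonal[of a] \<kappa>_ge_1[of a] by simp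
  ultimately obtain \<epsilon> where \<epsilon>: "\<epsilon> > 0" "\<forall>z. dist (of_real a) z < \<epsilon> \<longrightarrow> K (of_real a) z \<noteq> 0"
    using continuous_at_avoid[of "of_real a" "K (of_real a)" 0] by blast
  show ?thesis
  proof (intro exI[of _ \<epsilon>] conjI \<epsilon>(1) allI impI)
    fix x assume x: "0 < \<bar>x - a\<bar> \<and> \<bar>x - a\<bar> < \<epsilon>"
    then have "dist (complex_of_real a) (of_real x) < \<epsilon>"
      unfolding dist_norm of_real_diff[symmetric] norm_of_real by (simp add: abs_minus_commute)
    then have "K (of_real a) (of_real x) \<noteq> 0" using \<epsilon>(2) by blast
    moreover have "complex_of_real x - of_real a \<noteq> 0" using x by auto
    ultimately have "(complex_of_real x - of_real a) * K (of_real a) (of_real x) \<noteq> 0" by simp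
    then have "c * G t (of_real x) \<noteq> 0" unfolding K_eq c(2) .
    then show "g t x \<noteq> 0" by (auto simp: g_eq)
  qed
qed

end

text \<open>For y \<ge> a the integrand is bounded by 1 and tends to the indicator of {a}; the
  transform just left of the support thus reveals the mass at its endpoint.\<close>

lemma cauchy_kernel_mass_limit:
  assumes fin: "finite_measure \<mu>" and sets: "sets \<mu> = sets borel" and supp: "AE y in \<mu>. a \<le> y"
  shows "(\<lambda>k. \<integral>y. 1 / real (Suc k) / (y - (a - 1 / real (Suc k))) \<partial>\<mu>) \<longlonglongrightarrow> measure \<mu> {a}"
proof -
  interpret finite_measure \<mu> by fact
  have [measurable_cong]: "sets \<mu> = sets borel" by fact
  have sp: "space \<mu> = UNIV" using sets_eq_imp_space_eq[OF sets] by simp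
  define e where "e k = 1 / real (Suc k)" for k
  have e0: "e k > 0" for k by (simp add: e_def)
  have el: "e \<longlonglongrightarrow> 0" unfolding e_def[abs_def] by (rule LIMSEQ_Suc[OF lim_1_over_n])
  have "(\<lambda>k. \<integral>y. e k / (y - (a - e k)) \<partial>\<mu>) \<longlonglongrightarrow> (\<integral>y. indicator {a} y \<partial>\<mu>)"
  proof (rule integral_dominated_convergence[where w = "\<lambda>_. 1"])
    show "AE y in \<mu>. (\<lambda>k. e k / (y - (a - e k))) \<longlonglongrightarrow> indicator {a} y"
      using supp
    proof eventually_elim
      fix y assume y: "a \<le> y"
      show "(\<lambda>k. e k / (y - (a - e k))) \<longlonglongrightarrow> indicator {a} y"
      proof (cases "y = a")
        case True
        then show ?thesis using e0 by (simp add: less_imp_neq[symmetric])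
      next
        case False
        have "(\<lambda>k. e k / (y - (a - e k))) \<longlonglongrightarrow> 0 / (y - (a - 0))"
          using False by (intro tendsto_intros el) auto
        then show ?thesis using False by simp
      qed
    qed
    show "AE y in \<mu>. norm (e k / (y - (a - e k))) \<le> 1" for k
      using supp by eventually_elim (use e0[of k] in \<open>simp add: abs_divide divide_le_eq_1\<close>)
  qed (auto simp: e_def)
  then show ?thesis by (simp add: e_def sp)
qed

context indeterminate_sequence
begin

lemma UW_limit_finite:
  assumes nz: "\<And>n. poly (p n) 0 \<noteq> 0" and \<tau>: "\<tau> \<longlonglongrightarrow> F"
  shows "(\<lambda>n. U n x) \<longlonglongrightarrow> g (ereal F) x" "(\<lambda>n. W n x) \<longlonglongrightarrow> h (ereal F) x"
proof -
  have "(\<lambda>n. complex_of_real (U n x)) \<longlonglongrightarrow> B (of_real x) + of_real F * D (of_real x)"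
    "(\<lambda>n. complex_of_real (W n x)) \<longlonglongrightarrow> A (of_real x) + of_real F * C (of_real x)"
    unfolding UW_eq[OF nz] by (intro tendsto_intros tendsto_ABCD \<tau>)+
  then have "(\<lambda>n. complex_of_real (U n x)) \<longlonglongrightarrow> of_real (g (ereal F) x)"
    "(\<lambda>n. complex_of_real (W n x)) \<longlonglongrightarrow> of_real (h (ereal F) x)"
    unfolding g_eq[symmetric] h_eq[symmetric] by (simp_all add: G_def H_def)
  then show "(\<lambda>n. U n x) \<longlonglongrightarrow> g (ereal F) x" "(\<lambda>n. W n x) \<longlonglongrightarrow> h (ereal F) x"
    by (simp_all only: tendsto_of_real_iff)
qed

lemma UW_limit_infinite:
  assumes nz: "\<And>n. poly (p n) 0 \<noteq> 0" and pos: "\<And>n. n > 0 \<Longrightarrow> \<tau> n > 0" and \<tau>: "filterlim \<tau> at_top sequentially"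
  shows "(\<lambda>n. U n x / \<tau> n) \<longlonglongrightarrow> g \<infinity> x" "(\<lambda>n. W n x / \<tau> n) \<longlonglongrightarrow> h \<infinity> x"
proof -
  have inv: "(\<lambda>n. inverse (complex_of_real (\<tau> n))) \<longlonglongrightarrow> 0"
    using tendsto_of_real[OF tendsto_inverse_0_at_top[OF \<tau>], where 'a = complex] by simp
  have eq: "Bn n (of_real x) * inverse (complex_of_real (\<tau> n)) + Dn n (of_real x) = of_real (U n x / \<tau> n)"
    "An n (of_real x) * inverse (complex_of_real (\<tau> n)) + Cn n (of_real x) = of_real (W n x / \<tau> n)" if "n > 0" for n
    using pos[OF that] by (simp_all add: UW_eq[OF nz] field_simps)
  have ev: "eventually (\<lambda>n. Bn n (of_real x) * inverse (complex_of_real (\<tau> n)) + Dn n (of_real x) = of_real (U n x / \<tau> n)) sequentially"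
    "eventually (\<lambda>n. An n (of_real x) * inverse (complex_of_real (\<tau> n)) + Cn n (of_real x) = of_real (W n x / \<tau> n)) sequentially"
    using eq by (auto intro!: eventually_sequentiallyI[of 1])
  have "(\<lambda>n. Bn n (of_real x) * inverse (complex_of_real (\<tau> n)) + Dn n (of_real x)) \<longlonglongrightarrow> B (of_real x) * 0 + D (of_real x)"
    "(\<lambda>n. An n (of_real x) * inverse (complex_of_real (\<tau> n)) + Cn n (of_real x)) \<longlonglongrightarrow> A (of_real x) * 0 + C (of_real x)"
    by (intro tendsto_intros tendsto_ABCD inv)+
  then have "(\<lambda>n. complex_of_real (U n x / \<tau> n)) \<longlonglongrightarrow> of_real (g \<infinity> x)"
    "(\<lambda>n. complex_of_real (W n x / \<tau> n)) \<longlonglongrightarrow> of_real (h \<infinity> x)"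
    unfolding g_eq[symmetric] h_eq[symmetric]
    using Lim_transform_eventually[OF _ ev(1)] Lim_transform_eventually[OF _ ev(2)] by (simp_all add: G_def H_def)
  then show "(\<lambda>n. U n x / \<tau> n) \<longlonglongrightarrow> g \<infinity> x" "(\<lambda>n. W n x / \<tau> n) \<longlonglongrightarrow> h \<infinity> x"
    by (simp_all only: tendsto_of_real_iff)
qed

text \<open>Here \<open>c\<close> is the constant with \<open>c G\<^sub>t(z) = (z - a) K(a, z)\<close>; its sign decides the
  direction of the inequality in the limit \<open>x \<rightarrow> a\<close> from the left.\<close>

lemma max_mass_of_bound:
  assumes \<mu>: "\<mu> \<in> V s" "supp \<mu> \<subseteq> {a..}" and c: "c > 0"
    "\<And>z. D (of_real a) * B z - B (of_real a) * D z = of_real c * G t z"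
    "\<And>z. D (of_real a) * A z - B (of_real a) * C z = of_real c * H t z"
    and bound: "\<And>x. x < a \<Longrightarrow> (\<integral>y. 1 / (y - x) \<partial>\<mu>) * g t x + h t x \<le> 0"
  shows "measure \<mu> {a} * \<kappa> a \<ge> 1"
proof -
  define e where "e k = 1 / real (Suc k)" for k
  have e0: "e k > 0" for k by (simp add: e_def)
  have el: "e \<longlonglongrightarrow> 0" unfolding e_def[abs_def] by (rule LIMSEQ_Suc[OF lim_1_over_n])
  define w where "w k = (\<integral>y. 1 / (y - (a - e k)) \<partial>\<mu>)" for k
  have AEa: "AE y in \<mu>. a \<le> y" using AE_in_supp[OF V_D(1)[OF \<mu>(1)]] by eventually_elim (use \<mu>(2) in auto)
  have ew: "(\<lambda>k. e k * w k) \<longlonglongrightarrow> measure \<mu> {a}"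
  proof -
    have "e k * w k = (\<integral>y. e k / (y - (a - e k)) \<partial>\<mu>)" for k
      unfolding w_def by (subst integral_mult_right_zero[symmetric]) simp
    then show ?thesis using cauchy_kernel_mass_limit[OF V_D(3,1)[OF \<mu>(1)] AEa] by (simp add: e_def)
  qed
  have x: "(\<lambda>k. complex_of_real (a - e k)) \<longlonglongrightarrow> of_real (a - 0)"
    by (intro tendsto_intros el)
  have K: "(\<lambda>k. K (of_real a) (of_real (a - e k))) \<longlonglongrightarrow> K (of_real a) (of_real a)"
    using x continuous_KN(1)[of "of_real a"] by (intro isCont_tendsto_compose[where g = "K (of_real a)"])
      (auto simp: continuous_on_eq_continuous_at)
  have N: "(\<lambda>k. N (of_real a) (of_real (a - e k))) \<longlonglongrightarrow> N (of_real a) (of_real a)"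
    using x continuous_KN(2)[of "of_real a"] by (intro isCont_tendsto_compose[where g = "N (of_real a)"])
      (auto simp: continuous_on_eq_continuous_at)
  \<comment> \<open>With x = a - e_k one has x - a = -e_k, so c (w_k g(x) + h(x)) equals -e_k w_k K
    + 1 - e_k N. It is nonpositive along the sequence, and its limit is 1 minus \<kappa>(a) times
    the mass.\<close>
  have "(\<lambda>k. Re (- (of_real (e k * w k)) * K (of_real a) (of_real (a - e k)) + (1 - of_real (e k) * N (of_real a) (of_real (a - e k)))))
    \<longlonglongrightarrow> Re (- (of_real (measure \<mu> {a})) * K (of_real a) (of_real a) + (1 - of_real 0 * N (of_real a) (of_real a)))"
    by (intro tendsto_intros ew K N el)
  moreover have "Re (- (of_real (e k * w k)) * K (of_real a) (of_real (a - e k)) + (1 - of_real (e k) * N (of_real a) (of_real (a - e k)))) \<le> 0" for k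
  proof -
    let ?x = "complex_of_real (a - e k)"
    have xa: "?x - of_real a = - of_real (e k)" by simp
    have "- (of_real (e k * w k)) * K (of_real a) ?x + (1 - of_real (e k) * N (of_real a) ?x) =
      of_real (w k) * ((?x - of_real a) * K (of_real a) ?x) + (1 + (?x - of_real a) * N (of_real a) ?x)"
      unfolding xa by (simp add: algebra_simps)
    also have "\<dots> = of_real (w k) * (of_real c * G t ?x) + of_real c * H t ?x"
      unfolding K_eq N_eq c(2,3) by simp
    also have "\<dots> = of_real (c * (w k * g t (a - e k) + h t (a - e k)))"
      unfolding g_eq h_eq by (simp add: algebra_simps)
    finally have "Re (- (of_real (e k * w k)) * K (of_real a) ?x + (1 - of_real (e k) * N (of_real a) ?x)) =
      c * (w k * g t (a - e k) + h t (a - e k))" by (metis Re_complex_of_real)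
    also have "\<dots> \<le> 0" using bound[of "a - e k"] e0[of k] c(1) unfolding w_def by (intro mult_nonneg_nonpos) auto
    finally show ?thesis .
  qed
  ultimately have "Re (- (of_real (measure \<mu> {a})) * K (of_real a) (of_real a) + (1 - of_real 0 * N (of_real a) (of_real a))) \<le> 0"
    by (intro tendsto_upperbound[OF _ always_eventually]) auto
  then show ?thesis by (simp add: K_diagonal)
qed

text \<open>If the increasing sequence \<tau> diverged, the Gauss bounds divided by \<tau> would
  tend to the bound for t = \<infinity>, where D vanishes at 0; that bound forces maximal mass at
  0.\<close>

lemma friedrichs_param_finite:
  assumes \<mu>: "\<mu> \<in> V s" "supp \<mu> \<subseteq> {0..}" and mass: "measure \<mu> {0} * \<kappa> 0 < 1"
  shows "\<exists>F. \<tau> \<longlonglongrightarrow> F"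
proof (rule ccontr)
  assume no: "\<nexists>F. \<tau> \<longlonglongrightarrow> F"
  have inc: "incseq \<tau>" using \<tau>_strict_incseq[OF \<mu>] by (intro incseq_SucI less_imp_le)
  have nz: "poly (p n) 0 \<noteq> 0" for n using p_no_root_below[OF \<mu>] by simp
  have pos: "n > 0 \<Longrightarrow> \<tau> n > 0" for n by (rule \<tau>_pos[OF \<mu>])
  have top: "filterlim \<tau> at_top sequentially"
    unfolding filterlim_at_top
  proof
    fix Z
    have "\<exists>n. \<tau> n \<ge> Z"
    proof (rule ccontr)
      assume "\<not> ?thesis"
      then have le: "\<And>n. \<tau> n \<le> Z" by (meson linear)
      then have "\<forall>i. \<tau> i \<le> Z" by simp
      then obtain l where "\<tau> \<longlonglongrightarrow> l" using incseq_convergent[OF inc] by blast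
      then show False using no by blast
    qed
    then obtain n where "\<tau> n \<ge> Z" ..
    then show "eventually (\<lambda>n. Z \<le> \<tau> n) sequentially"
      using inc by (intro eventually_sequentiallyI[of n]) (meson incseqD order_trans)
  qed
  have "measure \<mu> {0} * \<kappa> 0 \<ge> 1"
  proof (rule max_mass_of_bound[OF \<mu>, where c = 1 and t = \<infinity>])
    \<comment> \<open>D(0) = 0 and B(0) = -1, so the factor is 1.\<close>
    show "D (of_real 0) * B z - B (of_real 0) * D z = of_real 1 * G \<infinity> z"
      "D (of_real 0) * A z - B (of_real 0) * C z = of_real 1 * H \<infinity> z" for z
      by (simp_all add: G_def H_def Nev_D_def[of s 0] Nev_B_def[of s 0])
    fix x :: real assume x: "x < 0"
    have AEx: "AE y in \<mu>. x + (- x) \<le> y"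
      using AE_in_supp[OF V_D(1)[OF \<mu>(1)]] by eventually_elim (use \<mu>(2) in auto)
    let ?w = "\<integral>y. 1 / (y - x) \<partial>\<mu>"
    have "(\<lambda>n. ?w * (U n x / \<tau> n) + W n x / \<tau> n) \<longlonglongrightarrow> ?w * g \<infinity> x + h \<infinity> x"
      by (intro tendsto_intros UW_limit_infinite nz pos top)
    moreover have "eventually (\<lambda>n. ?w * (U n x / \<tau> n) + W n x / \<tau> n \<le> 0) sequentially"
      using eventually_gt_at_top[of 0]
    proof eventually_elim
      fix n :: nat assume "n > 0"
      have "?w * (U n x / \<tau> n) + W n x / \<tau> n = (?w * U n x + W n x) / \<tau> n"
        by (simp add: add_divide_distrib)
      also have "\<dots> \<le> 0" using UW_bounds(3)[OF \<mu> _ AEx, of n] x pos[OF \<open>n > 0\<close>]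
        by (intro divide_nonpos_pos) auto
      finally show "?w * (U n x / \<tau> n) + W n x / \<tau> n \<le> 0" .
    qed
    ultimately show "?w * g \<infinity> x + h \<infinity> x \<le> 0" by (rule tendsto_upperbound) simp
  qed simp
  then show False using mass by simp
qed

end

text \<open>Instantiated a second time at normalized shifted sequences. The limit of \<tau> is
  assumed rather than a value of \<open>friedrichs_param\<close>, because all bounds are limits of
  bounds at \<tau>_n.\<close>

locale friedrichs_sequence = indeterminate_sequence +
  fixes F :: real
  assumes stieltjes: "\<exists>\<mu>\<in>V s. supp \<mu> \<subseteq> {0..}" and \<tau>_limit: "\<tau> \<longlonglongrightarrow> F"
begin

lemma F_pos: "F > 0"
proof -
  obtain \<mu> where \<mu>: "\<mu> \<in> V s" "supp \<mu> \<subseteq> {0..}" using stieltjes by blast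
  have "incseq \<tau>" using \<tau>_strict_incseq[OF \<mu>] by (intro incseq_SucI less_imp_le)
  then have "\<tau> 1 \<le> F" using \<tau>_limit by (rule incseq_le)
  then show ?thesis using \<tau>_pos[OF \<mu>, of 1] by simp
qed

lemma friedrichs_param_eq: "friedrichs_param s = ereal F"
proof -
  have "(\<lambda>n. poly (p n) 0 / poly (q n) 0) = (\<lambda>n. - inverse (\<tau> n))"
    by (simp add: \<tau>_def fun_eq_iff)
  moreover have "(\<lambda>n. - inverse (\<tau> n)) \<longlonglongrightarrow> - inverse F"
    using F_pos by (intro tendsto_intros \<tau>_limit) auto
  ultimately have "\<alpha> s = - inverse F" unfolding \<alpha>_def by (simp add: limI)
  then show ?thesis using F_pos by (simp add: friedrichs_param_def divide_inverse)
qed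

text \<open>The bounds for \<open>U\<close> and \<open>W\<close> pass to the limit. The first stays
  strict because g = 0 would force h \<le> 0 and h \<ge> 0, a common zero.\<close>

lemma friedrichs_bound:
  assumes \<mu>: "\<mu> \<in> V s" "supp \<mu> \<subseteq> {0..}" and \<delta>: "\<delta> > 0" "AE y in \<mu>. x + \<delta> \<le> y"
  shows "g (ereal F) x < 0" "(\<integral>y. 1 / (y - x) \<partial>\<mu>) * g (ereal F) x + h (ereal F) x \<le> 0"
proof -
  have nz: "poly (p n) 0 \<noteq> 0" for n using p_no_root_below[OF \<mu>] by simp
  note lim = UW_limit_finite[OF nz \<tau>_limit, of x]
  note b = UW_bounds[OF \<mu> \<delta>]
  let ?w = "\<integral>y. 1 / (y - x) \<partial>\<mu>"
  have "(\<lambda>n. ?w * U n x + W n x) \<longlonglongrightarrow> ?w * g (ereal F) x + h (ereal F) x"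
    by (intro tendsto_intros lim)
  then show wh: "?w * g (ereal F) x + h (ereal F) x \<le> 0"
    using b(3) by (intro tendsto_upperbound[OF _ always_eventually]) auto
  have g0: "g (ereal F) x \<le> 0"
    using b(1) by (intro tendsto_upperbound[OF lim(1) always_eventually]) (auto simp: less_imp_le)
  have h0: "h (ereal F) x \<ge> 0"
    using b(2) by (intro tendsto_lowerbound[OF lim(2) always_eventually]) auto
  show "g (ereal F) x < 0"
    using g_no_common_zero[of "ereal F" x] g0 h0 wh by (cases "g (ereal F) x = 0") auto
qed

text \<open>At two points left of the support all products p_k(0) p_k(x) are positive, and the term
  for k = 0 is 1.\<close>

lemma d_sum_ge_1:
  assumes \<mu>: "\<mu> \<in> V s" "supp \<mu> \<subseteq> {a..}" and a: "0 \<le> a" "x \<le> a"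
  shows "(\<Sum>k. poly (p k) 0 * poly (p k) x) \<ge> 1"
proof -
  have "(\<Sum>k\<in>{0}. poly (p k) 0 * poly (p k) x) \<le> (\<Sum>k. poly (p k) 0 * poly (p k) x)"
    using p_same_sign_below[OF \<mu>] a by (intro sum_le_suminf summable_p_0_mult_p) (auto intro: less_imp_le)
  then show ?thesis by (simp add: p_0)
qed

lemma d_neg: "x < 0 \<Longrightarrow> d x < 0"
proof -
  assume x: "x < 0"
  obtain \<mu> where \<mu>: "\<mu> \<in> V s" "supp \<mu> \<subseteq> {0..}" using stieltjes by blast
  then show ?thesis using d_sum_ge_1[OF \<mu>, of x] x unfolding d_def by (intro mult_neg_pos) auto
qed

lemma g_neg_nonpos:
  assumes "F \<le> t" "x \<le> 0"
  shows "g (ereal t) x < 0"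
proof (cases "x = 0")
  case True
  then show ?thesis by (simp add: g_at_0)
next
  case False
  then have x: "x < 0" using assms by simp
  obtain \<mu> where \<mu>: "\<mu> \<in> V s" "supp \<mu> \<subseteq> {0..}" using stieltjes by blast
  have "AE y in \<mu>. x + (- x) \<le> y"
    using AE_in_supp[OF V_D(1)[OF \<mu>(1)]] by eventually_elim (use \<mu>(2) in auto)
  then have "g (ereal F) x < 0" using friedrichs_bound(1)[OF \<mu>, of "- x" x] x by simp
  moreover have "(t - F) * d x \<le> 0" using assms d_neg[OF x] by (intro mult_nonneg_nonpos) auto
  ultimately show ?thesis using g_finite[of t x F] by simp
qed

definition c :: "real \<Rightarrow> real" where "c t = \<xi> (N_ext s (ereal t))"

text \<open>For t \<ge> F the function g_t is negative on (-\<infinity>, 0], so all support points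
  are positive and their infimum is attained. A nonnegative value left of \<open>c t\<close> would,
  since g_t(0) = -1, produce an earlier zero.\<close>

lemma c_props:
  assumes t: "F \<le> t"
  shows "c t > 0" "g (ereal t) (c t) = 0" "supp (N_ext s (ereal t)) \<subseteq> {c t..}" "\<And>x. x < c t \<Longrightarrow> g (ereal t) x < 0"
proof -
  let ?S = "supp (N_ext s (ereal t))"
  have S: "?S = {x. g (ereal t) x = 0}" by (rule supp_N_ext_eq)
  have "infinite ?S" using V_D(2)[OF N_ext(1)] by (simp add: Mstar_def)
  then have ne: "?S \<noteq> {}" by auto
  have pos: "x > 0" if "x \<in> ?S" for x using that g_neg_nonpos[OF t, of x] unfolding S by fastforce
  then have bdd: "bdd_below ?S" by (intro bdd_belowI[of _ 0]) (auto intro: less_imp_le)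
  have cS: "c t \<in> ?S" unfolding c_def \<xi>_def by (rule closed_contains_Inf[OF ne bdd closed_supp])
  then show "c t > 0" "g (ereal t) (c t) = 0" using pos S by auto
  show sub: "?S \<subseteq> {c t..}" unfolding c_def \<xi>_def using bdd by (auto intro: cInf_lower)
  fix x assume x: "x < c t"
  show "g (ereal t) x < 0"
  proof (rule ccontr)
    assume "\<not> g (ereal t) x < 0"
    then have gx: "g (ereal t) x \<ge> 0" by simp
    then have x0: "x > 0" using g_neg_nonpos[OF t, of x] by fastforce
    have "\<exists>y. 0 \<le> y \<and> y \<le> x \<and> g (ereal t) y = 0"
      using gx x0 g_at_0[of t] continuous_gh(1) by (intro IVT') auto
    then obtain y where "y \<le> x" "y \<in> ?S" unfolding S by blast
    then show False using sub x by force
  qed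
qed

lemma AE_N_ext_ge: "F \<le> t \<Longrightarrow> AE y in N_ext s (ereal t). c t \<le> y"
  using AE_in_supp[OF V_D(1)[OF N_ext(1)]] by (rule eventually_mono) (use c_props(3) in auto)

lemma d_pos: "0 < x \<Longrightarrow> x \<le> c F \<Longrightarrow> d x > 0"
proof -
  assume x: "0 < x" "x \<le> c F"
  have "(\<Sum>k. poly (p k) 0 * poly (p k) x) \<ge> 1"
    using c_props[of F] x by (intro d_sum_ge_1[OF N_ext(1), of "ereal F" "c F"]) auto
  then show ?thesis unfolding d_def using x by (intro mult_pos_pos) auto
qed

text \<open>Since g_v = g_u + (v - u) d, the value of g_v at \<open>c u\<close> is positive, so g_v
  has crossed zero before. Positivity of \<open>d\<close> is available on (0, c F], hence c u \<le>
  c F is obtained first, from the case u = F.\<close>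

lemma c_strict_decreasing:
  assumes "F \<le> t'" "t' < t"
  shows "c t < c t'"
proof -
  have step: "c v < c u" if u: "F \<le> u" "u < v" "c u \<le> c F" for u v
  proof -
    have "d (c u) > 0" using d_pos c_props(1)[OF u(1)] u by simp
    then have gv: "g (ereal v) (c u) > 0"
      using g_finite[of v "c u" u] c_props(2)[OF u(1)] u by simp
    show ?thesis
    proof (rule ccontr)
      assume "\<not> c v < c u"
      then have "g (ereal v) (c u) \<le> 0"
        using c_props(2,4)[of v] u by (cases "c u = c v") (auto intro: less_imp_le)
      then show False using gv by simp
    qed
  qed
  have "c t' \<le> c F" using step[of F t'] assms by (cases "t' = F") auto
  then show ?thesis using step assms by blast
qed

lemma c_antimono: "F \<le> t' \<Longrightarrow> t' \<le> t \<Longrightarrow> c t \<le> c t'"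
  using c_strict_decreasing[of t' t] by (cases "t' = t") auto

text \<open>Such a solution obeys the Friedrichs bound at every x < c F; letting x tend to c F makes
  its mass there maximal.\<close>

lemma friedrichs_unique:
  assumes \<mu>: "\<mu> \<in> V s" "supp \<mu> \<subseteq> {c F..}"
  shows "\<mu> = N_ext s (ereal F)"
proof (rule max_mass_eq_N_ext[where a = "c F"])
  have cF: "c F > 0" "g (ereal F) (c F) = 0" using c_props[of F] by auto
  then show G0: "G (ereal F) (of_real (c F)) = 0" by (simp add: g_eq)
  then have Be: "B (of_real (c F)) = - of_real F * of_real (d (c F))"
    by (simp add: G_def D_of_real add_eq_0_iff2)
  show "\<mu> \<in> V s" by (rule \<mu>)
  show "1 \<le> measure \<mu> {c F} * \<kappa> (c F)"
  proof (rule max_mass_of_bound[OF \<mu>, where c = "d (c F)" and t = "ereal F"])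
    show "d (c F) > 0" using cF by (intro d_pos) auto
    show "D (of_real (c F)) * B z - B (of_real (c F)) * D z = of_real (d (c F)) * G (ereal F) z"
      "D (of_real (c F)) * A z - B (of_real (c F)) * C z = of_real (d (c F)) * H (ereal F) z" for z
      unfolding Be D_of_real by (simp_all add: G_def H_def algebra_simps)
    fix x assume x: "x < c F"
    have s0: "supp \<mu> \<subseteq> {0..}" using \<mu>(2) cF by force
    have "AE y in \<mu>. x + (c F - x) \<le> y"
      using AE_in_supp[OF V_D(1)[OF \<mu>(1)]] by eventually_elim (use \<mu>(2) in auto)
    then show "(\<integral>y. 1 / (y - x) \<partial>\<mu>) * g (ereal F) x + h (ereal F) x \<le> 0"
      using friedrichs_bound(2)[OF \<mu>(1) s0, of "c F - x" x] x by simp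
  qed
qed

text \<open>Left of \<open>c F\<close> the transform of \<mu>_F turns the Friedrichs bound into an
  equality, and g_F(x) < 0 orders the transforms. If x were not left of \<open>c F\<close>, the
  strict bound would hold at the zero \<open>c F\<close> of g_F.\<close>

lemma friedrichs_minimal:
  assumes \<nu>: "\<nu> \<in> V s" "supp \<nu> \<subseteq> {0..}" and \<delta>: "\<delta> > 0" "AE y in \<nu>. x + \<delta> \<le> y"
  shows "x < c F" "(\<integral>y. 1 / (y - x) \<partial>N_ext s (ereal F)) \<le> (\<integral>y. 1 / (y - x) \<partial>\<nu>)"
proof -
  show x: "x < c F"
  proof (rule ccontr)
    assume "\<not> x < c F"
    then have le: "c F \<le> x" by simp
    have "AE y in \<nu>. c F + \<delta> \<le> y" using \<delta>(2) by eventually_elim (use le in simp)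
    then have "g (ereal F) (c F) < 0" by (rule friedrichs_bound(1)[OF \<nu> \<delta>(1)])
    then show False using c_props(2)[of F] by simp
  qed
  let ?w = "\<integral>y. 1 / (y - x) \<partial>\<nu>" and ?W = "\<integral>y. 1 / (y - x) \<partial>N_ext s (ereal F)"
  have "AE y in N_ext s (ereal F). x + (c F - x) \<le> y" using AE_N_ext_ge[of F] by simp
  then have "?W * g (ereal F) x + h (ereal F) x = 0"
    using x c_props(2)[of F] by (intro N_ext_real_transform[of _ "c F" "c F - x"]) auto
  moreover have "?w * g (ereal F) x + h (ereal F) x \<le> 0" by (rule friedrichs_bound(2)[OF \<nu> \<delta>])
  ultimately have "(?w - ?W) * g (ereal F) x \<le> 0" by (simp add: algebra_simps)
  then show "?W \<le> ?w" using friedrichs_bound(1)[OF \<nu> \<delta>] by (simp add: mult_le_0_iff)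
qed

end

section \<open>Multiplication and division by a linear factor\<close>

lemma scale_measure_eq_density: "scale_measure r M = density M (\<lambda>_. r)"
  by (rule measure_eqI) (auto simp: emeasure_density_const)

lemma scale_measure_inverse: "c > 0 \<Longrightarrow> scale_measure (ennreal c) (scale_measure (ennreal (1 / c)) M) = M"
  "c > 0 \<Longrightarrow> scale_measure (ennreal (1 / c)) (scale_measure (ennreal c) M) = M"
  by (simp_all add: ennreal_mult[symmetric] del: ennreal_mult)

lemma supp_scale_measure: "c > 0 \<Longrightarrow> supp (scale_measure (ennreal c) \<mu>) = supp \<mu>"
  by (simp add: supp_def ennreal_zero_less_mult_iff)

lemma V_scale_measure:
  assumes \<mu>: "\<mu> \<in> V s" and c: "c > 0"
  shows "scale_measure (ennreal c) \<mu> \<in> V (\<lambda>n. c * s n)"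
proof -
  have sets: "sets \<mu> = sets borel" using V_D(1)[OF \<mu>] .
  have [measurable_cong]: "sets \<mu> = sets borel" by fact
  have int: "integrable (scale_measure (ennreal c) \<mu>) (\<lambda>x. x ^ n)" "(\<integral>x. x ^ n \<partial>scale_measure (ennreal c) \<mu>) = c * s n" for n
    using \<mu> c unfolding scale_measure_eq_density
    by (auto simp: V_def Mstar_def integrable_density integral_density)
  show ?thesis
    using \<mu> int sets by (simp add: V_def Mstar_def supp_scale_measure[OF c])
qed

lemma indeterminate_iff: "indeterminate s \<longleftrightarrow> (\<exists>\<mu>\<in>V s. \<exists>\<nu>\<in>V s. \<mu> \<noteq> \<nu>)"
proof
  assume "indeterminate s"
  then have V: "V s \<noteq> {}" "\<And>\<mu>. V s \<noteq> {\<mu>}" by (auto simp: indeterminate_def determinate_def)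
  then obtain \<mu> where "\<mu> \<in> V s" by blast
  moreover then obtain \<nu> where "\<nu> \<in> V s" "\<mu> \<noteq> \<nu>" using V(2)[of \<mu>] by blast
  ultimately show "\<exists>\<mu>\<in>V s. \<exists>\<nu>\<in>V s. \<mu> \<noteq> \<nu>" by blast
qed (auto simp: indeterminate_def determinate_def)

lemma V_moment_0_pos: "\<mu> \<in> V s \<Longrightarrow> s 0 > 0"
  using integral_poly_pos[OF V_D(2), of \<mu> s 1] V_D(6)[of \<mu> s 1] by simp

lemma V_normalize:
  assumes "\<mu> \<in> V s"
  shows "scale_measure (ennreal (1 / s 0)) \<mu> \<in> V (normalize_seq s)"
  using V_scale_measure[OF assms, of "1 / s 0"] V_moment_0_pos[OF assms]
  by (simp add: normalize_seq_def[abs_def])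

lemma V_unnormalize:
  assumes "\<mu> \<in> V (normalize_seq s)" "s 0 > 0"
  shows "scale_measure (ennreal (s 0)) \<mu> \<in> V s"
proof -
  have "(\<lambda>n. s 0 * normalize_seq s n) = s" using assms(2) by (simp add: normalize_seq_def fun_eq_iff)
  then show ?thesis using V_scale_measure[OF assms] by simp
qed

lemma indeterminate_normalize:
  assumes "indeterminate s"
  shows "indeterminate (normalize_seq s)"
proof -
  obtain \<mu> \<nu> where mn: "\<mu> \<in> V s" "\<nu> \<in> V s" "\<mu> \<noteq> \<nu>" using assms indeterminate_iff by blast
  have "scale_measure (ennreal (1 / s 0)) \<mu> \<noteq> scale_measure (ennreal (1 / s 0)) \<nu>"
    using mn scale_measure_inverse(1)[OF V_moment_0_pos[OF mn(1)]] by metis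
  then show ?thesis using V_normalize mn indeterminate_iff by blast
qed

lemma moment_sequence_normalize:
  assumes "\<mu> \<in> V s"
  shows "moment_sequence (normalize_seq s)"
proof
  show "V (normalize_seq s) \<noteq> {}" using V_normalize[OF assms] by blast
  show "normalize_seq s 0 = 1" using V_moment_0_pos[OF assms] by (simp add: normalize_seq_def)
qed

section \<open>Densities y - a\<close>

lemma sets_linear_density [simp]: "sets (linear_density a \<mu>) = sets \<mu>"
  by (simp add: linear_density_def)

lemma linear_density_integral:
  fixes f :: "real \<Rightarrow> real"
  assumes sets: "sets \<mu> = sets borel" and supp: "AE y in \<mu>. a \<le> y" and [measurable]: "f \<in> borel_measurable borel"
  shows "integrable (linear_density a \<mu>) f \<longleftrightarrow> integrable \<mu> (\<lambda>y. (y - a) * f y)"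
    "(\<integral>y. f y \<partial>linear_density a \<mu>) = (\<integral>y. (y - a) * f y \<partial>\<mu>)"
proof -
  have [measurable_cong]: "sets \<mu> = sets borel" by fact
  have AE: "AE y in \<mu>. 0 \<le> y - a" using supp by eventually_elim simp
  show "integrable (linear_density a \<mu>) f \<longleftrightarrow> integrable \<mu> (\<lambda>y. (y - a) * f y)"
    unfolding linear_density_def using AE by (subst integrable_density) auto
  show "(\<integral>y. f y \<partial>linear_density a \<mu>) = (\<integral>y. (y - a) * f y \<partial>\<mu>)"
    unfolding linear_density_def using AE by (subst integral_density) auto
qed

lemma AE_linear_density:
  assumes "sets \<mu> = sets borel"
  shows "(AE y in linear_density a \<mu>. P y) \<longleftrightarrow> (AE y in \<mu>. a < y \<longrightarrow> P y)"
proof -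
  have [measurable_cong]: "sets \<mu> = sets borel" by fact
  show ?thesis unfolding linear_density_def by (subst AE_density) auto
qed

lemma emeasure_linear_density_singleton:
  assumes "sets \<mu> = sets borel"
  shows "emeasure (linear_density a \<mu>) {b} = ennreal (b - a) * emeasure \<mu> {b}"
proof -
  have [measurable_cong]: "sets \<mu> = sets borel" by fact
  have "emeasure (linear_density a \<mu>) {b} = (\<integral>\<^sup>+y. ennreal (y - a) * indicator {b} y \<partial>\<mu>)"
    unfolding linear_density_def by (rule emeasure_density) (auto simp: assms)
  also have "\<dots> = (\<integral>\<^sup>+y. ennreal (b - a) * indicator {b} y \<partial>\<mu>)"
    by (intro nn_integral_cong) (auto simp: indicator_def)
  also have "\<dots> = ennreal (b - a) * emeasure \<mu> {b}"
    by (subst nn_integral_cmult_indicator) (auto simp: assms)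
  finally show ?thesis .
qed

text \<open>The density is positive right of \<open>a\<close>, so an open set that is null for the
  new measure meets {a<..} in a null set of \<mu>.\<close>

lemma supp_linear_density_superset:
  assumes "sets \<mu> = sets borel"
  shows "supp \<mu> \<inter> {a<..} \<subseteq> supp (linear_density a \<mu>)"
proof
  fix x assume x: "x \<in> supp \<mu> \<inter> {a<..}"
  show "x \<in> supp (linear_density a \<mu>)"
    unfolding supp_def
  proof (safe)
    fix U :: "real set" assume U: "open U" "x \<in> U"
    show "emeasure (linear_density a \<mu>) U > 0"
    proof (rule ccontr)
      assume "\<not> emeasure (linear_density a \<mu>) U > 0"
      then have "U \<in> null_sets (linear_density a \<mu>)" using U assms by (auto simp: null_sets_def)
      then have "AE y in linear_density a \<mu>. y \<notin> U" by (rule AE_not_in)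
      then have "AE y in \<mu>. a < y \<longrightarrow> y \<notin> U" unfolding AE_linear_density[OF assms] .
      then have "AE y in \<mu>. y \<in> - (U \<inter> {a<..})" by eventually_elim auto
      then have "supp \<mu> \<subseteq> - (U \<inter> {a<..})"
        using U by (intro supp_subset_closed assms) (auto simp: closed_def)
      then show False using x U by auto
    qed
  qed
qed

lemma linear_density_V:
  assumes \<mu>: "\<mu> \<in> V s" "supp \<mu> \<subseteq> {a..}"
  shows "linear_density a \<mu> \<in> V (shifted_seq s a)" "supp (linear_density a \<mu>) \<subseteq> {a..}"
proof -
  note sets = V_D(1)[OF \<mu>(1)]
  have supp: "AE y in \<mu>. a \<le> y" using AE_in_supp[OF sets] by eventually_elim (use \<mu>(2) in auto)
  have I: "integrable \<mu> (\<lambda>x. x ^ n)" "(\<integral>x. x ^ n \<partial>\<mu>) = s n" for n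
    using \<mu>(1) by (auto simp: V_def Mstar_def)
  have eq: "(y - a) * y ^ n = y ^ (n + 1) - a * y ^ n" for y n by (simp add: algebra_simps)
  have int: "integrable (linear_density a \<mu>) (\<lambda>x. x ^ n)" for n
    by (subst linear_density_integral(1)[OF sets supp]) (use I in \<open>auto simp: eq simp del: power_Suc\<close>)
  have mom: "(\<integral>x. x ^ n \<partial>linear_density a \<mu>) = shifted_seq s a n" for n
    by (subst linear_density_integral(2)[OF sets supp])
      (use I I(1)[of "n + 1"] in \<open>auto simp: eq shifted_seq_def simp del: power_Suc\<close>)
  have "infinite (supp \<mu>)" using V_D(2)[OF \<mu>(1)] by (simp add: Mstar_def)
  then have "infinite (supp \<mu> - {a})" by simp
  moreover have "supp \<mu> - {a} \<subseteq> supp (linear_density a \<mu>)"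
    using supp_linear_density_superset[OF sets, of a] \<mu>(2) by force
  ultimately have "infinite (supp (linear_density a \<mu>))" using finite_subset by blast
  then show "linear_density a \<mu> \<in> V (shifted_seq s a)"
    unfolding V_def Mstar_def using int mom sets by simp
  have "AE y in linear_density a \<mu>. y \<in> {a..}" unfolding AE_linear_density[OF sets] by simp
  then show "supp (linear_density a \<mu>) \<subseteq> {a..}" using sets by (intro supp_subset_closed) auto
qed

section \<open>Adding a point mass\<close>

definition add_atom :: "real measure \<Rightarrow> real \<Rightarrow> real \<Rightarrow> real measure" where
  "add_atom \<nu> a m = measure_of UNIV (sets borel) (\<lambda>A. emeasure \<nu> A + emeasure (scale_measure (ennreal m) (return borel a)) A)"

lemma sets_add_atom [simp, measurable_cong]: "sets (add_atom \<nu> a m) = sets borel"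
  and space_add_atom [simp]: "space (add_atom \<nu> a m) = UNIV"
  using sets.sigma_sets_eq[of "borel :: real measure"] by (simp_all add: add_atom_def sets_measure_of)

lemma emeasure_add_atom:
  assumes "sets \<nu> = sets borel" "A \<in> sets borel"
  shows "emeasure (add_atom \<nu> a m) A = emeasure \<nu> A + ennreal m * indicator A a"
proof -
  let ?\<rho> = "scale_measure (ennreal m) (return borel a) :: real measure"
  have "emeasure (add_atom \<nu> a m) A = emeasure \<nu> A + emeasure ?\<rho> A"
  proof (rule emeasure_measure_of[OF add_atom_def])
    show "positive (sets (add_atom \<nu> a m)) (\<lambda>A. emeasure \<nu> A + emeasure ?\<rho> A)" by (simp add: positive_def)
    show "countably_additive (sets (add_atom \<nu> a m)) (\<lambda>A. emeasure \<nu> A + emeasure ?\<rho> A)"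
    proof (rule countably_additiveI)
      fix X :: "nat \<Rightarrow> real set"
      assume X: "range X \<subseteq> sets (add_atom \<nu> a m)" "disjoint_family X"
      have "(\<Sum>i. emeasure \<nu> (X i) + emeasure ?\<rho> (X i)) = (\<Sum>i. emeasure \<nu> (X i)) + (\<Sum>i. emeasure ?\<rho> (X i))"
        by (intro suminf_add[symmetric] summableI)
      also have "\<dots> = emeasure \<nu> (\<Union>i. X i) + emeasure ?\<rho> (\<Union>i. X i)"
        using X assms(1) by (simp only: suminf_emeasure sets_add_atom sets_scale_measure sets_return)
      finally show "(\<Sum>i. emeasure \<nu> (X i) + emeasure ?\<rho> (X i)) = emeasure \<nu> (\<Union>i. X i) + emeasure ?\<rho> (\<Union>i. X i)" .
    qed
  qed (use assms in auto)
  then show ?thesis using assms(2) by simp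
qed

lemma nn_integral_add_atom:
  assumes sets: "sets \<nu> = sets borel" and f: "f \<in> borel_measurable borel"
  shows "(\<integral>\<^sup>+y. f y \<partial>add_atom \<nu> a m) = (\<integral>\<^sup>+y. f y \<partial>\<nu>) + ennreal m * f a"
  using f
proof (induction rule: borel_measurable_induct)
  case (cong f g)
  then have "f = g" by auto
  then show ?case using cong by simp
next
  case (set A)
  then show ?case using emeasure_add_atom[OF sets set, of a m] sets by simp
next
  case (mult u c)
  have [measurable_cong]: "sets \<nu> = sets borel" by fact
  have "u \<in> borel_measurable (add_atom \<nu> a m)" "u \<in> borel_measurable \<nu>" using mult by measurable
  then show ?case using mult by (simp add: nn_integral_cmult distrib_left mult_ac)
next
  case (add u v)
  have [measurable_cong]: "sets \<nu> = sets borel" by fact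
  have "u \<in> borel_measurable (add_atom \<nu> a m)" "u \<in> borel_measurable \<nu>"
    "v \<in> borel_measurable (add_atom \<nu> a m)" "v \<in> borel_measurable \<nu>" using add by measurable
  then show ?case using add by (simp add: nn_integral_add distrib_left add_ac)
next
  case (seq U)
  have [measurable_cong]: "sets \<nu> = sets borel" by fact
  have U: "U i \<in> borel_measurable (add_atom \<nu> a m)" "U i \<in> borel_measurable \<nu>" for i using seq by measurable
  have "(\<integral>\<^sup>+y. (SUP i. U i) y \<partial>add_atom \<nu> a m) = (SUP i. \<integral>\<^sup>+y. U i y \<partial>add_atom \<nu> a m)"
    unfolding SUP_apply by (rule nn_integral_monotone_convergence_SUP[OF seq(3) U(1)])
  also have "\<dots> = (SUP i. (\<integral>\<^sup>+y. U i y \<partial>\<nu>) + ennreal m * U i a)"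
    using seq by simp
  also have "\<dots> = (SUP i. \<integral>\<^sup>+y. U i y \<partial>\<nu>) + (SUP i. ennreal m * U i a)"
    using seq(3) by (intro ennreal_SUP_add incseq_nn_integral)
      (auto simp: incseq_def le_fun_def intro!: mult_left_mono)
  also have "(SUP i. \<integral>\<^sup>+y. U i y \<partial>\<nu>) = (\<integral>\<^sup>+y. (SUP i. U i) y \<partial>\<nu>)"
    unfolding SUP_apply by (rule nn_integral_monotone_convergence_SUP[OF seq(3) U(2), symmetric])
  also have "(SUP i. ennreal m * U i a) = ennreal m * (SUP i. U i) a"
    unfolding SUP_apply by (rule SUP_mult_left_ennreal[symmetric])
  finally show ?case .
qed

lemma integral_add_atom:
  fixes f :: "real \<Rightarrow> real"
  assumes sets: "sets \<nu> = sets borel" and m: "m \<ge> 0" and f [measurable]: "f \<in> borel_measurable borel"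
    and int: "integrable \<nu> f"
  shows "integrable (add_atom \<nu> a m) f" "(\<integral>y. f y \<partial>add_atom \<nu> a m) = (\<integral>y. f y \<partial>\<nu>) + m * f a"
proof -
  have nn: "(\<integral>\<^sup>+y. ennreal (g y) \<partial>add_atom \<nu> a m) = (\<integral>\<^sup>+y. ennreal (g y) \<partial>\<nu>) + ennreal (m * g a)"
    if [measurable]: "g \<in> borel_measurable borel" for g :: "real \<Rightarrow> real"
    using nn_integral_add_atom[OF sets, of "\<lambda>y. ennreal (g y)" a m] m by (simp add: ennreal_mult')
  have fin: "(\<integral>\<^sup>+y. ennreal (norm (f y)) \<partial>\<nu>) < \<infinity>" using int by (simp add: integrable_iff_bounded)
  have "(\<integral>\<^sup>+y. ennreal (norm (f y)) \<partial>add_atom \<nu> a m) < \<infinity>"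
    using fin by (subst nn) auto
  then show i: "integrable (add_atom \<nu> a m) f" by (intro integrableI_bounded) auto
  have top: "(\<integral>\<^sup>+y. ennreal (f y) \<partial>\<nu>) < \<top>" "(\<integral>\<^sup>+y. ennreal (- f y) \<partial>\<nu>) < \<top>"
    using int by (auto simp: real_integrable_def less_top)
  have "(\<integral>y. f y \<partial>add_atom \<nu> a m) =
     enn2real (\<integral>\<^sup>+y. ennreal (f y) \<partial>add_atom \<nu> a m) - enn2real (\<integral>\<^sup>+y. ennreal (- f y) \<partial>add_atom \<nu> a m)"
    by (rule real_lebesgue_integral_def[OF i])
  also have "\<dots> = (enn2real (\<integral>\<^sup>+y. ennreal (f y) \<partial>\<nu>) + enn2real (ennreal (m * f a)))
     - (enn2real (\<integral>\<^sup>+y. ennreal (- f y) \<partial>\<nu>) + enn2real (ennreal (m * - f a)))"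
    using top by (subst (1 2) nn) (auto simp: enn2real_plus simp del: mult_minus_right)
  also have "\<dots> = (\<integral>y. f y \<partial>\<nu>) + (enn2real (ennreal (m * f a)) - enn2real (ennreal (- (m * f a))))"
    by (simp add: real_lebesgue_integral_def[OF int])
  also have "enn2real (ennreal (m * f a)) - enn2real (ennreal (- (m * f a))) = m * f a"
    by (cases "m * f a \<ge> 0") (auto simp: ennreal_neg)
  finally show "(\<integral>y. f y \<partial>add_atom \<nu> a m) = (\<integral>y. f y \<partial>\<nu>) + m * f a" .
qed

lemma AE_scale_measure: "c > 0 \<Longrightarrow> (AE y in scale_measure (ennreal c) \<mu>. Q y) \<longleftrightarrow> (AE y in \<mu>. Q y)"
  unfolding scale_measure_eq_density by (subst AE_density) auto

lemma integral_scale_measure: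
  fixes f :: "real \<Rightarrow> real"
  assumes "c > 0" "f \<in> borel_measurable \<mu>"
  shows "(\<integral>y. f y \<partial>scale_measure (ennreal c) \<mu>) = c * (\<integral>y. f y \<partial>\<mu>)"
  unfolding scale_measure_eq_density using assms by (subst integral_density) auto

context moment_sequence
begin

text \<open>The inverse of \<open>\<mu> \<mapsto> (y - a) d\<mu>(y)\<close>: divide by \<open>y - a\<close> and put the missing mass at \<open>a\<close>.\<close>

lemma solution_from_shifted:
  fixes a \<delta> :: real
  defines "\<sigma> \<equiv> shifted_seq s a 0"
  assumes \<sigma>: "\<sigma> > 0" and \<nu>: "\<nu> \<in> V (normalize_seq (shifted_seq s a))"
    and \<delta>: "\<delta> > 0" "AE y in \<nu>. a + \<delta> \<le> y" and m: "\<sigma> * (\<integral>y. 1 / (y - a) \<partial>\<nu>) \<le> 1"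
  obtains \<mu> where "\<mu> \<in> V s" "supp \<mu> \<subseteq> {a..}" "measure \<mu> {a} \<ge> 1 - \<sigma> * (\<integral>y. 1 / (y - a) \<partial>\<nu>)"
    "linear_density a \<mu> = scale_measure (ennreal \<sigma>) \<nu>"
proof -
  note sets = V_D(1)[OF \<nu>]
  have [measurable_cong]: "sets \<nu> = sets borel" by fact
  \<comment> \<open>The mass lost at \<open>a\<close>: division by y - a recovers only the part of
    the solution outside {a}.\<close>
  define M where "M = 1 - \<sigma> * (\<integral>y. 1 / (y - a) \<partial>\<nu>)"
  have M0: "M \<ge> 0" using m by (simp add: M_def)
  define f where "f y = \<sigma> / (y - a)" for y
  have [measurable]: "f \<in> borel_measurable borel" unfolding f_def by measurable
  have f0: "AE y in \<nu>. 0 \<le> f y" using \<delta>(2) by eventually_elim (use \<delta>(1) \<sigma> in \<open>auto simp: f_def\<close>)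
  have fb: "AE y in \<nu>. norm (f y) \<le> \<sigma> / \<delta>"
    using \<delta>(2) by eventually_elim (use \<delta>(1) \<sigma> in \<open>auto simp: f_def abs_divide intro!: divide_left_mono mult_pos_pos\<close>)
  define \<rho> where "\<rho> = density \<nu> (\<lambda>y. ennreal (f y))"
  have s\<rho>: "sets \<rho> = sets borel" by (simp add: \<rho>_def sets)
  define \<mu> where "\<mu> = add_atom \<rho> a M"
  have ipow: "integrable \<nu> (\<lambda>y. y ^ n)" "(\<integral>y. y ^ n \<partial>\<nu>) = shifted_seq s a n / \<sigma>" for n
    using \<nu> by (auto simp: V_def Mstar_def normalize_seq_def \<sigma>_def)
  have if': "integrable \<nu> (\<lambda>y. f y * y ^ n)" for n
    by (rule integrable_bounded_mult[OF ipow(1) _ fb]) measurable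
  have \<rho>int: "integrable \<rho> (\<lambda>y. y ^ n)" "(\<integral>y. y ^ n \<partial>\<rho>) = (\<integral>y. f y * y ^ n \<partial>\<nu>)" for n
    unfolding \<rho>_def using f0 if'[of n] by (auto simp: integrable_density integral_density)
  \<comment> \<open>Since y f(y) = a f(y) + \<sigma>, both sides satisfy s_{n+1} = a s_n plus the
    shifted moment; the choice of \<open>M\<close> settles n = 0, where the total mass must be
    1.\<close>
  have mom: "(\<integral>y. f y * y ^ n \<partial>\<nu>) + M * a ^ n = s n" for n
  proof (induction n)
    case 0
    have "(\<integral>y. f y \<partial>\<nu>) = \<sigma> * (\<integral>y. 1 / (y - a) \<partial>\<nu>)"
      unfolding f_def by (subst integral_mult_right_zero[symmetric]) simp
    then show ?case by (simp add: M_def s_0)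
  next
    case (Suc n)
    have "(\<integral>y. f y * y ^ Suc n \<partial>\<nu>) = (\<integral>y. a * (f y * y ^ n) + \<sigma> * y ^ n \<partial>\<nu>)"
    proof (rule integral_cong_AE)
      show "AE y in \<nu>. f y * y ^ Suc n = a * (f y * y ^ n) + \<sigma> * y ^ n"
        using \<delta>(2)
      proof eventually_elim
        fix y assume "a + \<delta> \<le> y"
        then have "f y * y = a * f y + \<sigma>" using \<delta>(1) by (simp add: f_def field_simps)
        then show "f y * y ^ Suc n = a * (f y * y ^ n) + \<sigma> * y ^ n"
          by (metis (no_types, lifting) distrib_right mult.assoc power_Suc)
      qed
    qed measurable
    also have "\<dots> = a * (\<integral>y. f y * y ^ n \<partial>\<nu>) + shifted_seq s a n"
      using if'[of n] ipow[of n] \<sigma> by simp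
    finally have "(\<integral>y. f y * y ^ Suc n \<partial>\<nu>) + M * a ^ Suc n = a * ((\<integral>y. f y * y ^ n \<partial>\<nu>) + M * a ^ n) + shifted_seq s a n"
      by (simp add: algebra_simps)
    then show ?case unfolding Suc.IH by (simp add: shifted_seq_def)
  qed
  have "\<mu> \<in> V s"
  proof (rule V_I[OF V_nonempty])
    show "integrable \<mu> (\<lambda>x. x ^ n)" for n
      unfolding \<mu>_def by (rule integral_add_atom(1)[OF s\<rho> M0 _ \<rho>int(1)]) measurable
    have "(\<integral>x. x ^ n \<partial>\<mu>) = (\<integral>y. y ^ n \<partial>\<rho>) + M * a ^ n" for n
      unfolding \<mu>_def by (rule integral_add_atom(2)[OF s\<rho> M0 _ \<rho>int(1)]) measurable
    then show "(\<integral>x. x ^ n \<partial>\<mu>) = s n" for n unfolding \<rho>int(2) mom .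
  qed (simp add: \<mu>_def)
  moreover have "supp \<mu> \<subseteq> {a..}"
  proof (rule supp_subset_closed)
    have "AE y in \<rho>. y \<in> {a..}" unfolding \<rho>_def using \<delta>
      by (subst AE_density) (auto elim!: eventually_mono)
    then have "emeasure \<rho> {..<a} = 0"
      by (subst (asm) AE_iff_measurable[of "{..<a}"]) (auto simp: s\<rho> sets_eq_imp_space_eq[OF s\<rho>])
    then have "emeasure \<mu> {..<a} = 0" unfolding \<mu>_def by (subst emeasure_add_atom[OF s\<rho>]) auto
    then show "AE y in \<mu>. y \<in> {a..}"
      by (intro AE_I[of _ _ "{..<a}"]) (auto simp: \<mu>_def)
  qed (auto simp: \<mu>_def)
  moreover have "measure \<mu> {a} \<ge> M"
  proof -
    interpret finite_measure \<mu> using V_D(3)[OF \<open>\<mu> \<in> V s\<close>] .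
    have "emeasure \<mu> {a} \<ge> ennreal M" unfolding \<mu>_def by (subst emeasure_add_atom[OF s\<rho>]) auto
    then show ?thesis by (simp add: emeasure_eq_measure)
  qed
  moreover have "linear_density a \<mu> = scale_measure (ennreal \<sigma>) \<nu>"
  proof (rule measure_eqI)
    fix A assume "A \<in> Sigma_Algebra.sets (linear_density a \<mu>)"
    then have A [measurable]: "A \<in> Sigma_Algebra.sets borel" by (simp add: \<mu>_def)
    have "emeasure (linear_density a \<mu>) A = (\<integral>\<^sup>+y. ennreal (y - a) * indicator A y \<partial>\<mu>)"
      unfolding linear_density_def by (rule emeasure_density) (auto simp: \<mu>_def)
    \<comment> \<open>The factor y - a vanishes at the added atom.\<close>
    also have "\<dots> = (\<integral>\<^sup>+y. ennreal (y - a) * indicator A y \<partial>\<rho>)"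
      unfolding \<mu>_def by (subst nn_integral_add_atom[OF s\<rho>]) auto
    also have "\<dots> = (\<integral>\<^sup>+y. ennreal (f y) * (ennreal (y - a) * indicator A y) \<partial>\<nu>)"
      unfolding \<rho>_def by (subst nn_integral_density) auto
    also have "\<dots> = (\<integral>\<^sup>+y. ennreal \<sigma> * indicator A y \<partial>\<nu>)"
    proof (rule nn_integral_cong_AE)
      show "AE y in \<nu>. ennreal (f y) * (ennreal (y - a) * indicator A y) = ennreal \<sigma> * indicator A y"
        using \<delta>(2)
      proof eventually_elim
        fix y assume y: "a + \<delta> \<le> y"
        have "ennreal (f y) * ennreal (y - a) = ennreal (f y * (y - a))"
          using y \<delta>(1) \<sigma> by (intro ennreal_mult[symmetric]) (auto simp: f_def)
        also have "f y * (y - a) = \<sigma>" using y \<delta>(1) by (simp add: f_def)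
        finally show "ennreal (f y) * (ennreal (y - a) * indicator A y) = ennreal \<sigma> * indicator A y"
          by (simp only: mult.assoc[symmetric])
      qed
    qed
    also have "\<dots> = emeasure (scale_measure (ennreal \<sigma>) \<nu>) A"
      using A by (simp add: nn_integral_cmult_indicator sets)
    finally show "emeasure (linear_density a \<mu>) A = emeasure (scale_measure (ennreal \<sigma>) \<nu>) A" .
  qed (simp add: \<mu>_def sets)
  ultimately show ?thesis using that unfolding M_def by blast
qed

end

context indeterminate_sequence
begin

text \<open>Cauchy-Schwarz between the coefficients of f and the values p_k(b). For f(b) = 1 it
  bounds 1 / \<kappa>(b) by \<open>L (f * f)\<close>, which is how test polynomials enter the mass
  estimates.\<close>

lemma christoffel_bound: "(poly f b)\<^sup>2 \<le> \<kappa> b * L (f * f)"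
proof -
  define n where "n = Suc (degree f)"
  define u where "u k = L (f * p k)" for k
  have f: "f = (\<Sum>k<n. smult (u k) (p k))" unfolding u_def by (rule p_expansion) (simp add: n_def)
  have "poly f b = (\<Sum>k<n. u k * poly (p k) b)" by (subst f) (simp add: poly_sum)
  then have "(poly f b)\<^sup>2 \<le> (\<Sum>k<n. (u k)\<^sup>2) * (\<Sum>k<n. (poly (p k) b)\<^sup>2)"
    by (simp add: Cauchy_Schwarz_ineq_sum)
  also have "(\<Sum>k<n. (u k)\<^sup>2) = L (f * f)" by (subst (1 2) f) (rule L_p_combination_square[symmetric])
  also have "L (f * f) * (\<Sum>k<n. (poly (p k) b)\<^sup>2) \<le> L (f * f) * \<kappa> b"
  proof (rule mult_left_mono[OF \<kappa>_bound])
    show "L (f * f) \<ge> 0" using L_square_pos[of f] by (cases "f = 0") auto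
  qed
  finally show ?thesis by (simp add: mult.commute)
qed

text \<open>Take t = -B(a) / D(a), or t = \<infinity> if D(a) = 0. Hence a solution with maximal
  mass anywhere on the line is N-extremal.\<close>

lemma ex_G_zero: "\<exists>t. G t (of_real a) = 0"
proof (cases "D (of_real a) = 0")
  case True
  then show ?thesis by (intro exI[of _ \<infinity>]) (simp add: G_def)
next
  case False
  define b where "b = Re (B (of_real a))"
  have b: "B (of_real a) = of_real b" unfolding b_def using ABCD_real(2)[of a] by (metis of_real_Re)
  have d: "d a \<noteq> 0" using False by (auto simp: D_of_real)
  show ?thesis
    by (intro exI[of _ "ereal (- b / d a)"]) (use d in \<open>simp add: G_def b D_of_real field_simps\<close>)
qed

end

section \<open>The Friedrichs solution of a shifted sequence\<close>

context friedrichs_sequence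
begin

text \<open>The gap keeps 1 / (y - c t) bounded on the rest of the support, so that division by y -
  c t is legitimate.\<close>

lemma N_ext_isolated:
  assumes t: "F \<le> t"
  obtains \<delta> where "\<delta> > 0" "AE y in N_ext s (ereal t). y = c t \<or> c t + \<delta> \<le> y"
proof -
  obtain \<epsilon> where \<epsilon>: "\<epsilon> > 0" "\<forall>x. 0 < \<bar>x - c t\<bar> \<and> \<bar>x - c t\<bar> < \<epsilon> \<longrightarrow> g (ereal t) x \<noteq> 0"
    using g_zero_isolated[OF c_props(2)[OF t]] by blast
  have "AE y in N_ext s (ereal t). y = c t \<or> c t + \<epsilon> \<le> y"
    using AE_in_supp[OF V_D(1)[OF N_ext(1)]] AE_N_ext_ge[OF t]
  proof eventually_elim
    fix y assume "y \<in> supp (N_ext s (ereal t))" and y: "c t \<le> y"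
    then have "g (ereal t) y = 0" by (simp add: supp_N_ext_eq)
    then have "\<not> (0 < \<bar>y - c t\<bar> \<and> \<bar>y - c t\<bar> < \<epsilon>)" using \<epsilon>(2) by blast
    then show "y = c t \<or> c t + \<epsilon> \<le> y" using y by auto
  qed
  then show ?thesis using that \<epsilon>(1) by blast
qed

lemma N_ext_mass_c: "F \<le> t \<Longrightarrow> measure (N_ext s (ereal t)) {c t} * \<kappa> (c t) = 1"
  using c_props(2) by (intro N_ext_mass) (simp add: g_eq)

lemma N_ext_mass_c_pos: "F \<le> t \<Longrightarrow> measure (N_ext s (ereal t)) {c t} > 0"
  using N_ext_mass_c[of t] \<kappa>_ge_1[of "c t"] by (metis mult_not_zero zero_less_measure_iff zero_neq_one)

lemma nu_in_V:
  assumes "F \<le> t'" "t' \<le> t"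
  shows "linear_density (c t) (N_ext s (ereal t')) \<in> V (shifted_seq s (c t))"
    "supp (linear_density (c t) (N_ext s (ereal t'))) \<subseteq> {c t..}"
proof -
  have "supp (N_ext s (ereal t')) \<subseteq> {c t..}"
    using c_props(3)[OF assms(1)] c_antimono[OF assms] by force
  then show "linear_density (c t) (N_ext s (ereal t')) \<in> V (shifted_seq s (c t))"
    "supp (linear_density (c t) (N_ext s (ereal t'))) \<subseteq> {c t..}"
    using linear_density_V[OF N_ext(1)] by auto
qed

lemma shifted_pos: "F \<le> t \<Longrightarrow> shifted_seq s (c t) 0 > 0"
  using V_moment_0_pos[OF nu_in_V(1)[of t t]] by simp

text \<open>The solution (y - c t) d\<mu>_t is supported in [c t, \<infinity>) with c t > 0. It has
  no mass at 0, which is the criterion for a finite Friedrichs parameter.\<close>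

lemma shifted_friedrichs_sequence:
  assumes t: "F \<le> t" and ind: "indeterminate (shifted_seq s (c t))"
  shows "\<exists>F'. friedrichs_sequence (normalize_seq (shifted_seq s (c t))) F'"
proof -
  let ?r = "normalize_seq (shifted_seq s (c t))" and ?\<sigma> = "shifted_seq s (c t) 0"
  note \<nu> = nu_in_V[OF t order_refl]
  interpret T: moment_sequence ?r by (rule moment_sequence_normalize[OF \<nu>(1)])
  interpret T: indeterminate_sequence ?r by unfold_locales (rule indeterminate_normalize[OF ind])
  define \<nu>' where "\<nu>' = scale_measure (ennreal (1 / ?\<sigma>)) (linear_density (c t) (N_ext s (ereal t)))"
  have \<nu>': "\<nu>' \<in> V ?r" unfolding \<nu>'_def by (rule V_normalize[OF \<nu>(1)])
  have supp: "supp \<nu>' \<subseteq> {c t..}"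
    unfolding \<nu>'_def using \<nu>(2) shifted_pos[OF t] by (subst supp_scale_measure) auto
  then have supp0: "supp \<nu>' \<subseteq> {0..}" using c_props(1)[OF t] by force
  have "AE y in \<nu>'. y \<notin> {0}"
    using AE_in_supp[OF V_D(1)[OF \<nu>']] by eventually_elim (use supp c_props(1)[OF t] in auto)
  then have "measure \<nu>' {0} = 0"
    using V_D(1)[OF \<nu>'] by (subst measure_eq_0_null_sets) (auto simp: AE_iff_null_sets)
  then obtain F' where "T.\<tau> \<longlonglongrightarrow> F'" using T.friedrichs_param_finite[OF \<nu>' supp0] by auto
  then have "friedrichs_sequence ?r F'" by unfold_locales (use \<nu>' supp0 in auto)
  then show ?thesis by blast
qed

text \<open>The normalized (y - c t) d\<mu>_t integrates 1 / (y - c t) to (1 - m) / \<sigma>, where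
  m is the mass of \<mu>_t at \<open>c t\<close>. By minimality the Friedrichs solution gives at
  most this value, so the solution rebuilt from it has mass at least m, which was maximal. The gap
  and the strict inequality, due to m > 0, are recorded for a perturbation at F.\<close>

lemma shifted_friedrichs_solution:
  assumes t: "F \<le> t" and T: "friedrichs_sequence (normalize_seq (shifted_seq s (c t))) F'"
  shows "linear_density (c t) (N_ext s (ereal t)) =
      scale_measure (ennreal (shifted_seq s (c t) 0)) (N_ext (normalize_seq (shifted_seq s (c t))) (ereal F'))"
    "c t < \<xi> (N_ext (normalize_seq (shifted_seq s (c t))) (ereal F'))"
    "shifted_seq s (c t) 0 * (\<integral>y. 1 / (y - c t) \<partial>N_ext (normalize_seq (shifted_seq s (c t))) (ereal F')) < 1"
proof -
  let ?r = "normalize_seq (shifted_seq s (c t))"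
  let ?\<mu> = "N_ext s (ereal t)" and ?\<kappa> = "N_ext ?r (ereal F')"
  define \<sigma> where "\<sigma> = shifted_seq s (c t) 0"
  interpret T: friedrichs_sequence ?r F' by (rule T)
  have \<sigma>: "\<sigma> > 0" unfolding \<sigma>_def by (rule shifted_pos[OF t])
  note \<nu> = nu_in_V[OF t order_refl]
  note sets = V_D(1)[OF N_ext(1), of "ereal t"]
  have [measurable_cong]: "sets ?\<mu> = sets borel" by (rule sets)
  define \<nu>' where "\<nu>' = scale_measure (ennreal (1 / \<sigma>)) (linear_density (c t) ?\<mu>)"
  have \<nu>': "\<nu>' \<in> V ?r" unfolding \<nu>'_def \<sigma>_def by (rule V_normalize[OF \<nu>(1)])
  have supp: "supp \<nu>' \<subseteq> {0..}"
    unfolding \<nu>'_def using \<nu>(2) \<sigma> c_props(1)[OF t] by (subst supp_scale_measure) force+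
  obtain \<delta> where \<delta>: "\<delta> > 0" "AE y in ?\<mu>. y = c t \<or> c t + \<delta> \<le> y" by (rule N_ext_isolated[OF t])
  have AE\<nu>: "AE y in \<nu>'. c t + \<delta> \<le> y"
    unfolding \<nu>'_def using \<sigma> \<delta>(2)
    by (subst AE_scale_measure) (auto simp: AE_linear_density[OF sets] elim!: eventually_mono)
  have lt: "c t < T.c F'" by (rule T.friedrichs_minimal(1)[OF \<nu>' supp \<delta>(1) AE\<nu>])
  then show "c t < \<xi> ?\<kappa>" by (simp add: T.c_def)
  interpret P: prob_space ?\<mu> by (rule V_prob_space[OF N_ext(1)])
  have "(\<integral>y. 1 / (y - c t) \<partial>\<nu>') = 1 / \<sigma> * (\<integral>y. (y - c t) * (1 / (y - c t)) \<partial>?\<mu>)"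
    unfolding \<nu>'_def using \<sigma> AE_N_ext_ge[OF t]
    by (subst integral_scale_measure) (auto simp: linear_density_integral(2)[OF sets] measurable_cong_sets[OF sets refl] measurable_cong_sets[OF sets_linear_density refl])
  \<comment> \<open>At y = c t the integrand is 0, division by zero included, so exactly the atom is
    removed.\<close>
  also have "(\<integral>y. (y - c t) * (1 / (y - c t)) \<partial>?\<mu>) = (\<integral>y. 1 - indicator {c t} y \<partial>?\<mu>)"
    by (intro Bochner_Integration.integral_cong) (auto simp: indicator_def)
  also have "\<dots> = 1 - measure ?\<mu> {c t}"
    using integral_indicator_singleton_mult(1)[OF V_D(3)[OF N_ext(1)] sets, of "\<lambda>_. 1 :: real" "c t"]
      sets_eq_imp_space_eq[OF sets] P.prob_space
    by (subst Bochner_Integration.integral_diff) auto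
  finally have \<nu>int: "\<sigma> * (\<integral>y. 1 / (y - c t) \<partial>\<nu>') = 1 - measure ?\<mu> {c t}" using \<sigma> by simp
  have "(\<integral>y. 1 / (y - c t) \<partial>?\<kappa>) \<le> (\<integral>y. 1 / (y - c t) \<partial>\<nu>')"
    by (rule T.friedrichs_minimal(2)[OF \<nu>' supp \<delta>(1) AE\<nu>])
  then have "\<sigma> * (\<integral>y. 1 / (y - c t) \<partial>?\<kappa>) \<le> \<sigma> * (\<integral>y. 1 / (y - c t) \<partial>\<nu>')"
    using \<sigma> by (intro mult_left_mono) auto
  then have le: "\<sigma> * (\<integral>y. 1 / (y - c t) \<partial>?\<kappa>) \<le> 1 - measure ?\<mu> {c t}" unfolding \<nu>int .
  then show "shifted_seq s (c t) 0 * (\<integral>y. 1 / (y - c t) \<partial>?\<kappa>) < 1"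
    using N_ext_mass_c_pos[OF t] by (simp add: \<sigma>_def)
  have AE\<kappa>: "AE y in ?\<kappa>. c t + (T.c F' - c t) \<le> y" using T.AE_N_ext_ge[of F'] by simp
  have le1: "\<sigma> * (\<integral>y. 1 / (y - c t) \<partial>?\<kappa>) \<le> 1"
    using le measure_nonneg[of ?\<mu> "{c t}"] by linarith
  obtain \<mu>' where \<mu>': "\<mu>' \<in> V s" "measure \<mu>' {c t} \<ge> 1 - \<sigma> * (\<integral>y. 1 / (y - c t) \<partial>?\<kappa>)"
    "linear_density (c t) \<mu>' = scale_measure (ennreal \<sigma>) ?\<kappa>"
    using solution_from_shifted[of "c t" ?\<kappa> "T.c F' - c t"] \<sigma> T.N_ext(1) lt AE\<kappa> le1
    unfolding \<sigma>_def by (metis diff_gt_0_iff_gt)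
  have "measure ?\<mu> {c t} \<le> measure \<mu>' {c t}" using \<mu>'(2) le by linarith
  then have "measure ?\<mu> {c t} * \<kappa> (c t) \<le> measure \<mu>' {c t} * \<kappa> (c t)"
    using \<kappa>_ge_1[of "c t"] by (intro mult_right_mono) auto
  then have "measure \<mu>' {c t} * \<kappa> (c t) \<ge> 1" using N_ext_mass_c[OF t] by simp
  then have "\<mu>' = ?\<mu>"
    using c_props(2)[OF t] \<mu>'(1) by (intro max_mass_eq_N_ext[of "ereal t" "c t"]) (auto simp: g_eq)
  then show "linear_density (c t) ?\<mu> = scale_measure (ennreal (shifted_seq s (c t) 0)) ?\<kappa>"
    using \<mu>'(3) by (simp add: \<sigma>_def)
qed

end

section \<open>Shifted sequences\<close>

lemma moment_functional_shifted:
  assumes \<mu>: "\<mu> \<in> V s" "supp \<mu> \<subseteq> {a..}"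
  shows "shifted_seq s a 0 * moment_functional (normalize_seq (shifted_seq s a)) f = (\<integral>y. (y - a) * poly f y \<partial>\<mu>)"
proof -
  note \<nu> = linear_density_V[OF \<mu>]
  note sets = V_D(1)[OF \<mu>(1)]
  define \<sigma> where "\<sigma> = shifted_seq s a 0"
  have \<sigma>: "\<sigma> > 0" unfolding \<sigma>_def by (rule V_moment_0_pos[OF \<nu>(1)])
  interpret T: moment_sequence "normalize_seq (shifted_seq s a)" by (rule moment_sequence_normalize[OF \<nu>(1)])
  have AE: "AE y in \<mu>. a \<le> y" using AE_in_supp[OF sets] by eventually_elim (use \<mu>(2) in auto)
  have "T.L f = (\<integral>y. poly f y \<partial>scale_measure (ennreal (1 / \<sigma>)) (linear_density a \<mu>))"
    unfolding \<sigma>_def by (rule T.L_eq_integral[OF V_normalize[OF \<nu>(1)]])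
  also have "\<dots> = 1 / \<sigma> * (\<integral>y. poly f y \<partial>linear_density a \<mu>)"
    using \<sigma> V_D(5)[OF \<nu>(1), of f] by (intro integral_scale_measure) auto
  also have "(\<integral>y. poly f y \<partial>linear_density a \<mu>) = (\<integral>y. (y - a) * poly f y \<partial>\<mu>)"
    by (rule linear_density_integral(2)[OF sets AE]) measurable
  finally show ?thesis using \<sigma> by (simp add: \<sigma>_def)
qed

text \<open>The minimizer of \<open>L (f * f)\<close> among polynomials of degree below n with f(b)
  = 1, hence the test polynomial for the mass estimates.\<close>

lemma (in moment_sequence) normalized_kern:
  fixes b :: real and n :: nat
  assumes "n > 0"
  defines "f \<equiv> smult (1 / poly (kern b n) b) (kern b n)"
  shows "poly f b = 1" "L (f * f) = 1 / poly (kern b n) b"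
  using kern_diagonal_ge_1[OF assms(1), of b] L_kern_square[of b n] by (auto simp: f_def L_smult)

lemma (in indeterminate_sequence) h_finite:
  "h (ereal t) x = h (ereal t') x + (t - t') * Re (C (of_real x))"
  unfolding h_def H_def by (simp add: algebra_simps)

context friedrichs_sequence
begin

text \<open>On [0, a] the function g_F has a negative maximum, and g at parameter F + e is g_F + e d
  with \<open>d\<close> bounded above; for small e there is still no zero up to
  \<open>a\<close>.\<close>

lemma c_right_continuous:
  assumes a: "0 \<le> a" "a < c F"
  shows "eventually (\<lambda>k. a < c (F + 1 / real (Suc k))) sequentially"
proof -
  define e where "e k = 1 / real (Suc k)" for k
  have e0: "e k > 0" for k by (simp add: e_def)
  have el: "e \<longlonglongrightarrow> 0" unfolding e_def[abs_def] by (rule LIMSEQ_Suc[OF lim_1_over_n])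
  obtain x0 where x0: "x0 \<in> {0..a}" "\<And>x. x \<in> {0..a} \<Longrightarrow> g (ereal F) x \<le> g (ereal F) x0"
    using continuous_attains_sup[of "{0..a}" "g (ereal F)"] continuous_gh(1) a by auto
  have d_eq: "d = (\<lambda>x. g (ereal 1) x - g (ereal 0) x)" using g_finite[of 1 _ 0] by (simp add: fun_eq_iff)
  have "continuous_on {0..a} d" unfolding d_eq by (intro continuous_intros continuous_gh)
  then have "\<exists>x\<in>{0..a}. \<forall>y\<in>{0..a}. d y \<le> d x" using a by (intro continuous_attains_sup) auto
  then obtain x1 where x1: "\<And>x. x \<in> {0..a} \<Longrightarrow> d x \<le> d x1" by blast
  have "(\<lambda>k. g (ereal F) x0 + e k * d x1) \<longlonglongrightarrow> g (ereal F) x0 + 0 * d x1" by (intro tendsto_intros el)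
  moreover have "g (ereal F) x0 < 0" using c_props(4)[of F x0] x0(1) a by simp
  ultimately have "eventually (\<lambda>k. g (ereal F) x0 + e k * d x1 < 0) sequentially"
    by (intro order_tendstoD(2)) auto
  then show ?thesis
  proof eventually_elim
    fix k assume k: "g (ereal F) x0 + e k * d x1 < 0"
    have Fu: "F \<le> F + e k" using e0[of k] by simp
    have "g (ereal (F + e k)) x < 0" if x: "x \<in> {0..a}" for x
    proof -
      have "g (ereal (F + e k)) x = g (ereal F) x + e k * d x" using g_finite[of "F + e k" x F] by simp
      also have "\<dots> \<le> g (ereal F) x0 + e k * d x1"
        using x0(2)[OF x] x1[OF x] e0[of k] by (intro add_mono mult_left_mono) auto
      finally show ?thesis using k by simp
    qed
    then have "c (F + e k) \<notin> {0..a}" using c_props(2)[OF Fu] by fastforce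
    then show "a < c (F + 1 / real (Suc k))" using c_props(1)[OF Fu] by (simp add: e_def)
  qed
qed

text \<open>The transform at \<open>a\<close> is -h / g with g and h affine in the parameter, and
  g_F(a) is nonzero.\<close>

lemma transform_right_continuous:
  assumes a: "0 \<le> a" "a < c F" and v: "(\<integral>y. 1 / (y - a) \<partial>N_ext s (ereal F)) < v"
  obtains u where "F < u" "a < c u" "(\<integral>y. 1 / (y - a) \<partial>N_ext s (ereal u)) < v"
proof -
  define e where "e k = 1 / real (Suc k)" for k
  have e0: "e k > 0" for k by (simp add: e_def)
  have el: "e \<longlonglongrightarrow> 0" unfolding e_def[abs_def] by (rule LIMSEQ_Suc[OF lim_1_over_n])
  have tr: "(\<integral>y. 1 / (y - a) \<partial>N_ext s (ereal u)) = - h (ereal u) a / g (ereal u) a" if u: "F \<le> u" "a < c u" for u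
  proof -
    have "AE y in N_ext s (ereal u). a + (c u - a) \<le> y" using AE_N_ext_ge[OF u(1)] by simp
    then have "(\<integral>y. 1 / (y - a) \<partial>N_ext s (ereal u)) * g (ereal u) a + h (ereal u) a = 0"
      using u c_props(2)[OF u(1)] by (intro N_ext_real_transform[of _ "c u" "c u - a"]) auto
    then show ?thesis using c_props(4)[OF u] by (simp add: field_simps)
  qed
  have "(\<lambda>k. - (h (ereal F) a + e k * Re (C (of_real a))) / (g (ereal F) a + e k * d a)) \<longlonglongrightarrow>
    - (h (ereal F) a + 0 * Re (C (of_real a))) / (g (ereal F) a + 0 * d a)"
    using c_props(4)[of F a] a by (intro tendsto_intros el) auto
  then have "(\<lambda>k. - (h (ereal F) a + e k * Re (C (of_real a))) / (g (ereal F) a + e k * d a)) \<longlonglongrightarrow> (\<integral>y. 1 / (y - a) \<partial>N_ext s (ereal F))"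
    using tr[of F] a by simp
  then have "eventually (\<lambda>k. - (h (ereal F) a + e k * Re (C (of_real a))) / (g (ereal F) a + e k * d a) < v) sequentially"
    using v by (rule order_tendstoD(2))
  with c_right_continuous[OF a]
  have "eventually (\<lambda>k. a < c (F + e k) \<and> - (h (ereal F) a + e k * Re (C (of_real a))) / (g (ereal F) a + e k * d a) < v) sequentially"
    unfolding e_def by (rule eventually_conj)
  then obtain k where k: "a < c (F + e k)" "- (h (ereal F) a + e k * Re (C (of_real a))) / (g (ereal F) a + e k * d a) < v"
    by (auto simp: eventually_sequentially)
  have "(\<integral>y. 1 / (y - a) \<partial>N_ext s (ereal (F + e k))) < v"
    using k(2) g_finite[of "F + e k" a F] h_finite[of "F + e k" a F] e0[of k] by (subst tr) (auto intro: k(1))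
  then show ?thesis using that[of "F + e k"] k(1) e0[of k] by simp
qed

text \<open>In the indeterminate case the Friedrichs solution would leave positive mass to be put at
  \<open>c F\<close>, so a solution with parameter u slightly above F' could be divided by y - c F
  as well. The result is supported in [c F, \<infinity>), hence is \<mu>_F again; but the parameters
  u and F' have different smallest mass points.\<close>

lemma shifted_F_determinate: "\<not> indeterminate (shifted_seq s (c F))"
proof
  assume ind: "indeterminate (shifted_seq s (c F))"
  let ?r = "normalize_seq (shifted_seq s (c F))"
  define \<sigma> where "\<sigma> = shifted_seq s (c F) 0"
  have \<sigma>: "\<sigma> > 0" unfolding \<sigma>_def by (rule shifted_pos) simp
  obtain F' where T': "friedrichs_sequence ?r F'" using shifted_friedrichs_sequence[OF order_refl ind] by blast
  interpret T: friedrichs_sequence ?r F' by (rule T')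
  note sol = shifted_friedrichs_solution[OF order_refl T']
  have a: "0 \<le> c F" "c F < T.c F'" using c_props(1)[of F] sol(2) by (auto simp: T.c_def)
  have "(\<integral>y. 1 / (y - c F) \<partial>N_ext ?r (ereal F')) < 1 / \<sigma>"
    using sol(3) \<sigma> by (simp add: \<sigma>_def field_simps)
  then obtain u where u: "F' < u" "c F < T.c u" "(\<integral>y. 1 / (y - c F) \<partial>N_ext ?r (ereal u)) < 1 / \<sigma>"
    by (rule T.transform_right_continuous[OF a])
  have AEu: "AE y in N_ext ?r (ereal u). c F + (T.c u - c F) \<le> y" using T.AE_N_ext_ge[of u] u(1) by simp
  have le1: "\<sigma> * (\<integral>y. 1 / (y - c F) \<partial>N_ext ?r (ereal u)) \<le> 1" using u(3) \<sigma> by (simp add: field_simps)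
  obtain \<mu> where \<mu>: "\<mu> \<in> V s" "supp \<mu> \<subseteq> {c F..}"
    "linear_density (c F) \<mu> = scale_measure (ennreal \<sigma>) (N_ext ?r (ereal u))"
    using solution_from_shifted[of "c F" "N_ext ?r (ereal u)" "T.c u - c F"] \<sigma> T.N_ext(1) u(2) AEu le1
    unfolding \<sigma>_def by (metis diff_gt_0_iff_gt)
  have "\<mu> = N_ext s (ereal F)" by (rule friedrichs_unique[OF \<mu>(1,2)])
  then have "scale_measure (ennreal \<sigma>) (N_ext ?r (ereal u)) = scale_measure (ennreal \<sigma>) (N_ext ?r (ereal F'))"
    using \<mu>(3) sol(1) by (simp add: \<sigma>_def)
  then have "N_ext ?r (ereal u) = N_ext ?r (ereal F')" using scale_measure_inverse(2)[OF \<sigma>] by metis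
  then have "T.c u = T.c F'" by (simp add: T.c_def)
  then show False using T.c_strict_decreasing[of F' u] u(1) by simp
qed

lemma V_shifted_F: "V (shifted_seq s (c F)) = {linear_density (c F) (N_ext s (ereal F))}"
  using shifted_F_determinate nu_in_V(1)[of F F] unfolding indeterminate_iff by blast

text \<open>The atom of \<mu>_{t'} at \<open>c t'\<close> survives because c t' > c t, whereas
  \<mu>_t has no atom there since g_t does not vanish at \<open>c t'\<close>.\<close>

lemma nu_distinct:
  assumes "F \<le> t'" "t' < t"
  shows "linear_density (c t) (N_ext s (ereal t')) \<noteq> linear_density (c t) (N_ext s (ereal t))"
proof
  assume eq: "linear_density (c t) (N_ext s (ereal t')) = linear_density (c t) (N_ext s (ereal t))"
  let ?b = "c t'"
  have ab: "c t < ?b" by (rule c_strict_decreasing[OF assms])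
  have "d ?b > 0" using c_props(1)[OF assms(1)] c_antimono[of F t'] assms by (intro d_pos) auto
  then have "g (ereal t) ?b \<noteq> 0"
    using g_finite[of t ?b t'] c_props(2)[OF assms(1)] assms by simp
  then have "?b \<notin> supp (N_ext s (ereal t))" by (simp add: supp_N_ext_eq)
  then have "\<not> emeasure (N_ext s (ereal t)) {?b} > 0" using in_supp_if_atom[OF V_D(1)[OF N_ext(1)]] by blast
  then have "emeasure (linear_density (c t) (N_ext s (ereal t))) {?b} = 0"
    by (simp add: emeasure_linear_density_singleton[OF V_D(1)[OF N_ext(1)]])
  then have "ennreal (?b - c t) * emeasure (N_ext s (ereal t')) {?b} = 0"
    unfolding eq[symmetric] by (simp add: emeasure_linear_density_singleton[OF V_D(1)[OF N_ext(1)]])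
  then have "emeasure (N_ext s (ereal t')) {?b} = 0" using ab by (auto simp: ennreal_eq_0_iff)
  then show False using N_ext_mass_c_pos[OF assms(1)] by (simp add: measure_def)
qed

lemma shifted_indet_S:
  assumes t: "F < t"
  shows "indet_S (shifted_seq s (c t))"
proof -
  have F: "F \<le> t" using t by simp
  let ?\<nu> = "linear_density (c t) (N_ext s (ereal F))" and ?\<nu>' = "linear_density (c t) (N_ext s (ereal t))"
  have V: "?\<nu> \<in> V (shifted_seq s (c t))" "?\<nu>' \<in> V (shifted_seq s (c t))"
    using nu_in_V(1)[of F t] nu_in_V(1)[of t t] F by auto
  have supp: "supp ?\<nu> \<subseteq> {0..}" "supp ?\<nu>' \<subseteq> {0..}"
    using nu_in_V(2)[of F t] nu_in_V(2)[of t t] F c_props(1)[OF F] by force+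
  have ne: "?\<nu> \<noteq> ?\<nu>'" by (rule nu_distinct) (use t in auto)
  show ?thesis unfolding indet_S_def stieltjes_def indeterminate_iff using V supp ne by blast
qed

lemma shifted_stieltjes: "F \<le> t \<Longrightarrow> stieltjes (shifted_seq s (c t))"
  unfolding stieltjes_def using nu_in_V[of t t] c_props(1)[of t] by force

lemma nu_friedrichs:
  assumes t: "F < t"
  shows "linear_density (c t) (N_ext s (ereal t)) = friedrichs_solution (shifted_seq s (c t))"
proof -
  have F: "F \<le> t" using t by simp
  have ind: "indeterminate (shifted_seq s (c t))" using shifted_indet_S[OF t] by (simp add: indet_S_def)
  obtain F' where T': "friedrichs_sequence (normalize_seq (shifted_seq s (c t))) F'"
    using shifted_friedrichs_sequence[OF F ind] by blast
  interpret T: friedrichs_sequence "normalize_seq (shifted_seq s (c t))" F' by (rule T')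
  show ?thesis unfolding friedrichs_solution_def T.friedrichs_param_eq
    by (rule shifted_friedrichs_solution(1)[OF F T'])
qed

section \<open>Comparison of Christoffel functions\<close>

lemma measure_nu:
  assumes "F \<le> t'" "t' \<le> t"
  shows "measure (scale_measure (ennreal (1 / shifted_seq s (c t) 0)) (linear_density (c t) (N_ext s (ereal t')))) {c t'}
    = (c t' - c t) * measure (N_ext s (ereal t')) {c t'} / shifted_seq s (c t) 0"
proof -
  have "shifted_seq s (c t) 0 > 0" using assms by (intro shifted_pos) simp
  moreover have "c t' - c t \<ge> 0" using c_antimono[OF assms] by simp
  moreover have "measure (linear_density (c t) (N_ext s (ereal t'))) {c t'} = (c t' - c t) * measure (N_ext s (ereal t')) {c t'}"
    using \<open>c t' - c t \<ge> 0\<close>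
    by (simp add: measure_def emeasure_linear_density_singleton[OF V_D(1)[OF N_ext(1)]] enn2real_mult)
  ultimately show ?thesis by (simp add: measure_scale_measure)
qed

text \<open>A bounded kernel would produce a solution with positive mass at \<open>c F\<close>, but
  up to scaling the only solution is (y - c F) d\<mu>_F, which has none there.\<close>

lemma kern_at_c_F_unbounded:
  assumes "M \<ge> 0"
  shows "\<exists>n>0. poly (moment_sequence.kern (normalize_seq (shifted_seq s (c F))) (c F) n) (c F) > M"
proof (rule ccontr)
  let ?r = "normalize_seq (shifted_seq s (c F))"
  define \<sigma> where "\<sigma> = shifted_seq s (c F) 0"
  have \<sigma>: "\<sigma> > 0" unfolding \<sigma>_def by (rule shifted_pos) simp
  note \<nu> = nu_in_V(1)[OF order_refl order_refl]
  interpret R: moment_sequence ?r by (rule moment_sequence_normalize[OF \<nu>])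
  assume no: "\<not> (\<exists>n>0. poly (R.kern (c F) n) (c F) > M)"
  have "(\<Sum>k<n. (poly (R.p k) (c F))\<^sup>2) \<le> M" for n
  proof (cases "n = 0")
    case False
    then have "\<not> poly (R.kern (c F) n) (c F) > M" using no by blast
    then show ?thesis by (simp only: R.poly_kern_diagonal not_less)
  qed (use assms in simp)
  then obtain \<mu> where \<mu>: "\<mu> \<in> V ?r" "measure \<mu> {c F} * M \<ge> 1" using R.max_mass_solution by blast
  have "scale_measure (ennreal \<sigma>) \<mu> \<in> V (shifted_seq s (c F))"
    unfolding \<sigma>_def using \<mu>(1) \<sigma> by (intro V_unnormalize) (auto simp: \<sigma>_def)
  then have "scale_measure (ennreal \<sigma>) \<mu> = linear_density (c F) (N_ext s (ereal F))" by (simp add: V_shifted_F)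
  then have "emeasure (scale_measure (ennreal \<sigma>) \<mu>) {c F} = 0"
    by (simp add: emeasure_linear_density_singleton[OF V_D(1)[OF N_ext(1)]])
  then have "emeasure \<mu> {c F} = 0" using \<sigma> by (auto simp: ennreal_eq_0_iff)
  then show False using \<mu>(2) by (simp add: measure_def)
qed

text \<open>With b = c F, polynomials with f(b) = 1 make the integral of (y - b) f^2 d\<mu>
  arbitrarily small. Right of the gap y - a is at most a multiple of y - b, so the integral of (y -
  a) f^2 d\<mu> comes arbitrarily close to the contribution (b - a) m of the point b alone; the mass
  at b is therefore maximal.\<close>

lemma nu_F_N_extremal:
  assumes t: "F < t"
  shows "is_N_extremal (shifted_seq s (c t)) (linear_density (c t) (N_ext s (ereal F)))"
proof -
  have F: "F \<le> t" using t by simp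
  let ?\<mu> = "N_ext s (ereal F)"
  define a b where "a = c t" and "b = c F"
  define \<sigma> \<sigma>' where "\<sigma> = shifted_seq s a 0" and "\<sigma>' = shifted_seq s b 0"
  have \<sigma>: "\<sigma> > 0" "\<sigma>' > 0" unfolding \<sigma>_def \<sigma>'_def a_def b_def using F by (auto intro: shifted_pos)
  have ab: "a < b" unfolding a_def b_def using t by (intro c_strict_decreasing) auto
  have ind: "indeterminate (shifted_seq s a)" using shifted_indet_S[OF t] by (simp add: indet_S_def a_def)
  note \<mu> = N_ext(1)[of "ereal F"]
  note sets = V_D(1)[OF \<mu>]
  have supp: "supp ?\<mu> \<subseteq> {b..}" unfolding b_def using c_props(3)[of F] by simp
  then have suppa: "supp ?\<mu> \<subseteq> {a..}" using ab by force
  note \<nu> = linear_density_V[OF \<mu> suppa] linear_density_V[OF \<mu> supp]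
  interpret T: moment_sequence "normalize_seq (shifted_seq s a)" by (rule moment_sequence_normalize[OF \<nu>(1)])
  interpret T: indeterminate_sequence "normalize_seq (shifted_seq s a)"
    by unfold_locales (rule indeterminate_normalize[OF ind])
  interpret R: moment_sequence "normalize_seq (shifted_seq s b)" by (rule moment_sequence_normalize[OF \<nu>(3)])
  define \<nu>' where "\<nu>' = scale_measure (ennreal (1 / \<sigma>)) (linear_density a ?\<mu>)"
  have \<nu>': "\<nu>' \<in> V (normalize_seq (shifted_seq s a))" unfolding \<nu>'_def \<sigma>_def by (rule V_normalize[OF \<nu>(1)])
  define m where "m = measure ?\<mu> {b}"
  have \<nu>'b: "measure \<nu>' {b} = (b - a) * m / \<sigma>"
    unfolding \<nu>'_def \<sigma>_def a_def b_def m_def using F by (intro measure_nu) auto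
  obtain \<delta> where \<delta>: "\<delta> > 0" "AE y in ?\<mu>. y = b \<or> b + \<delta> \<le> y"
    unfolding b_def by (rule N_ext_isolated[OF order_refl])
  \<comment> \<open>The least factor with y - a \<le> l (y - b) for all y \<ge> b + \<delta>;
    equality holds at y = b + \<delta>.\<close>
  define l where "l = 1 + (b - a) / \<delta>"
  have l: "l > 0" unfolding l_def using ab \<delta>(1) by (intro add_pos_pos) auto
  have bound: "\<sigma> / T.\<kappa> b \<le> (b - a) * m + \<epsilon>" if \<epsilon>: "\<epsilon> > 0" for \<epsilon>
  proof -
    \<comment> \<open>Chosen to make the remainder l \<sigma>' / k at most \<epsilon>.\<close>
    obtain n where n: "n > 0" "poly (R.kern b n) b > l * \<sigma>' / \<epsilon>"
      using kern_at_c_F_unbounded[of "l * \<sigma>' / \<epsilon>"] l \<sigma> \<epsilon> unfolding b_def by auto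
    define k where "k = poly (R.kern b n) b"
    define f where "f = smult (1 / k) (R.kern b n)"
    have fb: "poly f b = 1" and Rf: "R.L (f * f) = 1 / k"
      using R.normalized_kern[OF n(1), of b] by (auto simp: f_def k_def)
    have k: "k > 0" using n(2) l \<sigma> \<epsilon> unfolding k_def by (meson divide_pos_pos less_trans mult_pos_pos)
    have i: "integrable ?\<mu> (\<lambda>y. (y - x) * poly (f * f) y)" for x
      using V_D(5)[OF \<mu>, of "[:- x, 1:] * (f * f)"] by (simp add: algebra_simps)
    have j: "integrable ?\<mu> (\<lambda>y. (b - a) * indicator {b} y)" "(\<integral>y. (b - a) * indicator {b} y \<partial>?\<mu>) = m * (b - a)"
      using integral_indicator_singleton_mult[OF V_D(3)[OF \<mu>] sets, of "\<lambda>_. b - a" b] by (simp_all add: m_def)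
    have "\<sigma> * T.L (f * f) = (\<integral>y. (y - a) * poly (f * f) y \<partial>?\<mu>)"
      unfolding \<sigma>_def by (rule moment_functional_shifted[OF \<mu> suppa])
    also have "\<dots> \<le> (\<integral>y. (b - a) * indicator {b} y + l * ((y - b) * poly (f * f) y) \<partial>?\<mu>)"
    proof (rule integral_mono_AE)
      show "AE y in ?\<mu>. (y - a) * poly (f * f) y \<le> (b - a) * indicator {b} y + l * ((y - b) * poly (f * f) y)"
        using \<delta>(2)
      proof eventually_elim
        fix y assume y: "y = b \<or> b + \<delta> \<le> y"
        show "(y - a) * poly (f * f) y \<le> (b - a) * indicator {b} y + l * ((y - b) * poly (f * f) y)"
        proof (cases "y = b")
          case True
          then show ?thesis by (simp add: fb)
        next
          case False
          then have "\<delta> \<le> y - b" using y by simp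
          then have "(l - 1) * \<delta> \<le> (l - 1) * (y - b)"
            using ab \<delta>(1) unfolding l_def by (intro mult_left_mono) auto
          moreover have "(l - 1) * \<delta> = b - a" using \<delta>(1) by (simp add: l_def)
          ultimately have "y - a \<le> l * (y - b)" by (simp add: algebra_simps)
          then have "(y - a) * poly (f * f) y \<le> (l * (y - b)) * poly (f * f) y"
            by (intro mult_right_mono) auto
          then show ?thesis using False by (simp add: mult.assoc)
        qed
      qed
    qed (use i j in auto)
    also have "\<dots> = (b - a) * m + l * (\<sigma>' * R.L (f * f))"
      unfolding \<sigma>'_def moment_functional_shifted[OF \<mu> supp] using i[of b] j by simp
    also have "\<dots> = (b - a) * m + l * \<sigma>' / k" by (simp add: Rf)
    also have "l * \<sigma>' / k \<le> \<epsilon>" using n(2) \<epsilon> k by (simp add: k_def[symmetric] field_simps)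
    finally have "\<sigma> * T.L (f * f) \<le> (b - a) * m + \<epsilon>" by simp
    moreover have "1 / T.\<kappa> b \<le> T.L (f * f)"
      using T.christoffel_bound[of f b] fb T.\<kappa>_ge_1[of b] by (simp add: field_simps)
    then have "\<sigma> * (1 / T.\<kappa> b) \<le> \<sigma> * T.L (f * f)" using \<sigma> by (intro mult_left_mono) auto
    ultimately show ?thesis by simp
  qed
  have "\<sigma> / T.\<kappa> b \<le> (b - a) * m" by (rule field_le_epsilon) (rule bound)
  then have "measure \<nu>' {b} * T.\<kappa> b \<ge> 1"
    unfolding \<nu>'b using \<sigma> T.\<kappa>_ge_1[of b] by (simp add: field_simps)
  moreover obtain u where "T.G u (of_real b) = 0" using T.ex_G_zero by blast
  ultimately have "\<nu>' = N_ext (normalize_seq (shifted_seq s a)) u" using \<nu>' by (intro T.max_mass_eq_N_ext)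
  then have "linear_density a ?\<mu> = scale_measure (ennreal \<sigma>) (N_ext (normalize_seq (shifted_seq s a)) u)"
    using scale_measure_inverse(1)[OF \<sigma>(1), of "linear_density a ?\<mu>"] by (simp only: \<nu>'_def)
  then show ?thesis unfolding is_N_extremal_def using ind by (auto simp: a_def \<sigma>_def)
qed

text \<open>An N-extremal measure with an atom at b has maximal mass there. Testing with the
  minimizers for (y - a) d\<mu>, and using (y - b) f^2 \<le> (y - a) f^2 off b, leaves at least
  \<sigma>' / \<kappa>(b) > 0 between that maximum and the actual mass, both before normalization;
  here \<kappa> belongs to the sequence shifted by b, which is indeterminate because t' > F.\<close>

lemma nu_not_N_extremal:
  assumes t: "F < t'" "t' < t"
  shows "\<not> is_N_extremal (shifted_seq s (c t)) (linear_density (c t) (N_ext s (ereal t')))"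
proof
  assume ext: "is_N_extremal (shifted_seq s (c t)) (linear_density (c t) (N_ext s (ereal t')))"
  have F: "F \<le> t" "F \<le> t'" "t' \<le> t" using t by auto
  let ?\<mu> = "N_ext s (ereal t')"
  define a b where "a = c t" and "b = c t'"
  define \<sigma> \<sigma>' where "\<sigma> = shifted_seq s a 0" and "\<sigma>' = shifted_seq s b 0"
  have \<sigma>: "\<sigma> > 0" "\<sigma>' > 0" unfolding \<sigma>_def \<sigma>'_def a_def b_def using F by (auto intro: shifted_pos)
  have ab: "a < b" unfolding a_def b_def using t F by (intro c_strict_decreasing) auto
  have ind: "indeterminate (shifted_seq s a)" "indeterminate (shifted_seq s b)"
    using shifted_indet_S[of t] shifted_indet_S[of t'] t by (auto simp: indet_S_def a_def b_def)
  note \<mu> = N_ext(1)[of "ereal t'"]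
  note sets = V_D(1)[OF \<mu>]
  have supp: "supp ?\<mu> \<subseteq> {b..}" unfolding b_def using c_props(3)[OF F(2)] by simp
  then have suppa: "supp ?\<mu> \<subseteq> {a..}" using ab by force
  note \<nu> = linear_density_V[OF \<mu> suppa] linear_density_V[OF \<mu> supp]
  interpret T: moment_sequence "normalize_seq (shifted_seq s a)" by (rule moment_sequence_normalize[OF \<nu>(1)])
  interpret T: indeterminate_sequence "normalize_seq (shifted_seq s a)"
    by unfold_locales (rule indeterminate_normalize[OF ind(1)])
  interpret R: moment_sequence "normalize_seq (shifted_seq s b)" by (rule moment_sequence_normalize[OF \<nu>(3)])
  interpret R: indeterminate_sequence "normalize_seq (shifted_seq s b)"
    by unfold_locales (rule indeterminate_normalize[OF ind(2)])
  obtain u where u: "linear_density a ?\<mu> = scale_measure (ennreal \<sigma>) (N_ext (normalize_seq (shifted_seq s a)) u)"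
    using ext unfolding is_N_extremal_def a_def \<sigma>_def by blast
  have \<nu>': "N_ext (normalize_seq (shifted_seq s a)) u = scale_measure (ennreal (1 / \<sigma>)) (linear_density a ?\<mu>)"
    unfolding u scale_measure_inverse(2)[OF \<sigma>(1)] ..
  define m where "m = measure ?\<mu> {b}"
  have \<nu>'b: "measure (N_ext (normalize_seq (shifted_seq s a)) u) {b} = (b - a) * m / \<sigma>"
    unfolding \<nu>' unfolding \<sigma>_def a_def b_def m_def using F by (intro measure_nu) auto
  have m: "m > 0" unfolding m_def b_def by (rule N_ext_mass_c_pos[OF F(2)])
  have "measure (N_ext (normalize_seq (shifted_seq s a)) u) {b} \<noteq> 0" unfolding \<nu>'b using m ab \<sigma> by simp
  then have "emeasure (N_ext (normalize_seq (shifted_seq s a)) u) {b} \<noteq> 0" by (auto simp: measure_def)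
  then have "b \<in> supp (N_ext (normalize_seq (shifted_seq s a)) u)"
    using V_D(1)[OF T.N_ext(1)] by (intro in_supp_if_atom) (auto simp: zero_less_iff_neq_zero)
  then have "T.G u (of_real b) = 0" by (simp add: T.supp_N_ext)
  then have mass: "(b - a) * m / \<sigma> * T.\<kappa> b = 1" unfolding \<nu>'b[symmetric] by (rule T.N_ext_mass)
  have bound: "\<sigma>' / R.\<kappa> b \<le> \<sigma> / poly (T.kern b n) b - (b - a) * m" if n: "n > 0" for n
  proof -
    define k where "k = poly (T.kern b n) b"
    define f where "f = smult (1 / k) (T.kern b n)"
    have fb: "poly f b = 1" and Tf: "T.L (f * f) = 1 / k"
      using T.normalized_kern[OF n, of b] by (auto simp: f_def k_def)
    have i: "integrable ?\<mu> (\<lambda>y. (y - x) * poly (f * f) y)" for x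
      using V_D(5)[OF \<mu>, of "[:- x, 1:] * (f * f)"] by (simp add: algebra_simps)
    have j: "integrable ?\<mu> (\<lambda>y. (b - a) * indicator {b} y)" "(\<integral>y. (b - a) * indicator {b} y \<partial>?\<mu>) = m * (b - a)"
      using integral_indicator_singleton_mult[OF V_D(3)[OF \<mu>] sets, of "\<lambda>_. b - a" b] by (simp_all add: m_def)
    have "\<sigma>' * R.L (f * f) = (\<integral>y. (y - b) * poly (f * f) y \<partial>?\<mu>)"
      unfolding \<sigma>'_def by (rule moment_functional_shifted[OF \<mu> supp])
    also have "\<dots> \<le> (\<integral>y. (y - a) * poly (f * f) y - (b - a) * indicator {b} y \<partial>?\<mu>)"
    proof (rule integral_mono)
      fix y
      show "(y - b) * poly (f * f) y \<le> (y - a) * poly (f * f) y - (b - a) * indicator {b} y"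
      proof (cases "y = b")
        case True
        then show ?thesis by (simp add: fb)
      next
        case False
        have "(y - b) * poly (f * f) y \<le> (y - a) * poly (f * f) y" using ab by (intro mult_right_mono) auto
        then show ?thesis using False by simp
      qed
    qed (use i j in auto)
    also have "\<dots> = \<sigma> * T.L (f * f) - (b - a) * m"
      unfolding \<sigma>_def moment_functional_shifted[OF \<mu> suppa] using i[of a] j by simp
    finally have "\<sigma>' * R.L (f * f) \<le> \<sigma> / k - (b - a) * m" by (simp add: Tf)
    moreover have "1 / R.\<kappa> b \<le> R.L (f * f)"
      using R.christoffel_bound[of f b] fb R.\<kappa>_ge_1[of b] by (simp add: field_simps)
    then have "\<sigma>' * (1 / R.\<kappa> b) \<le> \<sigma>' * R.L (f * f)" using \<sigma> by (intro mult_left_mono) auto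
    ultimately show ?thesis by (simp add: k_def)
  qed
  have "(\<lambda>n. \<sigma> / poly (T.kern b n) b - (b - a) * m) \<longlonglongrightarrow> \<sigma> / T.\<kappa> b - (b - a) * m"
    using T.\<kappa>_ge_1[of b] by (intro tendsto_intros T.kern_tendsto_\<kappa>) auto
  moreover have "eventually (\<lambda>n. \<sigma>' / R.\<kappa> b \<le> \<sigma> / poly (T.kern b n) b - (b - a) * m) sequentially"
    using eventually_gt_at_top[of 0] by (rule eventually_mono) (rule bound)
  ultimately have "\<sigma>' / R.\<kappa> b \<le> \<sigma> / T.\<kappa> b - (b - a) * m" by (rule tendsto_lowerbound) simp
  \<comment> \<open>Maximal mass makes (b - a) m equal to \<sigma> divided by \<kappa>(b) of the
    sequence shifted by a, so a positive number would be at most 0.\<close>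
  also have "\<dots> = 0" using mass \<sigma> T.\<kappa>_ge_1[of b] by (simp add: field_simps)
  finally show False using \<sigma> R.\<kappa>_ge_1[of b] by (simp add: divide_le_0_iff)
qed

end

text \<open>Maximal mass at 0 forces a solution to be the one with parameter \<infinity>, so of two
  distinct solutions on the half-line one has smaller mass at 0, and that one makes the Friedrichs
  parameter finite.\<close>

lemma indet_S_friedrichs_sequence:
  assumes "normalized s" "indet_S s"
  shows "\<exists>F. friedrichs_sequence s F"
proof -
  obtain \<mu> \<nu> where mn: "\<mu> \<in> V s" "\<nu> \<in> V s" "supp \<mu> \<subseteq> {0..}" "supp \<nu> \<subseteq> {0..}" "\<mu> \<noteq> \<nu>"
    using assms(2) unfolding indet_S_def by blast
  interpret moment_sequence s using assms(1) mn(1) by unfold_locales (auto simp: normalized_def)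
  interpret indeterminate_sequence s using assms(2) by unfold_locales (simp add: indet_S_def)
  have G0: "G \<infinity> (of_real 0) = 0" by (simp add: G_def Nev_D_def)
  have "\<not> (measure \<mu> {0} * \<kappa> 0 \<ge> 1 \<and> measure \<nu> {0} * \<kappa> 0 \<ge> 1)"
    using max_mass_eq_N_ext[OF G0] mn by metis
  then obtain F where "\<tau> \<longlonglongrightarrow> F"
    using friedrichs_param_finite[OF mn(1,3)] friedrichs_param_finite[OF mn(2,4)] by (auto simp: not_le)
  then have "friedrichs_sequence s F" by unfold_locales (use mn in auto)
  then show ?thesis by blast
qed

theorem theorem3p6:
  fixes s :: "nat \<Rightarrow> real" and c :: "ereal \<Rightarrow> real" and F :: ereal
  assumes "normalized s" and "indet_S s"
    and F_def: "F = friedrichs_param s"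
    and c_def: "\<And>t. c t = \<xi> (N_ext s t)"
  shows
    "(\<forall>t. F \<le> t \<and> t < \<infinity> \<longrightarrow>
        stieltjes (shifted_seq s (c t)) \<and>
        (t = F \<longrightarrow> determinate (shifted_seq s (c t))) \<and>
        (F < t \<longrightarrow> indet_S (shifted_seq s (c t)))) \<and>
     V (shifted_seq s (c F)) = {linear_density (c F) (N_ext s F)} \<and>
     (\<forall>t. F < t \<and> t < \<infinity> \<longrightarrow>
        (\<forall>t'. F \<le> t' \<and> t' \<le> t \<longrightarrow>
           linear_density (c t) (N_ext s t') \<in> V (shifted_seq s (c t))) \<and>
        linear_density (c t) (N_ext s t) = friedrichs_solution (shifted_seq s (c t)) \<and>
        is_N_extremal (shifted_seq s (c t)) (linear_density (c t) (N_ext s F)) \<and>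
        (\<forall>t'. F < t' \<and> t' < t \<longrightarrow>
           \<not> is_N_extremal (shifted_seq s (c t)) (linear_density (c t) (N_ext s t'))))"
proof -
  obtain F0 where "friedrichs_sequence s F0"
    using indet_S_friedrichs_sequence[OF assms(1,2)] by blast
  then interpret S: friedrichs_sequence s F0 .
  have F: "F = ereal F0" using F_def S.friedrichs_param_eq by simp
  have c: "c (ereal t) = S.c t" for t by (simp add: c_def S.c_def)
  \<comment> \<open>Finiteness of F excludes both infinite values of t, so the results for real
    parameters cover the whole range.\<close>
  have real: "\<exists>r\<ge>F0. t = ereal r" if "F \<le> t" "t < \<infinity>" for t
    using that unfolding F by (cases t) auto
  have det: "determinate (shifted_seq s (S.c F0))"
    unfolding determinate_def using S.V_shifted_F by blast
  have 1: "stieltjes (shifted_seq s (c t)) \<and> (t = F \<longrightarrow> determinate (shifted_seq s (c t))) \<and>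
      (F < t \<longrightarrow> indet_S (shifted_seq s (c t)))" if t: "F \<le> t" "t < \<infinity>" for t
  proof -
    obtain r where r: "F0 \<le> r" "t = ereal r" using real[OF t] by blast
    then show ?thesis using S.shifted_stieltjes[of r] S.shifted_indet_S[of r] det by (auto simp: F c)
  qed
  have 2: "V (shifted_seq s (c F)) = {linear_density (c F) (N_ext s F)}"
    unfolding F c by (rule S.V_shifted_F)
  have 3: "(\<forall>t'. F \<le> t' \<and> t' \<le> t \<longrightarrow> linear_density (c t) (N_ext s t') \<in> V (shifted_seq s (c t))) \<and>
        linear_density (c t) (N_ext s t) = friedrichs_solution (shifted_seq s (c t)) \<and>
        is_N_extremal (shifted_seq s (c t)) (linear_density (c t) (N_ext s F)) \<and>
        (\<forall>t'. F < t' \<and> t' < t \<longrightarrow>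
           \<not> is_N_extremal (shifted_seq s (c t)) (linear_density (c t) (N_ext s t')))"
    if t: "F < t" "t < \<infinity>" for t
  proof -
    obtain r where r: "F0 \<le> r" "t = ereal r" using real[of t] t by (meson less_imp_le)
    then have r: "F0 < r" "t = ereal r" using t by (auto simp: F)
    show ?thesis
    proof (intro conjI allI impI)
      fix t' assume t': "F \<le> t' \<and> t' \<le> t"
      then obtain r' where r': "F0 \<le> r'" "t' = ereal r'" using real[of t'] t by (meson le_less_trans)
      then show "linear_density (c t) (N_ext s t') \<in> V (shifted_seq s (c t))"
        using t' r S.nu_in_V(1)[of r' r] by (simp add: c)
    next
      fix t' assume t': "F < t' \<and> t' < t"
      then obtain r' where r': "F0 \<le> r'" "t' = ereal r'" using real[of t'] t by (meson less_imp_le less_trans)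
      then show "\<not> is_N_extremal (shifted_seq s (c t)) (linear_density (c t) (N_ext s t'))"
        using t' r S.nu_not_N_extremal[of r' r] by (simp add: c F)
    qed (use r S.nu_friedrichs[of r] S.nu_F_N_extremal[of r] in \<open>simp_all add: c F\<close>)
  qed
  show ?thesis using 1 2 3 by blast
qed

end
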